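(* Suppose that conditions (A1), (A2), (A3) of the context hold. Then, on the product space $\mathbb{R}^{\tilde E}$ equipped with the product topology, $$\sqrt{M}\,\bigl(\hat{\bm q}(M)-\bm q\bigr)\ \xrightarrow[M\to\infty]{\ \mathrm d\ }\ \mathcal N(\bm 0,V^{\bm q})$$ (convergence in distribution) under $\mathbb P_{i_0}$ for every initial value $i_0\in E$, where the asymptotic variance matrix $V^{\bm q}=(V^{\bm q}_{ee'})_{e,e'\in\tilde E}$ is given by $$V^{\bm q}_{(i,j,k)(i',j',k')}=\mu_{ii}\,1_{\{i=i'\}}\,q_{ij}(k)\,\bigl(1_{\{j=j',\,k=k'\}}-q_{i'j'}(k')\bigr).$$
   Context: $E$ is a finite (nonempty) set, $\mathbb N=\{0,1,2,\dots\}$, $\tilde E:=E\times E\times\mathbb N$. Let $\bm q=(q_{ij}(k))_{(i,j,k)\in\tilde E}$ be nonnegative numbers with $q_{ij}(0)=0$ for all $i,j\in E$ and $\sum_{j\in E}\sum_{k\in\mathbb N}q_{ij}(k)=1$ for all $i\in E$. Markov renewal chain: for each $i_0\in E$, under the probability $\mathbb P_{i_0}$ (expectation $\mathbb E_{i_0}$), $(J_n,S_n)_{n\ge0}$ is an $E\times\mathbb N$-valued process with $J_0=i_0$, $S_0=X_0=0$, $X_n:=S_n-S_{n-1}$ for $n\ge1$, such that $(J_n,X_n)_{n\ge 0}$ is a Markov chain with $\mathbb P_{i_0}(J_{n+1}=j,\,X_{n+1}=k\mid J_n=i,\,X_n)=q_{ij}(k)$. Let $\tau_j=\inf\{n\ge1:J_n=j\}$.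 Conditions: (A1) the embedded Markov chain $J$ is irreducible: $\mathbb P_i(\tau_j<\infty)>0$ for all $i,j\in E$. (A2) aperiodicity: for all $i\in E$, the greatest common divisor of $\{k\in\mathbb N:\mathbb P_i(S_{\tau_i}=k)>0\}$ is one. (A3) positive recurrence: $\mu_{ii}:=\mathbb E_i S_{\tau_i}<\infty$ for all $i\in E$. Estimator: for $M\in\mathbb N$, $N(M):=\max\{n\in\mathbb N:S_n\le M\}$, $N_i(M):=\sum_{n=1}^{N(M)}1_{\{J_{n-1}=i\}}$, and $\hat{\bm q}(M)=(\hat q_{ij}(k,M))_{(i,j,k)\in\tilde E}$ with $$\hat q_{ij}(k,M):=\frac1{N_i(M)}\sum_{n=1}^{N(M)}1_{\{J_{n-1}=i,\,J_n=j,\,X_n=k\}}$$ (interpreted as $0$ when $N_i(M)=0$). For a nonnegative definite matrix $V=(V_{ee'})_{e,e'\in\tilde E}$, $\mathcal N(\bm0,V)$ is the law on $\mathbb R^{\tilde E}$ of a centered Gaussian system $(Y_e)_{e\in\tilde E}$ with $\mathbb E\,Y_eY_{e'}=V_{ee'}$. *)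

theory Defs
  imports "HOL-Probability.Probability"
begin

definition semi_markov_kernel :: "('e::finite \<Rightarrow> 'e \<Rightarrow> nat \<Rightarrow> real) \<Rightarrow> bool" where
  "semi_markov_kernel q \<longleftrightarrow>
     (\<forall>i j k. 0 \<le> q i j k) \<and> (\<forall>i j. q i j 0 = 0) \<and>
     (\<forall>i j. summable (q i j)) \<and> (\<forall>i. (\<Sum>j\<in>UNIV. \<Sum>k. q i j k) = 1)"

definition markov_chain :: "'w measure \<Rightarrow> ('s::countable \<Rightarrow> 's \<Rightarrow> real) \<Rightarrow> (nat \<Rightarrow> 'w \<Rightarrow> 's) \<Rightarrow> bool" where
  "markov_chain M K Z \<longleftrightarrow>
     prob_space M \<and> (\<forall>n. Z n \<in> measurable M (count_space UNIV)) \<and>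
     (\<forall>n z s. measure M {w \<in> space M. \<forall>m\<le>n. Z m w = z m} > 0 \<longrightarrow>
        cond_prob M (\<lambda>w. Z (Suc n) w = s) (\<lambda>w. \<forall>m\<le>n. Z m w = z m) = K (z n) s)"

text \<open>The subtraction of natural numbers truncates. Under the law of a Markov renewal chain this
  is harmless: since \<open>q i j 0 = 0\<close>, almost surely \<open>sojourn S n w \<ge> 1\<close> for all \<open>n \<ge> 1\<close>, which forces
  \<open>S (n - 1) w < S n w\<close>, so that the difference is the true one. For \<open>n = 0\<close> the value is \<open>0\<close>.\<close>

definition sojourn :: "(nat \<Rightarrow> 'w \<Rightarrow> nat) \<Rightarrow> nat \<Rightarrow> 'w \<Rightarrow> nat" where
  "sojourn S n w = S n w - S (n - 1) w"

text \<open>All the laws \<open>P i\<^sub>0\<close> govern the same process \<open>(J, S)\<close>, so the initial value is only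
  prescribed almost surely.\<close>

definition markov_renewal_chain ::
  "('e::finite \<Rightarrow> 'e \<Rightarrow> nat \<Rightarrow> real) \<Rightarrow> ('e \<Rightarrow> 'w measure) \<Rightarrow> (nat \<Rightarrow> 'w \<Rightarrow> 'e) \<Rightarrow> (nat \<Rightarrow> 'w \<Rightarrow> nat) \<Rightarrow> bool" where
  "markov_renewal_chain q P J S \<longleftrightarrow>
     (\<forall>i\<^sub>0. prob_space (P i\<^sub>0) \<and>
        (\<forall>n. J n \<in> measurable (P i\<^sub>0) (count_space UNIV)) \<and>
        (\<forall>n. S n \<in> measurable (P i\<^sub>0) (count_space UNIV)) \<and>
        (AE w in P i\<^sub>0. J 0 w = i\<^sub>0 \<and> S 0 w = 0) \<and>
        markov_chain (P i\<^sub>0) (\<lambda>(i, x) (j, k). q i j k) (\<lambda>n w. (J n w, sojourn S n w)))"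

definition hit_time :: "(nat \<Rightarrow> 'w \<Rightarrow> 'e) \<Rightarrow> 'e \<Rightarrow> 'w \<Rightarrow> enat" where
  "hit_time J j w = Inf {enat n | n. n \<ge> 1 \<and> J n w = j}"

text \<open>The value of \<open>S\<close> at the time \<open>hit_time J j\<close>, infinite if that time is infinite.\<close>

definition S_at_hit :: "(nat \<Rightarrow> 'w \<Rightarrow> 'e) \<Rightarrow> (nat \<Rightarrow> 'w \<Rightarrow> nat) \<Rightarrow> 'e \<Rightarrow> 'w \<Rightarrow> enat" where
  "S_at_hit J S j w = (case hit_time J j w of enat n \<Rightarrow> enat (S n w) | \<infinity> \<Rightarrow> \<infinity>)"

definition mean_return :: "('e \<Rightarrow> 'w measure) \<Rightarrow> (nat \<Rightarrow> 'w \<Rightarrow> 'e) \<Rightarrow> (nat \<Rightarrow> 'w \<Rightarrow> nat) \<Rightarrow> 'e \<Rightarrow> ennreal" where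
  "mean_return P J S i = (\<integral>\<^sup>+ w. ennreal_of_enat (S_at_hit J S i w) \<partial>P i)"

definition irreducible_chain :: "('e \<Rightarrow> 'w measure) \<Rightarrow> (nat \<Rightarrow> 'w \<Rightarrow> 'e) \<Rightarrow> bool" where
  "irreducible_chain P J \<longleftrightarrow>
     (\<forall>i j. measure (P i) {w \<in> space (P i). hit_time J j w < \<infinity>} > 0)"

definition aperiodic_chain :: "('e \<Rightarrow> 'w measure) \<Rightarrow> (nat \<Rightarrow> 'w \<Rightarrow> 'e) \<Rightarrow> (nat \<Rightarrow> 'w \<Rightarrow> nat) \<Rightarrow> bool" where
  "aperiodic_chain P J S \<longleftrightarrow>
     (\<forall>i. Gcd {k::nat. measure (P i) {w \<in> space (P i). S_at_hit J S i w = enat k} > 0} = 1)"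

definition positive_recurrent_chain :: "('e \<Rightarrow> 'w measure) \<Rightarrow> (nat \<Rightarrow> 'w \<Rightarrow> 'e) \<Rightarrow> (nat \<Rightarrow> 'w \<Rightarrow> nat) \<Rightarrow> bool" where
  "positive_recurrent_chain P J S \<longleftrightarrow> (\<forall>i. mean_return P J S i < \<infinity>)"

text \<open>The set is almost surely finite and nonempty; elsewhere \<open>Max\<close> is a fixed unspecified number.\<close>

definition num_jumps :: "(nat \<Rightarrow> 'w \<Rightarrow> nat) \<Rightarrow> nat \<Rightarrow> 'w \<Rightarrow> nat" where
  "num_jumps S M w = Max {n. S n w \<le> M}"

definition num_visits :: "(nat \<Rightarrow> 'w \<Rightarrow> 'e) \<Rightarrow> (nat \<Rightarrow> 'w \<Rightarrow> nat) \<Rightarrow> 'e \<Rightarrow> nat \<Rightarrow> 'w \<Rightarrow> nat" where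
  "num_visits J S i M w = (\<Sum>n=1..num_jumps S M w. of_bool (J (n - 1) w = i))"

text \<open>Division by zero yields \<open>0\<close>, as required when there are no visits.\<close>

definition q_hat :: "(nat \<Rightarrow> 'w \<Rightarrow> 'e) \<Rightarrow> (nat \<Rightarrow> 'w \<Rightarrow> nat) \<Rightarrow> nat \<Rightarrow> 'w \<Rightarrow> 'e \<Rightarrow> 'e \<Rightarrow> nat \<Rightarrow> real" where
  "q_hat J S M w i j k =
     1 / real (num_visits J S i M w) *
     (\<Sum>n=1..num_jumps S M w. of_bool (J (n - 1) w = i \<and> J n w = j \<and> sojourn S n w = k))"

text \<open>Constants count as (degenerate) Gaussian random variables.\<close>

definition gaussian_rv :: "'w measure \<Rightarrow> ('w \<Rightarrow> real) \<Rightarrow> bool" where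
  "gaussian_rv M X \<longleftrightarrow> X \<in> borel_measurable M \<and>
     ((\<exists>m. AE w in M. X w = m) \<or>
      (\<exists>m \<sigma>. \<sigma> > 0 \<and> distributed M lborel X (\<lambda>x. ennreal (normal_density m \<sigma> x))))"

definition centered_gaussian_system ::
  "'w measure \<Rightarrow> ('a \<Rightarrow> 'w \<Rightarrow> real) \<Rightarrow> ('a \<Rightarrow> 'a \<Rightarrow> real) \<Rightarrow> bool" where
  "centered_gaussian_system M Y V \<longleftrightarrow>
     prob_space M \<and>
     (\<forall>F c. finite F \<longrightarrow> gaussian_rv M (\<lambda>w. \<Sum>e\<in>F. c e * Y e w)) \<and>
     (\<forall>e. (\<integral>w. Y e w \<partial>M) = 0) \<and>
     (\<forall>e e'. (\<integral>w. Y e w * Y e' w \<partial>M) = V e e')"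

text \<open>\<open>\<mu>\<close> is the law \<open>N(0, V)\<close> on the space of all real families indexed by \<open>'a\<close>. The Borel sets are
  those of the product topology. The law is determined by \<open>V\<close>, as the finite-dimensional marginals
  are; it exists only if \<open>V\<close> is nonnegative definite.\<close>

definition centered_gaussian_law :: "('a::countable \<Rightarrow> 'a \<Rightarrow> real) \<Rightarrow> ('a \<Rightarrow> real) measure \<Rightarrow> bool" where
  "centered_gaussian_law V \<mu> \<longleftrightarrow>
     sets \<mu> = sets borel \<and> centered_gaussian_system \<mu> (\<lambda>e y. y e) V"

definition converges_in_distribution ::
  "'w measure \<Rightarrow> (nat \<Rightarrow> 'w \<Rightarrow> 'b::topological_space) \<Rightarrow> 'b measure \<Rightarrow> bool" where
  "converges_in_distribution M Z \<mu> \<longleftrightarrow>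
     prob_space M \<and> (\<forall>n. Z n \<in> borel_measurable M) \<and>
     prob_space \<mu> \<and> sets \<mu> = sets borel \<and>
     (\<forall>f :: 'b \<Rightarrow> real. continuous_on UNIV f \<and> bounded (range f) \<longrightarrow>
        (\<lambda>n. \<integral>w. f (Z n w) \<partial>M) \<longlonglongrightarrow> (\<integral>y. f y \<partial>\<mu>))"

definition asymp_var ::
  "('e \<Rightarrow> 'e \<Rightarrow> nat \<Rightarrow> real) \<Rightarrow> ('e \<Rightarrow> real) \<Rightarrow> 'e \<times> 'e \<times> nat \<Rightarrow> 'e \<times> 'e \<times> nat \<Rightarrow> real" where
  "asymp_var q \<mu> = (\<lambda>(i, j, k) (i', j', k').
     \<mu> i * of_bool (i = i') * q i j k * (of_bool (j = j' \<and> k = k') - q i' j' k'))"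

end

theory Submission
  imports Defs "HOL-Real_Asymp.Real_Asymp"
begin

text \<open>
  Let \<open>\<nu>\<close> be the index of the first jump beyond time \<open>M\<close>. The weights \<open>1\<close> if \<open>n \<le> \<nu>\<close>, \<open>0\<close> otherwise are
  predictable and \<open>\<nu> \<le> M + 1\<close>, so sums up to \<open>\<nu>\<close> of martingale differences are treated as weighted sums
  over the first \<open>M + 1\<close> jumps. With the solution of a Poisson equation given by the mean hitting times,
  a law of large numbers in mean yields that the number of visits to \<open>i\<close> is \<open>M / \<mu>\<^sub>i\<^sub>i + o(M)\<close> in mean;
  only first moments of the sojourn times are needed. A linear form of the
  estimation error is, up to replacing the number of visits to \<open>i\<close> by \<open>M / \<mu>\<^sub>i\<^sub>i\<close>, a sum up to \<open>\<nu>\<close> of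
  bounded martingale differences divided by \<open>sqrt M\<close>; the accumulated conditional variances converge by
  the law of large numbers, which gives the limit of the characteristic function. The limit law is
  constructed from independent standard normal variables by a Cholesky factorisation, and the
  Cramer-Wold device for countably many coordinates concludes.\<close>

section \<open>The Cramer-Wold device for countable products\<close>

text \<open>The obstacle is the normalisation: both the number of summands and the divisor are
  random, and they depend on unbounded sojourn times. The indicators that enter the estimator are
  bounded, so the martingale part has all moments; unbounded variables occur only in the count of
  visits, and there convergence in mean suffices. Since every sojourn time is at least one,
  \<open>Suc M\<close> jumps always lead beyond time \<open>M\<close>. Every quantity is therefore a
  function of a list of fixed length with a discrete law, and neither filtrations nor optional
  stopping are needed. The factor \<open>\<mu> i\<close> in the variance: the sum of centred
  indicators over the visits to i has about M / \<mu> terms, and division by the number of visits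
  amounts to multiplication by \<mu> / M. After scaling, this gives \<mu>^2 * (1 / \<mu>) times the
  covariance of the indicators of a single jump out of i, which is multinomial. Jumps out of
  different states contribute no covariance, whence the block structure.\<close>

inductive_set trig_poly :: "(('i \<Rightarrow> real) \<Rightarrow> real) set" where
  cos: "finite F \<Longrightarrow> (\<lambda>x. cos ((\<Sum>e\<in>F. c e * x e) + b)) \<in> trig_poly"
| add: "f \<in> trig_poly \<Longrightarrow> g \<in> trig_poly \<Longrightarrow> (\<lambda>x. f x + g x) \<in> trig_poly"
| scale: "f \<in> trig_poly \<Longrightarrow> (\<lambda>x. a * f x) \<in> trig_poly"

lemma trig_poly_const: "(\<lambda>x. a) \<in> trig_poly"
  using trig_poly.scale[OF trig_poly.cos[of "{}" "\<lambda>_. 0" 0], of a] by simp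

lemma trig_poly_sin: "(\<lambda>x. sin (a * x e)) \<in> trig_poly"
proof -
  have "cos (a * x e - pi / 2) = sin (a * x e)" for x :: "'a \<Rightarrow> real"
    by (simp add: cos_diff)
  then show ?thesis
    using trig_poly.cos[of "{e}" "\<lambda>_. a" "-(pi / 2)"] by simp
qed

text \<open>Products are no constructor of \<open>trig_poly\<close>, because convergence of
  integrals is later proved by induction over the constructors and would not pass through products.
  They come from the product-to-sum formula, once both coefficient families are extended by zero to
  a common index set.\<close>

lemma trig_poly_cos_mult_cos:
  fixes c d :: "'i \<Rightarrow> real"
  assumes "finite F" "finite G"
  shows "(\<lambda>x. cos ((\<Sum>e\<in>F. c e * x e) + b) * cos ((\<Sum>e\<in>G. d e * x e) + b')) \<in> trig_poly"
proof -
  define c' where "c' e = (if e \<in> F then c e else 0)" for e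
  define d' where "d' e = (if e \<in> G then d e else 0)" for e
  have c: "(\<Sum>e\<in>F. c e * x e) = (\<Sum>e\<in>F \<union> G. c' e * x e)" for x
    unfolding c'_def by (rule sum.mono_neutral_cong_left) (use assms in auto)
  have d: "(\<Sum>e\<in>G. d e * x e) = (\<Sum>e\<in>F \<union> G. d' e * x e)" for x
    unfolding d'_def by (rule sum.mono_neutral_cong_left) (use assms in auto)
  have "(\<lambda>x. (1/2) * (cos ((\<Sum>e\<in>F \<union> G. (c' e - d' e) * x e) + (b - b')) +
                   cos ((\<Sum>e\<in>F \<union> G. (c' e + d' e) * x e) + (b + b')))) \<in> trig_poly"
    by (intro trig_poly.scale trig_poly.add trig_poly.cos) (use assms in auto)
  also have "(\<lambda>x. (1/2) * (cos ((\<Sum>e\<in>F \<union> G. (c' e - d' e) * x e) + (b - b')) +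
                   cos ((\<Sum>e\<in>F \<union> G. (c' e + d' e) * x e) + (b + b')))) =
      (\<lambda>x. cos ((\<Sum>e\<in>F. c e * x e) + b) * cos ((\<Sum>e\<in>G. d e * x e) + b'))"
    unfolding c d cos_times_cos
    by (simp add: sum.distrib sum_subtractf algebra_simps add_divide_distrib)
  finally show ?thesis .
qed

lemma trig_poly_mult:
  assumes "f \<in> trig_poly" "g \<in> trig_poly"
  shows "(\<lambda>x. f x * g x) \<in> trig_poly"
  using assms
proof (induction arbitrary: g rule: trig_poly.induct)
  case (cos F c b)
  from cos(2) show ?case
  proof induction
    case (cos G d b')
    then show ?case by (rule trig_poly_cos_mult_cos[OF \<open>finite F\<close>])
  next
    case (add f g)
    then show ?case using trig_poly.add[OF add.IH] by (simp add: algebra_simps)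
  next
    case (scale f a)
    then show ?case using trig_poly.scale[OF scale.IH, of a] by (simp add: algebra_simps)
  qed
next
  case (add f g h)
  then show ?case using trig_poly.add[OF add.IH(1)[of h] add.IH(2)[of h]] by (simp add: algebra_simps)
next
  case (scale f a h)
  then show ?case using trig_poly.scale[OF scale.IH[of h], of a] by (simp add: algebra_simps)
qed

lemma trig_poly_bounded: "f \<in> trig_poly \<Longrightarrow> \<exists>B. \<forall>x. \<bar>f x\<bar> \<le> B"
proof (induction rule: trig_poly.induct)
  case (cos F c b)
  then show ?case by (intro exI[of _ 1]) auto
next
  case (add f g)
  then obtain A B where AB: "\<And>x. \<bar>f x\<bar> \<le> A" "\<And>x. \<bar>g x\<bar> \<le> B" by auto
  have "\<bar>f x + g x\<bar> \<le> A + B" for x using AB(1)[of x] AB(2)[of x] by linarith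
  then show ?case by blast
next
  case (scale f a)
  then obtain A where "\<And>x. \<bar>f x\<bar> \<le> A" by auto
  then have "\<bar>a * f x\<bar> \<le> \<bar>a\<bar> * A" for x by (simp add: abs_mult mult_left_mono)
  then show ?case by blast
qed

lemma trig_poly_measurable:
  fixes f :: "('i::countable \<Rightarrow> real) \<Rightarrow> real"
  shows "f \<in> trig_poly \<Longrightarrow> f \<in> borel_measurable borel"
proof (induction rule: trig_poly.induct)
  case (cos F c b)
  have [measurable]: "(\<lambda>x::'i \<Rightarrow> real. x e) \<in> borel_measurable borel" for e
    by (rule borel_measurable_continuous_onI) simp
  show ?case by measurable
qed auto

text \<open>Tychonoff's theorem; the function space carries the product topology.\<close>

lemma compact_cube: "compact {y :: 'i \<Rightarrow> real. \<forall>e. \<bar>y e\<bar> \<le> 1}"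
proof -
  have "compactin (product_topology (\<lambda>i. euclidean) UNIV) (PiE UNIV (\<lambda>_::'i. {-1..1::real}))"
    by (subst compactin_PiE) auto
  moreover have "PiE UNIV (\<lambda>_::'i. {-1..1::real}) = {y. \<forall>e. \<bar>y e\<bar> \<le> 1}"
    by (auto simp: PiE_def Pi_def extensional_def abs_le_iff minus_le_iff)
  ultimately show ?thesis
    by (simp add: euclidean_product_topology)
qed

text \<open>\<open>sin\<close> maps the whole real line into [-1, 1], so an approximation on the
  compact cube pulls back to one that is uniform on the whole space. The ring \<open>R\<close>
  collects the functions on the cube with trigonometric pullback; it contains the coordinates, which
  separate points.\<close>

lemma trig_poly_Stone_Weierstrass:
  fixes h :: "('i::countable \<Rightarrow> real) \<Rightarrow> real"
  assumes "continuous_on {y. \<forall>e. \<bar>y e\<bar> \<le> 1} h" "0 < \<epsilon>"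
  obtains p where "p \<in> trig_poly" "\<And>x. \<bar>h (\<lambda>e. sin (a e * x e)) - p x\<bar> < \<epsilon>"
proof -
  define C where "C = {y :: 'i \<Rightarrow> real. \<forall>e. \<bar>y e\<bar> \<le> 1}"
  define R where "R = {h :: ('i \<Rightarrow> real) \<Rightarrow> real. continuous_on C h \<and> (\<lambda>x. h (\<lambda>e. sin (a e * x e))) \<in> trig_poly}"
  interpret function_ring_on R C
  proof
    show "compact C" unfolding C_def by (rule compact_cube)
    fix x y assume "x \<in> C" "y \<in> C" "x \<noteq> y"
    then obtain e where "x e \<noteq> y e" by auto
    moreover have "(\<lambda>y. y e) \<in> R"
      unfolding R_def by (auto intro: trig_poly_sin continuous_on_subset[OF continuous_on_product_coordinates])
    ultimately show "\<exists>f\<in>R. f x \<noteq> f y" by (intro bexI[of _ "\<lambda>y. y e"])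
  qed (auto simp: R_def intro: continuous_intros trig_poly_const trig_poly.add trig_poly_mult)
  obtain g where g: "g \<in> R" "\<And>x. x \<in> C \<Longrightarrow> \<bar>h x - g x\<bar> < \<epsilon>"
    using Stone_Weierstrass_basic[of h \<epsilon>] assms unfolding C_def by auto
  show ?thesis
    by (rule that[of "\<lambda>x. g (\<lambda>e. sin (a e * x e))"]) (use g in \<open>auto simp: R_def C_def\<close>)
qed

text \<open>Levy's continuity theorem turns convergence of characteristic functions into weak
  convergence, which controls the tails for all large \<open>n\<close>. The finitely many remaining
  laws are tight one by one, and the largest threshold serves them all and the limit.\<close>

lemma uniform_tightness:
  fixes X :: "nat \<Rightarrow> 'w \<Rightarrow> real"
  assumes "prob_space M" and X[measurable]: "\<And>n. X n \<in> borel_measurable M"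
    and "prob_space \<mu>" and Y[measurable]: "Y \<in> borel_measurable \<mu>"
    and char: "\<And>t. (\<lambda>n. \<integral>w. iexp (t * X n w) \<partial>M) \<longlonglongrightarrow> (\<integral>y. iexp (t * Y y) \<partial>\<mu>)"
    and "0 < \<epsilon>"
  obtains K where "0 < K" "\<And>n. measure M {w \<in> space M. \<bar>X n w\<bar> > K} \<le> \<epsilon>"
    "measure \<mu> {y \<in> space \<mu>. \<bar>Y y\<bar> > K} \<le> \<epsilon>"
proof -
  interpret M: prob_space M by fact
  interpret \<mu>: prob_space \<mu> by fact
  have weak: "weak_conv_m (\<lambda>n. distr M borel (X n)) (distr \<mu> borel Y)"
    by (rule levy_continuity)
       (auto intro!: M.real_distribution_distr \<mu>.real_distribution_distr simp: char_def integral_distr char[simplified])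
  \<comment> \<open>A continuous ramp, 0 for \<bar>x\<bar> \<le> K and 1 for \<bar>x\<bar> \<ge> K +
    1: it is a legitimate test function and dominates the indicator of \<bar>x\<bar> > K +
    1.\<close>
  define h where "h K x = min 1 (max 0 (\<bar>x\<bar> - K))" for K x :: real
  have h01: "0 \<le> h K x" "h K x \<le> 1" "\<bar>h K x\<bar> \<le> 1" for K x by (auto simp: h_def)
  have hm[measurable]: "h K \<in> borel_measurable borel" for K unfolding h_def by measurable
  have h_cont: "isCont (h K) x" for K x
    unfolding h_def[abs_def] by (intro continuous_intros)
  have h_lim: "(\<lambda>m. \<integral>w. h (real m) (Z w) \<partial>N) \<longlonglongrightarrow> 0"
    if "prob_space N" and [measurable]: "Z \<in> borel_measurable N" for N :: "'z measure" and Z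
  proof -
    interpret N: prob_space N by fact
    have "(\<lambda>m. \<integral>w. h (real m) (Z w) \<partial>N) \<longlonglongrightarrow> (\<integral>w. 0 \<partial>N)"
    proof (rule integral_dominated_convergence[where w="\<lambda>_. 1"])
      have "(\<lambda>m. h (real m) z) \<longlonglongrightarrow> 0" for z
      proof (rule tendsto_eventually)
        show "\<forall>\<^sub>F m in sequentially. h (real m) z = 0"
          using eventually_ge_at_top[of "nat \<lceil>\<bar>z\<bar>\<rceil>"]
        proof eventually_elim
          case (elim m)
          then have "\<bar>z\<bar> - real m \<le> 0" by linarith
          then show ?case by (simp add: h_def)
        qed
      qed
      then show "AE x in N. (\<lambda>m. h (real m) (Z x)) \<longlonglongrightarrow> 0" by simp
    qed (use h01 in auto)
    then show ?thesis by simp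
  qed
  have h_meas: "measure N {w \<in> space N. \<bar>Z w\<bar> > K'} \<le> (\<integral>w. h K (Z w) \<partial>N)"
    if "prob_space N" and [measurable]: "Z \<in> borel_measurable N" and "K + 1 \<le> K'"
    for N :: "'z measure" and Z K K'
  proof -
    interpret N: prob_space N by fact
    have "measure N {w \<in> space N. \<bar>Z w\<bar> > K'} = (\<integral>w. indicator {w \<in> space N. \<bar>Z w\<bar> > K'} w \<partial>N)"
      by simp
    also have "\<dots> \<le> (\<integral>w. h K (Z w) \<partial>N)"
    proof (rule integral_mono)
      show "integrable N (\<lambda>w. h K (Z w))"
        by (rule N.integrable_const_bound[of _ 1]) (use h01 in auto)
      show "integrable N (\<lambda>w. indicat_real {w \<in> space N. \<bar>Z w\<bar> > K'} w)"
        by (intro integrable_real_indicator) (auto simp: less_top[symmetric])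
    qed (use that(3) h01 in \<open>auto simp: h_def indicator_def\<close>)
    finally show ?thesis .
  qed
  have conv: "(\<lambda>n. \<integral>w. h K (X n w) \<partial>M) \<longlonglongrightarrow> (\<integral>y. h K (Y y) \<partial>\<mu>)" for K
  proof -
    have "(\<lambda>n. integral\<^sup>L (distr M borel (X n)) (h K)) \<longlonglongrightarrow> integral\<^sup>L (distr \<mu> borel Y) (h K)"
      using weak M.real_distribution_distr[OF X] \<mu>.real_distribution_distr[OF Y]
      by (intro weak_conv_imp_integral_bdd_continuous_conv[where B=1])
         (use h_cont h01 in auto)
    then show ?thesis by (simp add: integral_distr)
  qed
  obtain m where m: "(\<integral>y. h (real m) (Y y) \<partial>\<mu>) < \<epsilon>"
    using order_tendstoD(2)[OF h_lim[OF \<open>prob_space \<mu>\<close> Y] \<open>0 < \<epsilon>\<close>] 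
    by (auto simp: eventually_sequentially)
  obtain N where N: "\<And>n. n \<ge> N \<Longrightarrow> (\<integral>w. h (real m) (X n w) \<partial>M) < \<epsilon>"
    using order_tendstoD(2)[OF conv m] by (auto simp: eventually_sequentially)
  have "\<exists>m. (\<integral>w. h (real m) (X n w) \<partial>M) < \<epsilon>" for n
    using order_tendstoD(2)[OF h_lim[OF \<open>prob_space M\<close> X] \<open>0 < \<epsilon>\<close>] 
    by (auto simp: eventually_sequentially)
  then obtain m' where m': "\<And>n. (\<integral>w. h (real (m' n)) (X n w) \<partial>M) < \<epsilon>" by metis
  \<comment> \<open>The summand 1 is the width of the ramp.\<close>
  define K where "K = real (Max (insert m (m' ` {..<N}))) + 1"
  have K: "real m + 1 \<le> K" "\<And>n. n < N \<Longrightarrow> real (m' n) + 1 \<le> K"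
    by (auto simp: K_def)
  show ?thesis
  proof (rule that)
    show "0 < K" by (simp add: K_def)
    show "measure \<mu> {y \<in> space \<mu>. \<bar>Y y\<bar> > K} \<le> \<epsilon>"
      using h_meas[OF \<open>prob_space \<mu>\<close> Y K(1)] m by linarith
    show "measure M {w \<in> space M. \<bar>X n w\<bar> > K} \<le> \<epsilon>" for n
    proof (cases "n < N")
      case True
      then show ?thesis using h_meas[OF \<open>prob_space M\<close> X K(2)[OF True], of n] m'[of n] by linarith
    next
      case False
      then show ?thesis using h_meas[OF \<open>prob_space M\<close> X K(1), of n] N[of n] by linarith
    qed
  qed
qed

text \<open>Countable subadditivity with geometric weights along the enumeration
  \<open>to_nat\<close>; a number that encodes no coordinate contributes the empty set.\<close>

lemma box_complement_measure_le:
  fixes Y :: "'w \<Rightarrow> 'i::countable \<Rightarrow> real"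
  assumes "prob_space M" and [measurable]: "\<And>e. (\<lambda>w. Y w e) \<in> borel_measurable M"
    and le: "\<And>e. measure M {w \<in> space M. \<bar>Y w e\<bar> > K e} \<le> \<epsilon> * (1/2) ^ Suc (to_nat e)"
    and "0 < \<epsilon>"
  shows "measure M {w \<in> space M. \<exists>e. \<bar>Y w e\<bar> > K e} \<le> \<epsilon>"
proof -
  interpret prob_space M by fact
  define A where "A n = {w \<in> space M. \<exists>e. to_nat e = n \<and> \<bar>Y w e\<bar> > K e}" for n :: nat
  have A[measurable]: "A n \<in> sets M" for n unfolding A_def by measurable
  have le': "measure M (A n) \<le> \<epsilon> * (1/2) ^ Suc n" for n
  proof (cases "\<exists>e::'i. to_nat e = n")
    case True
    then obtain e :: 'i where e: "to_nat e = n" by auto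
    have "A n = {w \<in> space M. \<bar>Y w e\<bar> > K e}" using e by (auto simp: A_def)
    then show ?thesis using le[of e] e by simp
  next
    case False
    then have "A n = {}" by (auto simp: A_def)
    then show ?thesis using \<open>0 < \<epsilon>\<close> by simp
  qed
  have sums: "(\<lambda>n. \<epsilon> * (1/2) ^ Suc n) sums (\<epsilon> * 1)"
    by (intro sums_mult power_half_series)
  have summable: "summable (\<lambda>n. measure M (A n))"
    by (rule summable_comparison_test'[of "\<lambda>n. \<epsilon> * (1/2) ^ Suc n" 0])
       (use sums le' in \<open>auto simp: sums_iff\<close>)
  have "{w \<in> space M. \<exists>e. \<bar>Y w e\<bar> > K e} = (\<Union>n. A n)" by (auto simp: A_def)
  then have "measure M {w \<in> space M. \<exists>e. \<bar>Y w e\<bar> > K e} \<le> (\<Sum>n. measure M (A n))"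
    using finite_measure_subadditive_countably[OF _ summable] A by (simp add: image_subset_iff)
  also have "\<dots> \<le> (\<Sum>n. \<epsilon> * (1/2) ^ Suc n)"
    by (rule suminf_le[OF le' summable]) (use sums in \<open>simp add: sums_iff\<close>)
  also have "\<dots> = \<epsilon>" using sums by (simp add: sums_iff)
  finally show ?thesis .
qed

lemma integral_diff_le_off_small_set:
  fixes f g :: "'w \<Rightarrow> real"
  assumes "prob_space M" and [measurable]: "f \<in> borel_measurable M" "g \<in> borel_measurable M" "A \<in> sets M"
    and f: "\<And>w. \<bar>f w\<bar> \<le> B" and g: "\<And>w. \<bar>g w\<bar> \<le> B"
    and "0 \<le> \<delta>"
    and off: "\<And>w. w \<in> space M \<Longrightarrow> w \<notin> A \<Longrightarrow> \<bar>f w - g w\<bar> \<le> \<delta>" and A: "measure M A \<le> \<epsilon>"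
  shows "\<bar>(\<integral>w. f w \<partial>M) - (\<integral>w. g w \<partial>M)\<bar> \<le> \<delta> + 2 * B * \<epsilon>"
proof -
  interpret prob_space M by fact
  have B: "0 \<le> B" using f[of undefined] by linarith
  have int: "integrable M f" "integrable M g"
    using f g by (auto intro!: integrable_const_bound[of _ B])
  have "\<bar>(\<integral>w. f w \<partial>M) - (\<integral>w. g w \<partial>M)\<bar> = \<bar>\<integral>w. f w - g w \<partial>M\<bar>"
    using int by simp
  also have "\<dots> \<le> (\<integral>w. \<bar>f w - g w\<bar> \<partial>M)" by (rule integral_abs_bound)
  also have "\<dots> \<le> (\<integral>w. \<bar>\<delta>\<bar> * indicator (space M - A) w + 2 * B * indicator A w \<partial>M)"
  proof (rule integral_mono)
    show "integrable M (\<lambda>w. \<bar>f w - g w\<bar>)" using int by auto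
    fix w assume "w \<in> space M"
    then show "\<bar>f w - g w\<bar> \<le> \<bar>\<delta>\<bar> * indicator (space M - A) w + 2 * B * indicator A w"
      using off[of w] f[of w] g[of w] by (cases "w \<in> A") auto
  qed (auto intro!: integrable_const_bound[of _ "\<bar>\<delta>\<bar> + 2 * B"] simp: indicator_def B)
  also have "\<dots> = \<bar>\<delta>\<bar> * prob (space M - A) + 2 * B * prob A"
    by (subst Bochner_Integration.integral_add) (auto intro: integrable_real_indicator simp: less_top[symmetric])
  also have "\<dots> \<le> \<delta> + 2 * B * \<epsilon>"
    using A B \<open>0 \<le> \<delta>\<close> by (intro add_mono mult_left_mono) (auto intro: mult_left_le)
  finally show ?thesis .
qed


text \<open>On a compact box, \<open>f\<close> agrees with a function that is periodic in every coordinate, because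
  \<open>arcsin \<circ> sin\<close> is a triangular wave. The trigonometric polynomials approximating the periodic function
  do so on the whole space, so that nothing has to be controlled outside the box.\<close>

theorem Cramer_Wold:
  fixes X :: "nat \<Rightarrow> 'w \<Rightarrow> 'i::countable \<Rightarrow> real"
  assumes M: "prob_space M" and X: "\<And>n. X n \<in> borel_measurable M"
    and \<mu>: "prob_space \<mu>" and sets_\<mu>: "sets \<mu> = sets borel"
    and char: "\<And>F c. finite F \<Longrightarrow>
      (\<lambda>n. \<integral>w. iexp (\<Sum>e\<in>F. c e * X n w e) \<partial>M) \<longlonglongrightarrow> (\<integral>y. iexp (\<Sum>e\<in>F. c e * y e) \<partial>\<mu>)"
  shows "converges_in_distribution M X \<mu>"
proof -
  interpret M: prob_space M by fact
  interpret \<mu>: prob_space \<mu> by fact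
  have coord: "(\<lambda>x. x e) \<in> borel_measurable borel" for e :: 'i
    by (rule borel_measurable_continuous_onI) simp
  have Y[measurable]: "(\<lambda>y. y e) \<in> borel_measurable \<mu>" for e
    using coord by (subst measurable_cong_sets[OF sets_\<mu> refl])
  have Xe[measurable]: "(\<lambda>w. X n w e) \<in> borel_measurable M" for n e
    using measurable_compose[OF X coord] .
  have trig: "(\<lambda>n. \<integral>w. p (X n w) \<partial>M) \<longlonglongrightarrow> (\<integral>y. p y \<partial>\<mu>)" if p: "p \<in> trig_poly" for p
  proof -
    have int: "integrable M (\<lambda>w. p (X n w))" "integrable \<mu> p" if p: "p \<in> trig_poly" for p n
    proof -
      obtain B where "\<And>x. \<bar>p x\<bar> \<le> B" using trig_poly_bounded[OF p] by auto
      moreover have "p \<in> borel_measurable \<mu>"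
        using trig_poly_measurable[OF p] by (subst measurable_cong_sets[OF sets_\<mu> refl])
      moreover have "(\<lambda>w. p (X n w)) \<in> borel_measurable M"
        using measurable_compose[OF X trig_poly_measurable[OF p]] .
      ultimately show "integrable M (\<lambda>w. p (X n w))" "integrable \<mu> p"
        by (auto intro!: M.integrable_const_bound[of _ B] \<mu>.integrable_const_bound[of _ B])
    qed
    from p show ?thesis
    proof induction
      case (cos F c b)
      \<comment> \<open>A cosine with phase is the real part of a constant times the exponential of
        a linear form, so the hypothesis on characteristic functions covers the generators.\<close>
      have eq: "(\<integral>w. cos ((\<Sum>e\<in>F. c e * Z w e) + b) \<partial>N) = Re (iexp b * (\<integral>w. iexp (\<Sum>e\<in>F. c e * Z w e) \<partial>N))"
        if "prob_space N" and [measurable]: "\<And>e. (\<lambda>w. Z w e) \<in> borel_measurable N" for N :: "'z measure" and Z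
      proof -
        interpret N: prob_space N by fact
        have int: "integrable N (\<lambda>w. iexp (\<Sum>e\<in>F. c e * Z w e))"
          by (rule N.integrable_const_bound[of _ 1]) auto
        have "cos ((\<Sum>e\<in>F. c e * Z w e) + b) = Re (iexp b * iexp (\<Sum>e\<in>F. c e * Z w e))" for w
          by (simp add: exp_add[symmetric] Re_exp add.commute flip: distrib_left of_real_add)
        then have "(\<integral>w. cos ((\<Sum>e\<in>F. c e * Z w e) + b) \<partial>N) = (\<integral>w. Re (iexp b * iexp (\<Sum>e\<in>F. c e * Z w e)) \<partial>N)"
          by simp
        also have "\<dots> = Re (\<integral>w. iexp b * iexp (\<Sum>e\<in>F. c e * Z w e) \<partial>N)"
          by (rule integral_Re[OF integrable_mult_right[OF int]])
        finally show ?thesis by (simp only: integral_mult_right_zero)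
      qed
      show ?case
        unfolding eq[OF M Xe] eq[OF \<mu> Y] by (intro tendsto_intros char cos)
    next
      case (add f g)
      then show ?case using int by (auto intro!: tendsto_add)
    next
      case (scale f a)
      then show ?case by (auto intro!: tendsto_mult_left)
    qed
  qed
  have "(\<lambda>n. \<integral>w. f (X n w) \<partial>M) \<longlonglongrightarrow> (\<integral>y. f y \<partial>\<mu>)"
    if f: "continuous_on UNIV f" and bdd: "bounded (range f)" for f :: "('i \<Rightarrow> real) \<Rightarrow> real"
  proof (rule LIMSEQ_I)
    fix r :: real assume "0 < r"
    obtain B where B: "0 < B" "\<And>x. \<bar>f x\<bar> \<le> B"
      using bdd by (auto simp: bounded_pos)
    \<comment> \<open>Exchanging \<open>f\<close> for a trigonometric polynomial costs (2 B + 1)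
      \<epsilon> under the law of \<open>X n\<close> and again under \<mu>; the convergence for the
      polynomial costs another \<epsilon>.\<close>
    define \<epsilon> where "\<epsilon> = r / (4 * B + 3)"
    have "0 < \<epsilon>" using \<open>0 < r\<close> B by (simp add: \<epsilon>_def)
    have "\<exists>K>0. (\<forall>n. measure M {w \<in> space M. \<bar>X n w e\<bar> > K} \<le> \<epsilon> * (1/2) ^ Suc (to_nat e)) \<and>
      measure \<mu> {y \<in> space \<mu>. \<bar>y e\<bar> > K} \<le> \<epsilon> * (1/2) ^ Suc (to_nat e)" for e
    proof (rule uniform_tightness[OF M Xe \<mu> Y])
      show "(\<lambda>n. \<integral>w. iexp (t * X n w e) \<partial>M) \<longlonglongrightarrow> (\<integral>y. iexp (t * y e) \<partial>\<mu>)" for t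
        using char[of "{e}" "\<lambda>_. t"] by simp
      show "0 < \<epsilon> * (1/2) ^ Suc (to_nat e)" using \<open>0 < \<epsilon>\<close> by simp
    qed auto
    then have "\<exists>K. \<forall>e. 0 < K e \<and>
      (\<forall>n. measure M {w \<in> space M. \<bar>X n w e\<bar> > K e} \<le> \<epsilon> * (1/2) ^ Suc (to_nat e)) \<and>
      measure \<mu> {y \<in> space \<mu>. \<bar>y e\<bar> > K e} \<le> \<epsilon> * (1/2) ^ Suc (to_nat e)"
      by (intro choice allI)
    then obtain K where K: "\<And>e. 0 < K e"
      "\<And>e n. measure M {w \<in> space M. \<bar>X n w e\<bar> > K e} \<le> \<epsilon> * (1/2) ^ Suc (to_nat e)"
      "\<And>e. measure \<mu> {y \<in> space \<mu>. \<bar>y e\<bar> > K e} \<le> \<epsilon> * (1/2) ^ Suc (to_nat e)"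
      by blast
    \<comment> \<open>Scales the box to [-pi/2, pi/2] in each coordinate, the range on which
      \<open>arcsin\<close> inverts \<open>sin\<close>.\<close>
    define a where "a e = pi / (2 * K e)" for e
    have a: "0 < a e" for e using K(1) by (simp add: a_def)
    define h where "h y = f (\<lambda>e. arcsin (y e) / a e)" for y
    define g where "g x = h (\<lambda>e. sin (a e * x e))" for x
    have g_eq: "g x = f x" if "\<And>e. \<bar>x e\<bar> \<le> K e" for x
    proof -
      have "\<bar>a e * x e\<bar> \<le> pi / 2" for e
      proof -
        have "\<bar>a e * x e\<bar> \<le> a e * K e" using that[of e] a[of e] by (simp add: abs_mult)
        also have "\<dots> = pi / 2" using K(1)[of e] by (simp add: a_def)
        finally show ?thesis .
      qed
      then have "- (pi / 2) \<le> a e * x e" "a e * x e \<le> pi / 2" for e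
        unfolding abs_le_iff by (auto simp: minus_le_iff)
      then have "arcsin (sin (a e * x e)) = a e * x e" for e
        by (rule arcsin_sin)
      then have "(\<lambda>e. arcsin (sin (a e * x e)) / a e) = x"
        using a by (auto simp: fun_eq_iff less_imp_neq[THEN not_sym])
      then show ?thesis by (simp add: g_def h_def)
    qed
    have g_bdd: "\<bar>g x\<bar> \<le> B" for x by (simp add: g_def h_def B)
    have h_cont: "continuous_on {y. \<forall>e. \<bar>y e\<bar> \<le> 1} h"
      unfolding h_def
    proof (rule continuous_on_compose2[OF f])
      show "continuous_on {y. \<forall>e. \<bar>y e\<bar> \<le> 1} (\<lambda>y e. arcsin (y e) / a e)"
        using a by (intro continuous_on_coordinatewise_then_product continuous_intros
            continuous_on_subset[OF continuous_on_product_coordinates])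
          (auto simp: abs_le_iff minus_le_iff less_imp_neq[THEN not_sym])
    qed simp
    obtain p where p: "p \<in> trig_poly" "\<And>x. \<bar>g x - p x\<bar> < \<epsilon>"
      using trig_poly_Stone_Weierstrass[OF h_cont \<open>0 < \<epsilon>\<close>] unfolding g_def by metis
    obtain C where C: "\<And>x. \<bar>p x\<bar> \<le> C" using trig_poly_bounded[OF p(1)] by auto
    have pm: "p \<in> borel_measurable borel" by (rule trig_poly_measurable[OF p(1)])
    have fm: "f \<in> borel_measurable borel" using f by (rule borel_measurable_continuous_onI)
    have gm: "g \<in> borel_measurable borel"
    proof -
      have "continuous_on UNIV g"
        unfolding g_def
        by (rule continuous_on_compose2[OF h_cont])
           (auto intro!: continuous_on_coordinatewise_then_product continuous_intros)
      then show ?thesis by (rule borel_measurable_continuous_onI)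
    qed
    have close: "\<bar>(\<integral>w. f (Z w) \<partial>N) - (\<integral>w. p (Z w) \<partial>N)\<bar> \<le> 2 * B * \<epsilon> + \<epsilon>"
      if N: "prob_space N" and Z: "Z \<in> borel_measurable N"
        and le: "\<And>e. measure N {w \<in> space N. \<bar>Z w e\<bar> > K e} \<le> \<epsilon> * (1/2) ^ Suc (to_nat e)"
      for N :: "'z measure" and Z
    proof -
      interpret N: prob_space N by fact
      have Ze[measurable]: "(\<lambda>w. Z w e) \<in> borel_measurable N" for e
        using measurable_compose[OF Z coord] .
      have [measurable]: "(\<lambda>w. f (Z w)) \<in> borel_measurable N" "(\<lambda>w. g (Z w)) \<in> borel_measurable N"
        "(\<lambda>w. p (Z w)) \<in> borel_measurable N"
        using measurable_compose[OF Z fm] measurable_compose[OF Z gm] measurable_compose[OF Z pm] by auto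
      have "\<bar>(\<integral>w. f (Z w) \<partial>N) - (\<integral>w. g (Z w) \<partial>N)\<bar> \<le> 0 + 2 * B * \<epsilon>"
      proof (rule integral_diff_le_off_small_set[OF N])
        show "measure N {w \<in> space N. \<exists>e. \<bar>Z w e\<bar> > K e} \<le> \<epsilon>"
          by (rule box_complement_measure_le[OF N Ze le \<open>0 < \<epsilon>\<close>])
        show "\<bar>f (Z w) - g (Z w)\<bar> \<le> 0"
          if "w \<in> space N" "w \<notin> {w \<in> space N. \<exists>e. \<bar>Z w e\<bar> > K e}" for w
          using that g_eq[of "Z w"] by (auto simp: not_less)
      qed (use B g_bdd in auto)
      \<comment> \<open>The approximation holds everywhere, so the exceptional set is empty and the
        bound \<open>C\<close> of the polynomial enters with factor 0.\<close>
      moreover have "\<bar>(\<integral>w. g (Z w) \<partial>N) - (\<integral>w. p (Z w) \<partial>N)\<bar> \<le> \<epsilon> + 2 * max B C * 0"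
        by (rule integral_diff_le_off_small_set[OF N, where A="{}"])
           (use p(2) g_bdd C \<open>0 < \<epsilon>\<close> in \<open>auto simp: le_max_iff_disj less_imp_le\<close>)
      ultimately show ?thesis by simp
    qed
    have 1: "\<bar>(\<integral>w. f (X n w) \<partial>M) - (\<integral>w. p (X n w) \<partial>M)\<bar> \<le> 2 * B * \<epsilon> + \<epsilon>" for n
      by (rule close[OF M X K(2)])
    have 2: "\<bar>(\<integral>y. f y \<partial>\<mu>) - (\<integral>y. p y \<partial>\<mu>)\<bar> \<le> 2 * B * \<epsilon> + \<epsilon>"
      by (rule close[OF \<mu> _ K(3)]) (subst measurable_cong_sets[OF sets_\<mu> refl], simp)
    obtain n0 where n0: "\<And>n. n \<ge> n0 \<Longrightarrow> \<bar>(\<integral>w. p (X n w) \<partial>M) - (\<integral>y. p y \<partial>\<mu>)\<bar> < \<epsilon>"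
      using LIMSEQ_D[OF trig[OF p(1)] \<open>0 < \<epsilon>\<close>] by auto
    have "\<bar>(\<integral>w. f (X n w) \<partial>M) - (\<integral>y. f y \<partial>\<mu>)\<bar> < r" if "n \<ge> n0" for n
    proof -
      have "\<bar>(\<integral>w. f (X n w) \<partial>M) - (\<integral>y. f y \<partial>\<mu>)\<bar> < (4 * B + 3) * \<epsilon>"
        using 1[of n] 2 n0[OF that] by (simp add: algebra_simps abs_le_iff abs_less_iff)
      also have "\<dots> = r" using B by (simp add: \<epsilon>_def)
      finally show ?thesis .
    qed
    then show "\<exists>n0. \<forall>n\<ge>n0. norm ((\<integral>w. f (X n w) \<partial>M) - (\<integral>y. f y \<partial>\<mu>)) < r" by auto
  qed
  then show ?thesis
    unfolding converges_in_distribution_def using M X \<mu> sets_\<mu> by auto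
qed

section \<open>Gaussian laws with multinomial covariance\<close>

text \<open>Integrability must come from the form of the law: an integral that does not exist is 0
  by convention, so the moment equations of a centred system do not supply it. In the degenerate
  case mean zero forces the constant 0; otherwise division by \<sigma> reduces the formula to the
  standard normal law.\<close>

lemma gaussian_rv_moments:
  assumes "prob_space M" "gaussian_rv M X"
  shows "integrable M X" "integrable M (\<lambda>w. (X w)\<^sup>2)"
    and "(\<integral>w. X w \<partial>M) = 0 \<Longrightarrow> (\<integral>w. iexp (X w) \<partial>M) = exp (- (\<integral>w. (X w)\<^sup>2 \<partial>M) / 2)"
proof -
  interpret prob_space M by fact
  have Xm[measurable]: "X \<in> borel_measurable M" using assms(2) by (simp add: gaussian_rv_def)
  consider m where "AE w in M. X w = m"
    | m \<sigma> where "0 < \<sigma>" "distributed M lborel X (normal_density m \<sigma>)"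
    using assms(2) unfolding gaussian_rv_def by blast
  then have "integrable M X \<and> integrable M (\<lambda>w. (X w)\<^sup>2) \<and>
    ((\<integral>w. X w \<partial>M) = 0 \<longrightarrow> (\<integral>w. iexp (X w) \<partial>M) = exp (- (\<integral>w. (X w)\<^sup>2 \<partial>M) / 2))"
  proof cases
    case 1
    then have "AE w in M. (X w)\<^sup>2 = m\<^sup>2" by (rule eventually_mono) simp
    then have int: "integrable M X" "integrable M (\<lambda>w. (X w)\<^sup>2)"
      using integrable_cong_AE[of X M "\<lambda>_. m"] integrable_cong_AE[of "\<lambda>w. (X w)\<^sup>2" M "\<lambda>_. m\<^sup>2"] 1 by auto
    have "(\<integral>w. X w \<partial>M) = (\<integral>w. m \<partial>M)" "(\<integral>w. (X w)\<^sup>2 \<partial>M) = (\<integral>w. m\<^sup>2 \<partial>M)"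
      "(\<integral>w. iexp (X w) \<partial>M) = (\<integral>w. iexp m \<partial>M)"
      by (rule integral_cong_AE; use 1 in \<open>auto elim: eventually_mono\<close>)+
    then show ?thesis using int by (simp add: prob_space)
  next
    case 2
    note D = 2(2)
    have sq: "integrable M (\<lambda>w. (X w - m)\<^sup>2)"
      using integrable_normal_moment[of \<sigma> m 2] distributed_integrable[OF D, of "\<lambda>x. (x - m)\<^sup>2"] 2(1)
      by simp
    have int: "integrable M X"
      using integrable_normal_moment_nz_1[of \<sigma> m] distributed_integrable[OF D, of "\<lambda>x. x"] 2(1)
      by simp
    have eq: "(X w)\<^sup>2 = (X w - m)\<^sup>2 + (2 * m * X w - m\<^sup>2)" for w
      by (simp add: power2_eq_square algebra_simps)
    have int2: "integrable M (\<lambda>w. (X w)\<^sup>2)"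
      unfolding eq using sq int by (intro Bochner_Integration.integrable_add) auto
    have "(\<integral>w. iexp (X w) \<partial>M) = exp (- (\<integral>w. (X w)\<^sup>2 \<partial>M) / 2)" if "(\<integral>w. X w \<partial>M) = 0"
    proof -
      have m: "m = 0" using normal_distributed_expectation[OF 2(1) D] that by simp
      have var: "(\<integral>w. (X w)\<^sup>2 \<partial>M) = \<sigma>\<^sup>2"
        using normal_distributed_variance[OF 2(1) D] that by simp
      have std: "distributed M lborel (\<lambda>w. X w / \<sigma>) std_normal_density"
        using normal_standard_normal_convert[OF 2(1), of X m] D m by simp
      have "(\<integral>w. iexp (X w) \<partial>M) = (\<integral>w. iexp (\<sigma> * (X w / \<sigma>)) \<partial>M)"
        using 2(1) by simp
      also have "\<dots> = char (distr M lborel (\<lambda>w. X w / \<sigma>)) \<sigma>"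
        unfolding char_def using std by (subst integral_distr) (auto simp: distributed_def)
      also have "distr M lborel (\<lambda>w. X w / \<sigma>) = std_normal_distribution"
        using distributed_distr_eq_density[OF std] .
      finally show ?thesis by (simp add: char_std_normal_distribution var)
    qed
    then show ?thesis using int int2 by auto
  qed
  then show "integrable M X" "integrable M (\<lambda>w. (X w)\<^sup>2)"
    "(\<integral>w. X w \<partial>M) = 0 \<Longrightarrow> (\<integral>w. iexp (X w) \<partial>M) = exp (- (\<integral>w. (X w)\<^sup>2 \<partial>M) / 2)"
    by auto
qed

lemma integrable_mult_square_integrable:
  fixes X Y :: "'w \<Rightarrow> real"
  assumes [measurable]: "X \<in> borel_measurable M" "Y \<in> borel_measurable M"
    and "integrable M (\<lambda>w. (X w)\<^sup>2)" "integrable M (\<lambda>w. (Y w)\<^sup>2)"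
  shows "integrable M (\<lambda>w. X w * Y w)"
proof (rule Bochner_Integration.integrable_bound)
  show "integrable M (\<lambda>w. (X w)\<^sup>2 + (Y w)\<^sup>2)" using assms by auto
  have "\<bar>x * y\<bar> \<le> x\<^sup>2 + y\<^sup>2" for x y :: real
  proof -
    have "2 * \<bar>x * y\<bar> \<le> x\<^sup>2 + y\<^sup>2"
      using zero_le_power2[of "\<bar>x\<bar> - \<bar>y\<bar>"] by (simp add: power2_diff abs_mult)
    then show ?thesis using abs_ge_zero[of "x * y"] by linarith
  qed
  then show "AE w in M. norm (X w * Y w) \<le> norm ((X w)\<^sup>2 + (Y w)\<^sup>2)" by simp
qed simp

text \<open>A linear form of the system is again centred Gaussian, so only its variance matters, and
  this is the quadratic form of \<open>V\<close>.\<close>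

lemma centered_gaussian_system_char:
  assumes G: "centered_gaussian_system M Y V" and F: "finite F"
  shows "(\<integral>w. iexp (\<Sum>e\<in>F. c e * Y e w) \<partial>M) = exp (- (\<Sum>e\<in>F. \<Sum>e'\<in>F. c e * c e' * V e e') / 2)"
proof -
  have M: "prob_space M" and lin: "\<And>F c. finite F \<Longrightarrow> gaussian_rv M (\<lambda>w. \<Sum>e\<in>F. c e * Y e w)"
    and mean: "\<And>e. (\<integral>w. Y e w \<partial>M) = 0" and cov: "\<And>e e'. (\<integral>w. Y e w * Y e' w \<partial>M) = V e e'"
    using G by (auto simp: centered_gaussian_system_def)
  have Y: "gaussian_rv M (Y e)" for e using lin[of "{e}" "\<lambda>_. 1"] by simp
  note mom = gaussian_rv_moments[OF M Y]
  have int: "integrable M (\<lambda>w. Y e w * Y e' w)" for e e'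
    using Y mom(2) by (intro integrable_mult_square_integrable) (auto simp: gaussian_rv_def)
  have "(\<integral>w. (\<Sum>e\<in>F. c e * Y e w) \<partial>M) = 0"
    using mom(1) mean by (subst Bochner_Integration.integral_sum) auto
  moreover have "(\<integral>w. (\<Sum>e\<in>F. c e * Y e w)\<^sup>2 \<partial>M) = (\<integral>w. (\<Sum>e\<in>F. \<Sum>e'\<in>F. (c e * c e') * (Y e w * Y e' w)) \<partial>M)"
    by (simp add: power2_eq_square sum_product algebra_simps)
  moreover have "\<dots> = (\<Sum>e\<in>F. \<Sum>e'\<in>F. (c e * c e') * V e e')"
    using int cov by (simp add: Bochner_Integration.integral_sum)
  ultimately show ?thesis
    using gaussian_rv_moments(3)[OF M lin[OF F, of c]] by (simp add: mult.assoc)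
qed

text \<open>Finite rows of \<open>L\<close> keep every coordinate a finite sum, so that no convergence question arises.\<close>

lemma centered_gaussian_law_of_factor:
  fixes L :: "'a::countable \<Rightarrow> 'n \<Rightarrow> real"
  assumes fin: "\<And>e. finite {m. L e m \<noteq> 0}"
  shows "\<exists>\<nu>. centered_gaussian_law (\<lambda>e e'. \<Sum>m | L e m \<noteq> 0. L e m * L e' m) \<nu>"
proof -
  define \<Omega> where "\<Omega> = PiM (UNIV :: 'n set) (\<lambda>_. std_normal_distribution)"
  interpret N: prob_space std_normal_distribution
    by (rule prob_space_normal_density) simp
  interpret product_prob_space "\<lambda>_. std_normal_distribution" "UNIV :: 'n set" ..
  interpret \<Omega>: prob_space \<Omega> unfolding \<Omega>_def by (rule prob_space_PiM) (rule N.prob_space_axioms)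
  have coord[measurable]: "(\<lambda>\<omega>. \<omega> m) \<in> borel_measurable \<Omega>" for m
    using measurable_component_singleton[of m UNIV "\<lambda>_. std_normal_distribution"]
    by (simp add: \<Omega>_def)
  have distr: "distr \<Omega> borel (\<lambda>\<omega>. \<omega> m) = std_normal_distribution" for m
    using PiM_component[of m] unfolding \<Omega>_def by (simp cong: distr_cong)
  have norm: "distributed \<Omega> lborel (\<lambda>\<omega>. \<omega> m) std_normal_density" for m
  proof -
    have "distr \<Omega> lborel (\<lambda>\<omega>. \<omega> m) = distr \<Omega> borel (\<lambda>\<omega>. \<omega> m)" by (rule distr_cong) auto
    then show ?thesis using distr[of m] by (simp add: distributed_def)
  qed
  \<comment> \<open>Coordinates on a product space are independent because their joint law, that of
    the identity map, is the product of the marginals.\<close>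
  have indep: "\<Omega>.indep_vars (\<lambda>_. borel) (\<lambda>m \<omega>. \<omega> m) UNIV"
  proof -
    have "distr \<Omega> (PiM UNIV (\<lambda>_. borel)) (\<lambda>x. x) = distr \<Omega> \<Omega> (\<lambda>x. x)"
      by (rule distr_cong) (auto simp: \<Omega>_def intro!: sets_PiM_cong)
    then show ?thesis
      by (subst \<Omega>.indep_vars_iff_distr_eq_PiM') (auto simp: distr distr_id \<Omega>_def[symmetric] restrict_UNIV)
  qed
  have int: "integrable \<Omega> (\<lambda>\<omega>. \<omega> m)" for m
    using distributed_integrable[OF norm, of "\<lambda>x. x"] integrable_std_normal_moment[of 1] by simp
  have mean: "(\<integral>\<omega>. \<omega> m \<partial>\<Omega>) = 0" for m
    using \<Omega>.standard_normal_distributed_expectation[OF norm] .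
  have int_sq: "integrable \<Omega> (\<lambda>\<omega>. \<omega> m * \<omega> m)" for m
    using distributed_integrable[OF norm, of "\<lambda>x. x * x"] integrable_std_normal_moment[of 2]
    by (simp add: power2_eq_square)
  have sq: "(\<integral>\<omega>. \<omega> m * \<omega> m \<partial>\<Omega>) = 1" for m
    using \<Omega>.standard_normal_distributed_variance[OF norm, of m] mean by (simp add: power2_eq_square)
  have pair: "(\<integral>\<omega>. \<omega> m * \<omega> m' \<partial>\<Omega>) = 0" "integrable \<Omega> (\<lambda>\<omega>. \<omega> m * \<omega> m')" if "m \<noteq> m'" for m m'
    using \<Omega>.indep_vars_lebesgue_integral[OF _ \<Omega>.indep_vars_subset[OF indep], of "{m, m'}"]
      \<Omega>.indep_vars_integrable[OF _ \<Omega>.indep_vars_subset[OF indep], of "{m, m'}"] that int mean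
    by auto
  have int2: "integrable \<Omega> (\<lambda>\<omega>. \<omega> m * \<omega> m')" for m m'
    using int_sq[of m] pair(2)[of m m'] by (cases "m = m'") auto
  have cov: "(\<integral>\<omega>. \<omega> m * \<omega> m' \<partial>\<Omega>) = of_bool (m = m')" for m m'
    using sq[of m] pair(1)[of m m'] by (cases "m = m'") auto
  define Y where "Y e \<omega> = (\<Sum>m | L e m \<noteq> 0. L e m * \<omega> m)" for e \<omega>
  have Ym[measurable]: "Y e \<in> borel_measurable \<Omega>" for e unfolding Y_def by measurable
  define \<nu> where "\<nu> = distr \<Omega> borel (\<lambda>\<omega> e. Y e \<omega>)"
  have m[measurable]: "(\<lambda>\<omega> e. Y e \<omega>) \<in> borel_measurable \<Omega>"
    by (rule measurable_coordinatewise_then_product) simp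
  have c[measurable]: "(\<lambda>y. y e) \<in> borel_measurable borel" for e :: 'a
    by (rule borel_measurable_continuous_onI) simp
  have gauss: "gaussian_rv \<Omega> (\<lambda>\<omega>. \<Sum>e\<in>F. c e * Y e \<omega>)" if F: "finite F" for F c
  proof -
    define G where "G = (\<Union>e\<in>F. {m. L e m \<noteq> 0})"
    define d where "d m = (\<Sum>e\<in>F. c e * L e m)" for m
    \<comment> \<open>Sums of independent normal variables require positive standard deviations, so
      vanishing coefficients are dropped; if none remains, the form is constant and counts as a
      degenerate Gaussian.\<close>
    define G' where "G' = {m\<in>G. d m \<noteq> 0}"
    have G: "finite G" using F fin by (auto simp: G_def)
    have "(\<Sum>e\<in>F. c e * Y e \<omega>) = (\<Sum>m\<in>G'. d m * \<omega> m)" for \<omega>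
    proof -
      have "Y e \<omega> = (\<Sum>m\<in>G. L e m * \<omega> m)" if "e \<in> F" for e
        unfolding Y_def using that G by (intro sum.mono_neutral_left) (auto simp: G_def)
      then have "(\<Sum>e\<in>F. c e * Y e \<omega>) = (\<Sum>e\<in>F. \<Sum>m\<in>G. c e * (L e m * \<omega> m))"
        by (simp add: sum_distrib_left)
      also have "\<dots> = (\<Sum>m\<in>G. d m * \<omega> m)"
        by (subst sum.swap) (simp add: d_def sum_distrib_right mult.assoc)
      also have "\<dots> = (\<Sum>m\<in>G'. d m * \<omega> m)"
        unfolding G'_def using G by (intro sum.mono_neutral_right) auto
      finally show ?thesis .
    qed
    moreover have "gaussian_rv \<Omega> (\<lambda>\<omega>. \<Sum>m\<in>G'. d m * \<omega> m)"
    proof (cases "G' = {}")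
      case True
      then show ?thesis by (auto simp: gaussian_rv_def)
    next
      case False
      have fin': "finite G'" using G by (simp add: G'_def)
      have "distributed \<Omega> lborel (\<lambda>\<omega>. \<Sum>m\<in>G'. d m * \<omega> m)
          (normal_density (\<Sum>m\<in>G'. 0) (sqrt (\<Sum>m\<in>G'. \<bar>d m\<bar>\<^sup>2)))"
      proof (rule \<Omega>.sum_indep_normal[OF fin' False])
        show "\<Omega>.indep_vars (\<lambda>i. borel) (\<lambda>m \<omega>. d m * \<omega> m) G'"
          by (rule \<Omega>.indep_vars_compose2[OF \<Omega>.indep_vars_subset[OF indep]]) auto
        show "distributed \<Omega> lborel (\<lambda>\<omega>. d m * \<omega> m) (normal_density 0 \<bar>d m\<bar>)" if "m \<in> G'" for m
          using \<Omega>.normal_density_affine[OF norm[of m], of "d m" 0] that by (simp add: G'_def)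
      qed (auto simp: G'_def)
      moreover have "sqrt (\<Sum>m\<in>G'. \<bar>d m\<bar>\<^sup>2) > 0"
        using False fin' by (intro real_sqrt_gt_zero sum_pos) (auto simp: G'_def)
      ultimately show ?thesis unfolding gaussian_rv_def by auto
    qed
    ultimately show ?thesis by simp
  qed
  have gauss_\<nu>: "gaussian_rv \<nu> (\<lambda>y. \<Sum>e\<in>F. c e * y e)" if F: "finite F" for F c
  proof -
    have comp: "distr \<nu> lborel (\<lambda>y. \<Sum>e\<in>F. c e * y e) = distr \<Omega> lborel (\<lambda>\<omega>. \<Sum>e\<in>F. c e * Y e \<omega>)"
      unfolding \<nu>_def by (subst distr_distr) (auto simp: comp_def)
    have ae: "(AE y in \<nu>. (\<Sum>e\<in>F. c e * y e) = a) \<longleftrightarrow> (AE \<omega> in \<Omega>. (\<Sum>e\<in>F. c e * Y e \<omega>) = a)" for a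
      unfolding \<nu>_def by (subst AE_distr_iff) auto
    show ?thesis
      using gauss[OF F, of c] unfolding gaussian_rv_def distributed_def comp ae
      by (auto simp: \<nu>_def)
  qed
  have "centered_gaussian_law (\<lambda>e e'. \<Sum>m | L e m \<noteq> 0. L e m * L e' m) \<nu>"
    unfolding centered_gaussian_law_def centered_gaussian_system_def
  proof (intro conjI allI impI)
    show "sets \<nu> = sets borel" by (simp add: \<nu>_def)
    show "prob_space \<nu>" unfolding \<nu>_def by (rule \<Omega>.prob_space_distr) simp
    show "gaussian_rv \<nu> (\<lambda>y. \<Sum>e\<in>F. c e * y e)" if "finite F" for F c
      by (rule gauss_\<nu>[OF that])
    show "(\<integral>y. y e \<partial>\<nu>) = 0" for e
    proof -
      have "(\<integral>y. y e \<partial>\<nu>) = (\<integral>\<omega>. Y e \<omega> \<partial>\<Omega>)"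
        unfolding \<nu>_def by (rule integral_distr[OF m c])
      also have "\<dots> = (\<Sum>m | L e m \<noteq> 0. L e m * (\<integral>\<omega>. \<omega> m \<partial>\<Omega>))"
        unfolding Y_def using int by (subst Bochner_Integration.integral_sum) auto
      also have "\<dots> = 0" by (simp add: mean)
      finally show ?thesis .
    qed
    show "(\<integral>y. y e * y e' \<partial>\<nu>) = (\<Sum>m | L e m \<noteq> 0. L e m * L e' m)" for e e'
    proof -
      have "(\<integral>y. y e * y e' \<partial>\<nu>) = (\<integral>\<omega>. Y e \<omega> * Y e' \<omega> \<partial>\<Omega>)"
        unfolding \<nu>_def by (rule integral_distr[OF m]) measurable
      also have "\<dots> = (\<integral>\<omega>. (\<Sum>m | L e m \<noteq> 0. \<Sum>m' | L e' m' \<noteq> 0. (L e m * L e' m') * (\<omega> m * \<omega> m')) \<partial>\<Omega>)"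
        unfolding Y_def sum_product by (simp only: mult_ac)
      also have "\<dots> = (\<Sum>m | L e m \<noteq> 0. \<Sum>m' | L e' m' \<noteq> 0. (L e m * L e' m') * of_bool (m = m'))"
        using int2 cov by (simp add: Bochner_Integration.integral_sum)
      also have "\<dots> = (\<Sum>m | L e m \<noteq> 0. L e m * L e' m)"
        using fin[of e'] by (intro sum.cong refl) (auto simp: of_bool_def if_distrib sum.delta cong: if_cong)
      finally show ?thesis .
    qed
  qed
  then show ?thesis ..
qed

text \<open>Cholesky factor of the multinomial covariance: the partial sums of the Gaussian vector form a
  Brownian bridge, and \<open>r\<close> is the mass still to come. The junk value \<open>x / 0 = 0\<close> makes all entries
  vanish once the mass is exhausted.\<close>

lemma multinomial_cholesky:
  fixes p :: "nat \<Rightarrow> real"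
  assumes p: "\<And>n. 0 \<le> p n" "\<And>n. (\<Sum>l<n. p l) \<le> 1"
  defines "r \<equiv> \<lambda>n. 1 - (\<Sum>l<n. p l)"
  defines "C \<equiv> \<lambda>n m. if m = n then sqrt (p n * r (Suc n) / r n)
                     else if m < n then - p n * sqrt (p m / (r m * r (Suc m))) else 0"
  shows "(\<Sum>m\<le>n. C n m * C n' m) = p n * (of_bool (n = n') - p n')"
proof -
  have r0: "0 \<le> r n" for n using p(2) by (simp add: r_def)
  have rS: "r (Suc n) = r n - p n" for n by (simp add: r_def)
  \<comment> \<open>Exhausted mass stays exhausted: \<open>r (Suc n) = r n - p n\<close> is
    nonnegative.\<close>
  have tail: "p n = 0" if "r n = 0" for n using that r0[of "Suc n"] p(1)[of n] rS by simp
  have mono: "r n \<le> r m" if "m \<le> n" for m n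
    unfolding r_def using that p(1) by (auto intro!: sum_mono2)
  \<comment> \<open>Each summand is the increment of 1 / r, and r starts at 1. As r decreases,
    \<open>r n \<noteq> 0\<close> keeps all earlier denominators nonzero.\<close>
  have telescope: "r n \<noteq> 0 \<Longrightarrow> (\<Sum>m<n. p m / (r m * r (Suc m))) = 1 / r n - 1" for n
  proof (induction n)
    case (Suc n)
    then have *: "r n \<noteq> 0" "r (Suc n) \<noteq> 0" using mono[of n "Suc n"] r0[of "Suc n"] by auto
    then have "1 / r (Suc n) - 1 / r n = p n / (r n * r (Suc n))" by (simp add: rS field_simps)
    then show ?case using Suc.IH * by simp
  qed (simp add: r_def)
  have lower: "(\<Sum>m<n. C n m * C n' m) = p n * p n' * (\<Sum>m<n. p m / (r m * r (Suc m)))" if "n \<le> n'" for n n'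
  proof -
    have "(\<Sum>m<n. C n m * C n' m) = (\<Sum>m<n. p n * p n' * (p m / (r m * r (Suc m))))"
    proof (rule sum.cong[OF refl])
      fix m assume m: "m \<in> {..<n}"
      define t where "t = p m / (r m * r (Suc m))"
      have "sqrt t * sqrt t = t" using p(1) r0 by (simp add: t_def)
      moreover have "C n m = - p n * sqrt t" "C n' m = - p n' * sqrt t"
        using m that by (auto simp: C_def t_def)
      ultimately show "C n m * C n' m = p n * p n' * (p m / (r m * r (Suc m)))"
        by (simp add: mult_ac flip: t_def)
    qed
    then show ?thesis by (simp add: sum_distrib_left)
  qed
  have le: "(\<Sum>m\<le>n. C n m * C n' m) = p n * (of_bool (n = n') - p n')" if "n \<le> n'" for n n'
  proof (cases "r n = 0")
    case True
    then have "p n = 0" by (rule tail)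
    then have "C n m = 0" for m by (simp add: C_def)
    then show ?thesis using \<open>p n = 0\<close> by simp
  next
    case rn: False
    have low: "(\<Sum>m<n. C n m * C n' m) = p n * p n' * (1 / r n - 1)"
      using lower[OF that] telescope[OF rn] by simp
    have split: "(\<Sum>m\<le>n. C n m * C n' m) = p n * p n' * (1 / r n - 1) + C n n * C n' n"
      using low by (simp add: lessThan_Suc_atMost[symmetric])
    show ?thesis
    proof (cases "n = n'")
      case True
      have "C n n * C n n = p n * r (Suc n) / r n"
        using p(1)[of n] r0[of n] r0[of "Suc n"] by (simp add: C_def)
      then have "(\<Sum>m\<le>n. C n m * C n' m) = p n * p n * (1 / r n - 1) + p n * (r n - p n) / r n"
        using split True by (simp add: rS)
      then show ?thesis using rn True by (simp add: field_simps)
    next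
      case False
      then have lt: "n < n'" using that by simp
      show ?thesis
      proof (cases "r (Suc n) = 0")
        case True
        then have "p n' = 0" using mono[of "Suc n" n'] r0[of n'] lt by (intro tail) auto
        then show ?thesis using split False by (simp add: C_def)
      next
        case False
        \<comment> \<open>The diagonal term contributes - p n' * p n / r n, which cancels the 1 / r
          n of the telescoped sum and leaves the covariance - p n * p n'.\<close>
        have "C n n * C n' n = - p n' * (sqrt (p n * r (Suc n) / r n) * sqrt (p n / (r n * r (Suc n))))"
          using lt by (simp add: C_def)
        also have "sqrt (p n * r (Suc n) / r n) * sqrt (p n / (r n * r (Suc n))) = sqrt ((p n / r n)\<^sup>2)"
          using False by (simp add: real_sqrt_mult[symmetric] power2_eq_square)
        also have "\<dots> = p n / r n" using p(1)[of n] r0[of n] by simp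
        finally show ?thesis using split lt rn by (simp add: field_simps)
      qed
    qed
  qed
  show ?thesis
  proof (cases "n \<le> n'")
    case True
    then show ?thesis by (rule le)
  next
    case False
    \<comment> \<open>The factor is lower triangular, so row \<open>n'\<close> vanishes beyond its
      diagonal and the roles of the two indices can be exchanged.\<close>
    have "(\<Sum>m\<le>n. C n m * C n' m) = (\<Sum>m\<le>n'. C n m * C n' m)"
      using False by (intro sum.mono_neutral_right) (auto simp: C_def)
    also have "\<dots> = p n' * (of_bool (n' = n) - p n)"
      using le[of n' n] False by (simp add: mult.commute)
    finally show ?thesis using False by simp
  qed
qed

text \<open>The alphabet is moved to the naturals by \<open>to_nat\<close>, where numbers without
  preimage get mass 0, and each block is factorised by Cholesky. Distinct \<open>i\<close> use
  disjoint families of normal variables, which makes the covariance block diagonal; sqrt (\<mu> i)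
  scales the block.\<close>

lemma multinomial_gaussian_law_exists:
  fixes Q :: "'i::countable \<Rightarrow> 's::countable pmf"
  assumes \<mu>: "\<And>i. 0 \<le> \<mu> i"
  shows "\<exists>\<nu>. centered_gaussian_law (\<lambda>(i, s) (i', s').
    \<mu> i * of_bool (i = i') * pmf (Q i) s * (of_bool (s = s') - pmf (Q i') s')) \<nu>"
proof -
  define p where "p i n = pmf (map_pmf to_nat (Q i)) n" for i and n :: nat
  have p: "0 \<le> p i n" "(\<Sum>l<n. p i l) \<le> 1" for i n
  proof -
    have "(\<Sum>l<n. p i l) = measure_pmf.prob (map_pmf to_nat (Q i)) {..<n}"
      by (simp add: p_def measure_measure_pmf_finite del: measure_map_pmf)
    then show "(\<Sum>l<n. p i l) \<le> 1" by simp
  qed (simp add: p_def)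
  have p_eq: "p i (to_nat s) = pmf (Q i) s" for i s
    unfolding p_def by (rule pmf_map_inj') simp
  define r where "r i n = 1 - (\<Sum>l<n. p i l)" for i n
  define C where "C i n m = (if m = n then sqrt (p i n * r i (Suc n) / r i n)
     else if m < n then - p i n * sqrt (p i m / (r i m * r i (Suc m))) else 0)" for i n m
  have chol: "(\<Sum>m\<le>n. C i n m * C i n' m) = p i n * (of_bool (n = n') - p i n')" for i n n'
    unfolding C_def r_def by (rule multinomial_cholesky[OF p])
  define L where "L = (\<lambda>(i, s::'s) (i', m). of_bool (i = i') * sqrt (\<mu> i) * C i (to_nat s) m)"
  have sub: "{x. L e x \<noteq> 0} \<subseteq> {fst e} \<times> {..to_nat (snd e)}" for e :: "'i \<times> 's"
    by (cases e) (auto simp: L_def C_def split: if_splits)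
  have "\<exists>\<nu>. centered_gaussian_law (\<lambda>e e'. \<Sum>x | L e x \<noteq> 0. L e x * L e' x) \<nu>"
    by (rule centered_gaussian_law_of_factor) (rule finite_subset[OF sub], simp)
  also have "(\<lambda>e e'. \<Sum>x | L e x \<noteq> 0. L e x * L e' x) = (\<lambda>(i, s) (i', s').
    \<mu> i * of_bool (i = i') * pmf (Q i) s * (of_bool (s = s') - pmf (Q i') s'))"
  proof (intro ext, clarify)
    fix i s i' s'
    have "(\<Sum>x | L (i, s) x \<noteq> 0. L (i, s) x * L (i', s') x) =
        (\<Sum>x\<in>{i} \<times> {..to_nat s}. L (i, s) x * L (i', s') x)"
      using sub[of "(i, s)"] by (intro sum.mono_neutral_left) auto
    also have "\<dots> = (\<Sum>m\<le>to_nat s. L (i, s) (i, m) * L (i', s') (i, m))"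
      by (simp add: sum.cartesian_product')
    also have "\<dots> = (\<Sum>m\<le>to_nat s. of_bool (i = i') * \<mu> i * (C i (to_nat s) m * C i (to_nat s') m))"
      using \<mu> by (intro sum.cong) (auto simp: L_def mult_ac)
    also have "\<dots> = of_bool (i = i') * \<mu> i * (\<Sum>m\<le>to_nat s. C i (to_nat s) m * C i (to_nat s') m)"
      by (simp add: sum_distrib_left)
    also have "\<dots> = \<mu> i * of_bool (i = i') * pmf (Q i) s * (of_bool (s = s') - pmf (Q i') s')"
      unfolding chol p_eq by auto
    finally show "(\<Sum>x | L (i, s) x \<noteq> 0. L (i, s) x * L (i', s') x) =
      \<mu> i * of_bool (i = i') * pmf (Q i) s * (of_bool (s = s') - pmf (Q i') s')" .
  qed
  finally show ?thesis .
qed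

section \<open>Martingale sums along the paths of a Markov renewal chain\<close>

text \<open>Adding \<open>B\<close> makes the function nonnegative, so that the identity for
  nonnegative integrals applies; boundedness then permits subtracting \<open>B\<close>
  again.\<close>

lemma expectation_bind_pmf_real:
  fixes f :: "'b \<Rightarrow> real"
  assumes bound: "\<And>x. \<bar>f x\<bar> \<le> B"
  shows "measure_pmf.expectation (bind_pmf p N) f =
         measure_pmf.expectation p (\<lambda>x. measure_pmf.expectation (N x) f)"
proof -
  have B: "\<bar>f x\<bar> \<le> B" "0 \<le> f x + B" for x using bound[of x] by auto
  have int: "integrable (measure_pmf r) f" for r
    by (rule measure_pmf.integrable_const_bound[of _ B]) (use B in auto)
  have inner: "0 \<le> measure_pmf.expectation r (\<lambda>x. f x + B)" for r
    by (rule Bochner_Integration.integral_nonneg) (use B in auto)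
  have inner_le: "measure_pmf.expectation r (\<lambda>x. f x + B) \<le> 2 * B" for r
    using measure_pmf.integral_le_const[of r "\<lambda>x. f x + B" "2 * B"] int B(1)
    by (auto simp: abs_le_iff)
  have int2: "integrable p (\<lambda>x. measure_pmf.expectation (N x) (\<lambda>y. f y + B))"
    by (rule measure_pmf.integrable_const_bound[of _ "2 * B"]) (use inner inner_le in auto)
  have eq: "measure_pmf.expectation r (\<lambda>x. f x + B) = measure_pmf.expectation r f + B" for r
    using int by simp
  have "ennreal (measure_pmf.expectation (bind_pmf p N) (\<lambda>x. f x + B)) = (\<integral>\<^sup>+x. ennreal (f x + B) \<partial>bind_pmf p N)"
    by (rule nn_integral_eq_integral[symmetric]) (use int B in auto)
  also have "\<dots> = (\<integral>\<^sup>+x. ennreal (measure_pmf.expectation (N x) (\<lambda>y. f y + B)) \<partial>p)"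
    unfolding nn_integral_bind_pmf by (intro nn_integral_cong nn_integral_eq_integral) (use int B in auto)
  also have "\<dots> = ennreal (measure_pmf.expectation p (\<lambda>x. measure_pmf.expectation (N x) (\<lambda>y. f y + B)))"
    by (rule nn_integral_eq_integral[OF int2]) (use inner in auto)
  finally have "measure_pmf.expectation (bind_pmf p N) (\<lambda>x. f x + B) =
      measure_pmf.expectation p (\<lambda>x. measure_pmf.expectation (N x) (\<lambda>y. f y + B))"
    using inner by (subst (asm) ennreal_inj) (auto intro!: Bochner_Integration.integral_nonneg)
  moreover have "integrable p (\<lambda>x. measure_pmf.expectation (N x) f)"
    using Bochner_Integration.integrable_diff[OF int2, of "\<lambda>_. B"] unfolding eq by simp
  ultimately show ?thesis unfolding eq by simp
qed

lemma expectation_bind_pmf_complex: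
  fixes f :: "'b \<Rightarrow> complex"
  assumes bound: "\<And>x. norm (f x) \<le> B"
  shows "measure_pmf.expectation (bind_pmf p N) f =
         measure_pmf.expectation p (\<lambda>x. measure_pmf.expectation (N x) f)"
proof -
  have int: "integrable (measure_pmf r) f" for r
    by (rule measure_pmf.integrable_const_bound[of _ B]) (use bound in auto)
  have "norm (measure_pmf.expectation r f) \<le> B" for r
  proof -
    have "norm (measure_pmf.expectation r f) \<le> measure_pmf.expectation r (\<lambda>x. norm (f x))"
      by (rule integral_norm_bound)
    also have "\<dots> \<le> B"
      using measure_pmf.integral_le_const[of r "\<lambda>x. norm (f x)" B] int bound by auto
    finally show ?thesis .
  qed
  then have int2: "integrable p (\<lambda>x. measure_pmf.expectation (N x) f)"
    by (intro measure_pmf.integrable_const_bound[of _ B]) auto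
  have "\<bar>Re (f x)\<bar> \<le> B" "\<bar>Im (f x)\<bar> \<le> B" for x
    using abs_Re_le_cmod[of "f x"] abs_Im_le_cmod[of "f x"] bound[of x] by auto
  then show ?thesis
    using expectation_bind_pmf_real[of "\<lambda>x. Re (f x)" B p N] expectation_bind_pmf_real[of "\<lambda>x. Im (f x)" B p N]
      int int2 by (simp add: complex_eq_iff)
qed

text \<open>Paths of a Markov renewal chain are lists of pairs (state entered, sojourn time), the latest first.\<close>

definition cur :: "'e \<Rightarrow> ('e \<times> nat) list \<Rightarrow> 'e" where
  "cur i\<^sub>0 h = (case h of [] \<Rightarrow> i\<^sub>0 | s # _ \<Rightarrow> fst s)"

definition tot :: "('e \<times> nat) list \<Rightarrow> nat" where
  "tot h = sum_list (map snd h)"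

text \<open>Additive functional of a path. The summand receives the past \<open>h\<close> and the
  next jump \<open>s\<close> separately: a factor that depends on \<open>h\<close> alone is
  predictable, and centring in \<open>s\<close> given \<open>h\<close> yields martingale
  differences.\<close>

primrec asum :: "('s list \<Rightarrow> 's \<Rightarrow> real) \<Rightarrow> 's list \<Rightarrow> real" where
  "asum f [] = 0"
| "asum f (s # h) = asum f h + f h s"

primrec mr_path :: "('e \<Rightarrow> ('e \<times> nat) pmf) \<Rightarrow> 'e \<Rightarrow> nat \<Rightarrow> ('e \<times> nat) list pmf" where
  "mr_path Q i\<^sub>0 0 = return_pmf []"
| "mr_path Q i\<^sub>0 (Suc n) = bind_pmf (mr_path Q i\<^sub>0 n) (\<lambda>h. map_pmf (\<lambda>s. s # h) (Q (cur i\<^sub>0 h)))"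

text \<open>The weight of the jump following the mr_path \<open>h\<close> when the chain is stopped after its first jump
  beyond time \<open>M\<close>; since it depends on the past only, weighted sums of martingale differences stay
  martingales.\<close>

definition wt :: "nat \<Rightarrow> ('e \<times> nat) list \<Rightarrow> real" where
  "wt M h = of_bool (tot h \<le> M)"

definition visits :: "nat \<Rightarrow> 'e \<Rightarrow> 'e \<Rightarrow> ('e \<times> nat) list \<Rightarrow> real" where
  "visits M i\<^sub>0 i = asum (\<lambda>h s. wt M h * of_bool (cur i\<^sub>0 h = i))"

section \<open>Additive functionals and the laws of finite paths\<close>

lemma cur_simps[simp]: "cur i\<^sub>0 [] = i\<^sub>0" "cur i\<^sub>0 (s # h) = fst s"
  by (simp_all add: cur_def)

lemma tot_simps[simp]: "tot [] = 0" "tot (s # h) = snd s + tot h"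
  by (simp_all add: tot_def)

lemma wt_bounds: "0 \<le> wt M h" "wt M h \<le> 1" "\<bar>wt M h\<bar> \<le> 1"
  by (simp_all add: wt_def)

lemma asum_add: "asum (\<lambda>h s. f h s + g h s) h = asum f h + asum g h"
  by (induction h) auto

lemma asum_cmult: "asum (\<lambda>h s. c * f h s) h = c * asum f h"
  by (induction h) (auto simp: algebra_simps)

lemma asum_sum: "asum (\<lambda>h s. \<Sum>i\<in>I. f i h s) h = (\<Sum>i\<in>I. asum (f i) h)"
  by (induction h) (auto simp: sum.distrib)

lemma asum_mono: "(\<And>h s. f h s \<le> g h s) \<Longrightarrow> asum f h \<le> asum g h"
  by (induction h) (auto intro: add_mono)

lemma asum_nonneg: "(\<And>h s. 0 \<le> f h s) \<Longrightarrow> 0 \<le> asum f h"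
  by (induction h) (auto intro: add_nonneg_nonneg)

lemma abs_asum_le: "\<bar>asum f h\<bar> \<le> asum (\<lambda>h s. \<bar>f h s\<bar>) h"
  by (induction h) (auto intro: order_trans[OF abs_triangle_ineq])

lemma asum_const: "asum (\<lambda>h s. c) h = real (length h) * c"
  by (induction h) (auto simp: algebra_simps)

lemma abs_asum_bound:
  assumes "\<And>h s. \<bar>f h s\<bar> \<le> B"
  shows "\<bar>asum f h\<bar> \<le> real (length h) * B"
  using abs_asum_le[of f h] asum_mono[of "\<lambda>h s. \<bar>f h s\<bar>" "\<lambda>h s. B" h] assms
  by (simp add: asum_const)

lemma set_path:
  "h \<in> set_pmf (mr_path Q i\<^sub>0 n) \<Longrightarrow> length h = n"
  by (induction n arbitrary: h) auto

text \<open>The reason why paths of \<open>Suc M\<close> jumps suffice for time horizon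
  \<open>M\<close>: they have always passed it.\<close>

lemma tot_ge_length:
  assumes "\<And>i s. s \<in> set_pmf (Q i) \<Longrightarrow> 1 \<le> snd s"
  shows "h \<in> set_pmf (mr_path Q i\<^sub>0 n) \<Longrightarrow> n \<le> tot h"
  by (induction n arbitrary: h) (use assms in force)+

lemma integrable_path:
  fixes f :: "('e \<times> nat) list \<Rightarrow> 'b::{banach, second_countable_topology}"
  assumes "\<And>h. length h = n \<Longrightarrow> norm (f h) \<le> B"
  shows "integrable (mr_path Q i\<^sub>0 n) f"
  by (rule measure_pmf.integrable_const_bound[of _ B]) (use assms in \<open>auto simp: AE_measure_pmf_iff dest: set_path\<close>)

lemma expectation_path_mono:
  fixes f g :: "('e \<times> nat) list \<Rightarrow> real"
  assumes "integrable (mr_path Q i\<^sub>0 n) f" "integrable (mr_path Q i\<^sub>0 n) g"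
    and "\<And>h. length h = n \<Longrightarrow> f h \<le> g h"
  shows "measure_pmf.expectation (mr_path Q i\<^sub>0 n) f \<le> measure_pmf.expectation (mr_path Q i\<^sub>0 n) g"
  by (rule integral_mono_AE) (use assms in \<open>auto simp: AE_measure_pmf_iff dest: set_path\<close>)

text \<open>Tower property at the last jump. The functionals in question are bounded only on lists
  of a given length, so the proof truncates to zero elsewhere.\<close>

lemma expectation_path_Suc:
  fixes f :: "('e \<times> nat) list \<Rightarrow> real"
  assumes "\<And>h. length h = Suc n \<Longrightarrow> \<bar>f h\<bar> \<le> B"
  shows "measure_pmf.expectation (mr_path Q i\<^sub>0 (Suc n)) f =
    measure_pmf.expectation (mr_path Q i\<^sub>0 n) (\<lambda>h. measure_pmf.expectation (Q (cur i\<^sub>0 h)) (\<lambda>s. f (s # h)))"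
proof -
  define g where "g h = (if length h = Suc n then f h else 0)" for h
  have g: "\<bar>g h\<bar> \<le> max B 0" for h using assms[of h] by (auto simp: g_def)
  have "measure_pmf.expectation (mr_path Q i\<^sub>0 (Suc n)) f = measure_pmf.expectation (mr_path Q i\<^sub>0 (Suc n)) g"
    by (rule integral_cong_AE) (auto simp: AE_measure_pmf_iff g_def dest!: set_path simp del: mr_path.simps)
  also have "\<dots> = measure_pmf.expectation (mr_path Q i\<^sub>0 n) (\<lambda>h. measure_pmf.expectation (Q (cur i\<^sub>0 h)) (\<lambda>s. g (s # h)))"
    by (simp only: mr_path.simps expectation_bind_pmf_real[of g, OF g] integral_map_pmf)
  also have "\<dots> = measure_pmf.expectation (mr_path Q i\<^sub>0 n) (\<lambda>h. measure_pmf.expectation (Q (cur i\<^sub>0 h)) (\<lambda>s. f (s # h)))"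
    by (rule integral_cong_AE) (auto simp: AE_measure_pmf_iff g_def dest!: set_path)
  finally show ?thesis .
qed

lemma expectation_path_Suc_complex:
  fixes f :: "('e \<times> nat) list \<Rightarrow> complex"
  assumes "\<And>h. length h = Suc n \<Longrightarrow> norm (f h) \<le> B"
  shows "measure_pmf.expectation (mr_path Q i\<^sub>0 (Suc n)) f =
    measure_pmf.expectation (mr_path Q i\<^sub>0 n) (\<lambda>h. measure_pmf.expectation (Q (cur i\<^sub>0 h)) (\<lambda>s. f (s # h)))"
proof -
  define g where "g h = (if length h = Suc n then f h else 0)" for h
  have g: "norm (g h) \<le> max B 0" for h using assms[of h] by (auto simp: g_def)
  have "measure_pmf.expectation (mr_path Q i\<^sub>0 (Suc n)) f = measure_pmf.expectation (mr_path Q i\<^sub>0 (Suc n)) g"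
    by (rule integral_cong_AE) (auto simp: AE_measure_pmf_iff g_def dest!: set_path simp del: mr_path.simps)
  also have "\<dots> = measure_pmf.expectation (mr_path Q i\<^sub>0 n) (\<lambda>h. measure_pmf.expectation (Q (cur i\<^sub>0 h)) (\<lambda>s. g (s # h)))"
    by (simp only: mr_path.simps expectation_bind_pmf_complex[of g, OF g] integral_map_pmf)
  also have "\<dots> = measure_pmf.expectation (mr_path Q i\<^sub>0 n) (\<lambda>h. measure_pmf.expectation (Q (cur i\<^sub>0 h)) (\<lambda>s. f (s # h)))"
    by (rule integral_cong_AE) (auto simp: AE_measure_pmf_iff g_def dest!: set_path)
  finally show ?thesis .
qed

text \<open>Phrased with nonnegative integrals, so that unbounded truncation remainders need no
  integrability argument on path space.\<close>

lemma nn_integral_asum_le: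
  fixes Q :: "'e \<Rightarrow> ('e \<times> nat) pmf"
  assumes "\<And>h s. 0 \<le> f h s" "0 \<le> c"
    and "\<And>h. (\<integral>\<^sup>+s. ennreal (f h s) \<partial>Q (cur i\<^sub>0 h)) \<le> ennreal c"
  shows "(\<integral>\<^sup>+h. ennreal (asum f h) \<partial>mr_path Q i\<^sub>0 n) \<le> ennreal (real n * c)"
proof (induction n)
  case (Suc n)
  have "(\<integral>\<^sup>+h. ennreal (asum f h) \<partial>mr_path Q i\<^sub>0 (Suc n)) =
    (\<integral>\<^sup>+h. (\<integral>\<^sup>+s. ennreal (asum f h) + ennreal (f h s) \<partial>Q (cur i\<^sub>0 h)) \<partial>mr_path Q i\<^sub>0 n)"
    using assms(1) by (simp add: asum_nonneg)
  also have "\<dots> = (\<integral>\<^sup>+h. ennreal (asum f h) + (\<integral>\<^sup>+s. ennreal (f h s) \<partial>Q (cur i\<^sub>0 h)) \<partial>mr_path Q i\<^sub>0 n)"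
    by (subst nn_integral_add) auto
  also have "\<dots> \<le> (\<integral>\<^sup>+h. ennreal (asum f h) + ennreal c \<partial>mr_path Q i\<^sub>0 n)"
    by (intro nn_integral_mono add_left_mono assms)
  also have "\<dots> = (\<integral>\<^sup>+h. ennreal (asum f h) \<partial>mr_path Q i\<^sub>0 n) + ennreal c"
    by (subst nn_integral_add) auto
  also have "\<dots> \<le> ennreal (real n * c) + ennreal c" by (intro add_right_mono Suc.IH)
  also have "\<dots> = ennreal (real (Suc n) * c)"
    using assms(2) by (simp add: ennreal_plus[symmetric] algebra_simps del: ennreal_plus)
  finally show ?case .
qed simp

text \<open>Martingale differences are orthogonal: given the past, the mixed term of the square has
  mean zero, and each jump adds at most the square of the bound.\<close>

lemma expectation_asum_square_le:
  assumes B: "\<And>h s. \<bar>f h s\<bar> \<le> B"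
    and mean: "\<And>h. measure_pmf.expectation (Q (cur i\<^sub>0 h)) (f h) = 0"
  shows "measure_pmf.expectation (mr_path Q i\<^sub>0 n) (\<lambda>h. (asum f h)\<^sup>2) \<le> real n * B\<^sup>2"
proof (induction n)
  case (Suc n)
  have B0: "0 \<le> B" using B[of "[]" undefined] by linarith
  have bound: "(asum f h)\<^sup>2 \<le> (real n * B)\<^sup>2" if "length h = n" for h n
    using abs_asum_bound[of f B h] B that by (metis abs_le_square_iff abs_of_nonneg B0 mult_nonneg_nonneg of_nat_0_le_iff)
  have int: "integrable (mr_path Q i\<^sub>0 n) (\<lambda>h. (asum f h)\<^sup>2)"
    by (rule integrable_path[of n _ "(real n * B)\<^sup>2"]) (use bound in auto)
  have intf: "integrable (measure_pmf p) (f h)" "integrable (measure_pmf p) (\<lambda>s. (f h s)\<^sup>2)" for p h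
  proof -
    show "integrable (measure_pmf p) (f h)"
      by (rule measure_pmf.integrable_const_bound[of _ B]) (use B in auto)
    show "integrable (measure_pmf p) (\<lambda>s. (f h s)\<^sup>2)"
      by (rule measure_pmf.integrable_const_bound[of _ "B\<^sup>2"]) (use B in \<open>auto simp: abs_le_square_iff[symmetric] B0\<close>)
  qed
  have inner: "measure_pmf.expectation (Q (cur i\<^sub>0 h)) (\<lambda>s. (asum f h + f h s)\<^sup>2) =
      (asum f h)\<^sup>2 + measure_pmf.expectation (Q (cur i\<^sub>0 h)) (\<lambda>s. (f h s)\<^sup>2)" for h
    using intf[of "Q (cur i\<^sub>0 h)" h] mean[of h] by (simp add: power2_sum)
  have sq_le: "measure_pmf.expectation (Q (cur i\<^sub>0 h)) (\<lambda>s. (f h s)\<^sup>2) \<le> B\<^sup>2" for h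
    using measure_pmf.integral_le_const[OF intf(2)[of "Q (cur i\<^sub>0 h)" h], of "B\<^sup>2"] B B0
    by (simp add: abs_le_square_iff[symmetric])
  have "measure_pmf.expectation (mr_path Q i\<^sub>0 (Suc n)) (\<lambda>h. (asum f h)\<^sup>2) =
     measure_pmf.expectation (mr_path Q i\<^sub>0 n) (\<lambda>h. (asum f h)\<^sup>2 + measure_pmf.expectation (Q (cur i\<^sub>0 h)) (\<lambda>s. (f h s)\<^sup>2))"
    by (subst expectation_path_Suc[of n _ "(real (Suc n) * B)\<^sup>2"]) (use bound[of _ "Suc n"] inner in auto)
  also have "\<dots> \<le> measure_pmf.expectation (mr_path Q i\<^sub>0 n) (\<lambda>h. (asum f h)\<^sup>2 + B\<^sup>2)"
  proof (rule expectation_path_mono)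
    show "integrable (mr_path Q i\<^sub>0 n) (\<lambda>h. (asum f h)\<^sup>2 + measure_pmf.expectation (Q (cur i\<^sub>0 h)) (\<lambda>s. (f h s)\<^sup>2))"
      using sq_le by (intro integrable_path[of n _ "(real n * B)\<^sup>2 + B\<^sup>2"]) (auto intro!: add_mono bound)
    show "integrable (mr_path Q i\<^sub>0 n) (\<lambda>h. (asum f h)\<^sup>2 + B\<^sup>2)" using int by simp
  qed (use sq_le in auto)
  also have "\<dots> = measure_pmf.expectation (mr_path Q i\<^sub>0 n) (\<lambda>h. (asum f h)\<^sup>2) + B\<^sup>2"
    using int by simp
  also have "\<dots> \<le> real n * B\<^sup>2 + B\<^sup>2" using Suc.IH by simp
  finally show ?case by (simp add: algebra_simps)
qed simp

text \<open>Truncation at level \<open>m\<close> splits the increments into a bounded centred part,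
  whose sum is of order sqrt n in mean by orthogonality, and a remainder of small conditional mean.
  The estimate is uniform in the weights because it is later used with \<open>wt M\<close> and n =
  \<open>Suc M\<close>, which change together.\<close>

lemma asum_L1_lln:
  fixes Q :: "'e::finite \<Rightarrow> ('e \<times> nat) pmf" and G :: "'e \<Rightarrow> 'e \<times> nat \<Rightarrow> real"
  assumes int: "\<And>j. integrable (Q j) (G j)"
    and mean: "\<And>j. measure_pmf.expectation (Q j) (G j) = 0"
    and "0 < \<epsilon>"
  shows "\<forall>\<^sub>F n in sequentially. \<forall>i\<^sub>0 w. (\<forall>h. \<bar>w h\<bar> \<le> 1) \<longrightarrow>
    (\<integral>\<^sup>+h. ennreal \<bar>asum (\<lambda>h s. w h * G (cur i\<^sub>0 h) s) h\<bar> \<partial>mr_path Q i\<^sub>0 n) \<le> ennreal (\<epsilon> * real n)"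
proof -
  \<comment> \<open>The discarded part and the recentring cost \<delta> per jump each, together half
    of \<epsilon> n; the martingale part gets the other half.\<close>
  define \<delta> where "\<delta> = \<epsilon> / 4"
  have "0 < \<delta>" using \<open>0 < \<epsilon>\<close> by (simp add: \<delta>_def)
  have "\<forall>\<^sub>F m in sequentially. measure_pmf.expectation (Q j) (\<lambda>s. \<bar>G j s * of_bool (\<bar>G j s\<bar> > real m)\<bar>) < \<delta>" for j
  proof -
    have "(\<lambda>m. measure_pmf.expectation (Q j) (\<lambda>s. \<bar>G j s * of_bool (\<bar>G j s\<bar> > real m)\<bar>))
      \<longlonglongrightarrow> measure_pmf.expectation (Q j) (\<lambda>s. 0)"
    proof (rule integral_dominated_convergence[where w="\<lambda>s. \<bar>G j s\<bar>"])
      have "(\<lambda>m. \<bar>G j s * of_bool (\<bar>G j s\<bar> > real m)\<bar>) \<longlonglongrightarrow> 0" for s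
      proof (rule tendsto_eventually)
        show "\<forall>\<^sub>F m in sequentially. \<bar>G j s * of_bool (\<bar>G j s\<bar> > real m)\<bar> = 0"
          using eventually_ge_at_top[of "nat \<lceil>\<bar>G j s\<bar>\<rceil>"]
        proof eventually_elim
          case (elim m)
          then have "\<not> \<bar>G j s\<bar> > real m" by linarith
          then show ?case by simp
        qed
      qed
      then show "AE s in Q j. (\<lambda>m. \<bar>G j s * of_bool (\<bar>G j s\<bar> > real m)\<bar>) \<longlonglongrightarrow> 0" by simp
    qed (use int in auto)
    then show ?thesis using \<open>0 < \<delta>\<close> by (auto dest: order_tendstoD(2))
  qed
  then have "\<forall>\<^sub>F m in sequentially. \<forall>j. measure_pmf.expectation (Q j) (\<lambda>s. \<bar>G j s * of_bool (\<bar>G j s\<bar> > real m)\<bar>) < \<delta>"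
    by (rule eventually_all_finite)
  then obtain m where m: "\<And>j. measure_pmf.expectation (Q j) (\<lambda>s. \<bar>G j s * of_bool (\<bar>G j s\<bar> > real m)\<bar>) < \<delta>"
    by (auto simp: eventually_sequentially)
  define D where "D j s = G j s * of_bool (\<bar>G j s\<bar> > real m)" for j s
  define T where "T j s = G j s - D j s" for j s
  define t where "t j = measure_pmf.expectation (Q j) (T j)" for j
  have T_le: "\<bar>T j s\<bar> \<le> real m" for j s by (auto simp: T_def D_def)
  have intT: "integrable (Q j) (T j)" for j
    by (rule measure_pmf.integrable_const_bound[of _ "real m"]) (use T_le in auto)
  have intD: "integrable (Q j) (D j)" for j
    using Bochner_Integration.integrable_diff[OF int intT, of j] by (simp add: T_def)
  have D_le: "measure_pmf.expectation (Q j) (\<lambda>s. \<bar>D j s\<bar>) \<le> \<delta>" for j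
    using m[of j] by (simp add: D_def)
  \<comment> \<open>As the full increment is centred, the mean of the truncated part is minus that
    of the discarded part, hence small.\<close>
  have t_eq: "t j = - measure_pmf.expectation (Q j) (D j)" for j
    using int[of j] intD[of j] mean[of j] by (simp add: t_def T_def[abs_def])
  have t_le: "\<bar>t j\<bar> \<le> \<delta>" for j
    unfolding t_eq abs_minus_cancel using integral_abs_bound D_le by (rule order_trans)
  have t_le': "\<bar>t j\<bar> \<le> real m" for j
    unfolding t_def using integral_abs_bound
  proof (rule order_trans)
    show "measure_pmf.expectation (Q j) (\<lambda>s. \<bar>T j s\<bar>) \<le> real m"
      by (rule measure_pmf.integral_le_const) (use intT T_le in auto)
  qed
  show ?thesis
    \<comment> \<open>From this n on, the second moment bound 4 m^2 n divided by \<epsilon> n is at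
      most \<epsilon> n / 4.\<close>
    using eventually_ge_at_top[of "nat \<lceil>16 * (real m)\<^sup>2 / \<epsilon>\<^sup>2\<rceil> + 1"]
  proof eventually_elim
    case (elim n)
    then have n: "0 < real n" "16 * (real m)\<^sup>2 / \<epsilon>\<^sup>2 \<le> real n" by linarith+
    show ?case
    proof (intro allI impI)
      fix i\<^sub>0 and w :: "('e \<times> nat) list \<Rightarrow> real" assume w: "\<forall>h. \<bar>w h\<bar> \<le> 1"
      define a where "a = asum (\<lambda>h s. w h * (T (cur i\<^sub>0 h) s - t (cur i\<^sub>0 h)))"
      define b where "b = asum (\<lambda>h s. \<bar>D (cur i\<^sub>0 h) s\<bar> + \<bar>t (cur i\<^sub>0 h)\<bar>)"
      have w_mult: "\<bar>w h * x\<bar> \<le> \<bar>x\<bar>" for h x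
        using mult_right_mono[OF w[rule_format, of h], of "\<bar>x\<bar>"] by (simp add: abs_mult)
      have Tt: "\<bar>w h * (T j s - t j)\<bar> \<le> 2 * real m" for h j s
        using w_mult[of h "T j s - t j"] T_le[of j s] t_le'[of j] by linarith
      have a2: "measure_pmf.expectation (mr_path Q i\<^sub>0 n) (\<lambda>h. (a h)\<^sup>2) \<le> real n * (2 * real m)\<^sup>2"
        unfolding a_def
      proof (rule expectation_asum_square_le)
        show "measure_pmf.expectation (Q (cur i\<^sub>0 h)) (\<lambda>s. w h * (T (cur i\<^sub>0 h) s - t (cur i\<^sub>0 h))) = 0" for h
          using intT by (simp add: t_def)
      qed (rule Tt)
      have a_bound: "\<bar>a h\<bar> \<le> real n * (2 * real m)" if "length h = n" for h
        using abs_asum_bound[of "\<lambda>h s. w h * (T (cur i\<^sub>0 h) s - t (cur i\<^sub>0 h))" "2 * real m" h] Tt that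
        unfolding a_def by auto
      have int_a: "integrable (mr_path Q i\<^sub>0 n) a"
        by (rule integrable_path[of n _ "real n * (2 * real m)"]) (use a_bound in auto)
      have "\<bar>(a h)\<^sup>2\<bar> \<le> (real n * (2 * real m))\<^sup>2" if "length h = n" for h
        using a_bound[OF that] by (simp add: abs_le_square_iff[symmetric])
      then have int_a2: "integrable (mr_path Q i\<^sub>0 n) (\<lambda>h. (a h)\<^sup>2)"
        by (intro integrable_path[of n _ "(real n * (2 * real m))\<^sup>2"]) auto
      \<comment> \<open>Passes from second to first moments; the weight is chosen so that the
        additive term is a quarter of \<epsilon> n.\<close>
      have amgm: "\<bar>x\<bar> \<le> x\<^sup>2 / (\<epsilon> * real n) + \<epsilon> * real n / 4" for x
      proof -
        have "0 \<le> (\<bar>x\<bar> - \<epsilon> * real n / 2)\<^sup>2" by simp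
        then have "\<epsilon> * real n * \<bar>x\<bar> \<le> x\<^sup>2 + (\<epsilon> * real n)\<^sup>2 / 4"
          by (simp add: power2_diff field_simps power_divide)
        then show ?thesis using n \<open>0 < \<epsilon>\<close> by (simp add: field_simps power2_eq_square)
      qed
      have "measure_pmf.expectation (mr_path Q i\<^sub>0 n) (\<lambda>h. \<bar>a h\<bar>) \<le>
          measure_pmf.expectation (mr_path Q i\<^sub>0 n) (\<lambda>h. (a h)\<^sup>2 / (\<epsilon> * real n) + \<epsilon> * real n / 4)"
        by (rule integral_mono) (use int_a int_a2 amgm in auto)
      also have "\<dots> = measure_pmf.expectation (mr_path Q i\<^sub>0 n) (\<lambda>h. (a h)\<^sup>2) / (\<epsilon> * real n) + \<epsilon> * real n / 4"
        using int_a2 by simp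
      also have "\<dots> \<le> real n * (2 * real m)\<^sup>2 / (\<epsilon> * real n) + \<epsilon> * real n / 4"
        using a2 n \<open>0 < \<epsilon>\<close> by (intro add_right_mono divide_right_mono) auto
      also have "\<dots> \<le> \<epsilon> * real n / 2"
      proof -
        have "16 * (real m)\<^sup>2 \<le> real n * \<epsilon>\<^sup>2" using n(2) \<open>0 < \<epsilon>\<close> by (simp add: field_simps)
        then show ?thesis using n \<open>0 < \<epsilon>\<close> by (simp add: field_simps power2_eq_square)
      qed
      finally have Ea: "(\<integral>\<^sup>+h. ennreal \<bar>a h\<bar> \<partial>mr_path Q i\<^sub>0 n) \<le> ennreal (\<epsilon> * real n / 2)"
        using int_a by (subst nn_integral_eq_integral) (auto intro: ennreal_leI)
      have Eb: "(\<integral>\<^sup>+h. ennreal (b h) \<partial>mr_path Q i\<^sub>0 n) \<le> ennreal (real n * (2 * \<delta>))"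
        unfolding b_def
      proof (rule nn_integral_asum_le)
        fix h
        have "(\<integral>\<^sup>+s. ennreal (\<bar>D (cur i\<^sub>0 h) s\<bar> + \<bar>t (cur i\<^sub>0 h)\<bar>) \<partial>Q (cur i\<^sub>0 h)) =
          ennreal (measure_pmf.expectation (Q (cur i\<^sub>0 h)) (\<lambda>s. \<bar>D (cur i\<^sub>0 h) s\<bar> + \<bar>t (cur i\<^sub>0 h)\<bar>))"
          by (rule nn_integral_eq_integral) (use intD in auto)
        also have "\<dots> \<le> ennreal (2 * \<delta>)"
          using intD D_le[of "cur i\<^sub>0 h"] t_le[of "cur i\<^sub>0 h"] by (intro ennreal_leI) simp
        finally show "(\<integral>\<^sup>+s. ennreal (\<bar>D (cur i\<^sub>0 h) s\<bar> + \<bar>t (cur i\<^sub>0 h)\<bar>) \<partial>Q (cur i\<^sub>0 h)) \<le> ennreal (2 * \<delta>)" .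
      qed (use \<open>0 < \<delta>\<close> in auto)
      have "\<bar>asum (\<lambda>h s. w h * G (cur i\<^sub>0 h) s) h\<bar> \<le> \<bar>a h\<bar> + b h" for h
      proof -
        have "asum (\<lambda>h s. w h * G (cur i\<^sub>0 h) s) h = a h + asum (\<lambda>h s. w h * (D (cur i\<^sub>0 h) s + t (cur i\<^sub>0 h))) h"
          unfolding a_def asum_add[symmetric] by (simp add: T_def algebra_simps)
        moreover have "\<bar>asum (\<lambda>h s. w h * (D (cur i\<^sub>0 h) s + t (cur i\<^sub>0 h))) h\<bar> \<le> b h"
          unfolding b_def by (rule order_trans[OF abs_asum_le asum_mono])
            (rule order_trans[OF w_mult abs_triangle_ineq])
        ultimately show ?thesis by linarith
      qed
      then have "(\<integral>\<^sup>+h. ennreal \<bar>asum (\<lambda>h s. w h * G (cur i\<^sub>0 h) s) h\<bar> \<partial>mr_path Q i\<^sub>0 n) \<le>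
          (\<integral>\<^sup>+h. ennreal \<bar>a h\<bar> + ennreal (b h) \<partial>mr_path Q i\<^sub>0 n)"
        by (intro nn_integral_mono) (simp add: ennreal_plus[symmetric] asum_nonneg b_def del: ennreal_plus)
      also have "\<dots> = (\<integral>\<^sup>+h. ennreal \<bar>a h\<bar> \<partial>mr_path Q i\<^sub>0 n) + (\<integral>\<^sup>+h. ennreal (b h) \<partial>mr_path Q i\<^sub>0 n)"
        by (rule nn_integral_add) auto
      also have "\<dots> \<le> ennreal (\<epsilon> * real n / 2) + ennreal (real n * (2 * \<delta>))"
        by (rule add_mono[OF Ea Eb])
      also have "\<dots> = ennreal (\<epsilon> * real n)"
        using \<open>0 < \<epsilon>\<close> by (simp add: ennreal_plus[symmetric] \<delta>_def del: ennreal_plus)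
      finally show "(\<integral>\<^sup>+h. ennreal \<bar>asum (\<lambda>h s. w h * G (cur i\<^sub>0 h) s) h\<bar> \<partial>mr_path Q i\<^sub>0 n) \<le> ennreal (\<epsilon> * real n)" .
    qed
  qed
qed

section \<open>Limit theorems at the time horizon\<close>

lemma asum_wt_sojourn_le: "tot h \<le> M \<Longrightarrow> asum (\<lambda>h s. wt M h * real (snd s)) h = real (tot h)"
proof (induction h)
  case (Cons s h)
  then have "wt M h = 1" "tot h \<le> M" by (auto simp: wt_def)
  then show ?case using Cons.IH by simp
qed simp

lemma asum_wt_sojourn_gt:
  assumes "M < tot h" "0 \<le> L"
  shows "real M < asum (\<lambda>h s. wt M h * real (snd s)) h \<and>
    asum (\<lambda>h s. wt M h * real (snd s)) h \<le> real M + L + asum (\<lambda>h s. max 0 (real (snd s) - L)) h"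
  using assms(1)
proof (induction h)
  case (Cons s h)
  show ?case
  proof (cases "tot h \<le> M")
    case True
    then have "wt M h = 1" by (simp add: wt_def)
    then have "asum (\<lambda>h s. wt M h * real (snd s)) (s # h) = real (tot h) + real (snd s)"
      using True by (simp add: asum_wt_sojourn_le)
    moreover have "0 \<le> asum (\<lambda>h s. max 0 (real (snd s) - L)) h" by (rule asum_nonneg) simp
    ultimately show ?thesis using Cons.prems True by (auto simp: max_def)
  next
    case False
    then have "wt M h = 0" by (simp add: wt_def)
    then have "asum (\<lambda>h s. wt M h * real (snd s)) (s # h) = asum (\<lambda>h s. wt M h * real (snd s)) h"
      by simp
    then show ?thesis using Cons.IH False by (auto simp: max_def)
  qed
qed simp

lemma asum_wt_telescope:
  assumes "\<And>j. \<bar>\<phi> j\<bar> \<le> H"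
  shows "\<bar>asum (\<lambda>h s. wt M h * (\<phi> (fst s) - \<phi> (cur i\<^sub>0 h))) h\<bar> \<le> 2 * H"
proof -
  \<comment> \<open>The induction needs both parts: up to time \<open>M\<close> the sum ends at the
    current state, afterwards it stays at the state in which it was frozen.\<close>
  have "(tot h \<le> M \<longrightarrow> asum (\<lambda>h s. wt M h * (\<phi> (fst s) - \<phi> (cur i\<^sub>0 h))) h = \<phi> (cur i\<^sub>0 h) - \<phi> i\<^sub>0) \<and>
      (\<exists>x. asum (\<lambda>h s. wt M h * (\<phi> (fst s) - \<phi> (cur i\<^sub>0 h))) h = \<phi> x - \<phi> i\<^sub>0)"
  proof (induction h)
    case Nil
    have "\<phi> i\<^sub>0 - \<phi> i\<^sub>0 = 0" by simp
    then show ?case by (simp, metis)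
  next
    case (Cons s h)
    have "wt M h = (if tot h \<le> M then 1 else 0)" by (simp add: wt_def)
    with Cons show ?case by (cases "tot h \<le> M") auto
  qed
  then obtain x where x: "asum (\<lambda>h s. wt M h * (\<phi> (fst s) - \<phi> (cur i\<^sub>0 h))) h = \<phi> x - \<phi> i\<^sub>0" by blast
  show ?thesis unfolding x using assms[of x] assms[of i\<^sub>0] by linarith
qed

lemma visits_bounds: "0 \<le> visits M i\<^sub>0 i h" "visits M i\<^sub>0 i h \<le> real (length h)"
proof -
  show "0 \<le> visits M i\<^sub>0 i h" unfolding visits_def by (rule asum_nonneg) (simp add: wt_bounds)
  have "visits M i\<^sub>0 i h \<le> asum (\<lambda>h s. 1) h"
    unfolding visits_def by (rule asum_mono) (simp add: wt_bounds)
  then show "visits M i\<^sub>0 i h \<le> real (length h)" by (simp add: asum_const)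
qed

lemma integrable_visits: "integrable (mr_path Q i\<^sub>0 n) (visits M i\<^sub>0 i)"
proof (rule integrable_path)
  show "norm (visits M i\<^sub>0 i h) \<le> real n" if "length h = n" for h
    using visits_bounds[of M i\<^sub>0 i h] that by simp
qed

text \<open>By the Poisson equation, \<open>S\<close> minus \<open>\<mu>\<close> times the number of visits to \<open>i\<close> plus \<open>\<phi>\<close> of the current
  state is a martingale. Stopped after the first jump beyond \<open>M\<close>, it is \<open>o(M)\<close> in mean, while \<open>S\<close> has
  overshot \<open>M\<close> by \<open>o(M)\<close> in mean.\<close>

lemma visits_lln:
  fixes Q :: "'e::finite \<Rightarrow> ('e \<times> nat) pmf" and \<phi> :: "'e \<Rightarrow> real"
  assumes pos: "\<And>j s. s \<in> set_pmf (Q j) \<Longrightarrow> 1 \<le> snd s"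
    and int: "\<And>j. integrable (Q j) (\<lambda>s. real (snd s))"
    and poisson: "\<And>j. measure_pmf.expectation (Q j) (\<lambda>s. real (snd s) + \<phi> (fst s)) = \<mu> * of_bool (j = i) + \<phi> j"
    and \<mu>: "0 < \<mu>"
  shows "(\<lambda>M. measure_pmf.expectation (mr_path Q i\<^sub>0 (Suc M)) (\<lambda>h. \<bar>visits M i\<^sub>0 i h / real M - 1 / \<mu>\<bar>)) \<longlonglongrightarrow> 0"
proof (rule tendstoI)
  fix r :: real assume "0 < r"
  \<comment> \<open>The final bound is 5 \<epsilon> / \<mu>, which is 5 r / 8.\<close>
  define \<epsilon> where "\<epsilon> = \<mu> * r / 8"
  have "0 < \<epsilon>" using \<open>0 < r\<close> \<mu> by (simp add: \<epsilon>_def)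
  define H where "H = Max (range (\<lambda>j. \<bar>\<phi> j\<bar>))"
  have H: "\<bar>\<phi> j\<bar> \<le> H" for j unfolding H_def by (rule Max_ge) auto
  then have H0: "0 \<le> H" using order_trans[OF abs_ge_zero] by blast
  have int\<phi>: "integrable (Q j) (\<lambda>s. \<phi> (fst s))" for j
    by (rule measure_pmf.integrable_const_bound[of _ H]) (use H in auto)
  have "\<forall>\<^sub>F m in sequentially. measure_pmf.expectation (Q j) (\<lambda>s. max 0 (real (snd s) - real m)) < \<epsilon>" for j
  proof -
    have "(\<lambda>m. measure_pmf.expectation (Q j) (\<lambda>s. max 0 (real (snd s) - real m)))
      \<longlonglongrightarrow> measure_pmf.expectation (Q j) (\<lambda>s. 0)"
    proof (rule integral_dominated_convergence[where w="\<lambda>s. real (snd s)"])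
      have "(\<lambda>m. max 0 (real (snd s) - real m)) \<longlonglongrightarrow> 0" for s :: "'e \<times> nat"
        by (rule tendsto_eventually, rule eventually_mono[OF eventually_ge_at_top[of "snd s"]]) auto
      then show "AE s in Q j. (\<lambda>m. max 0 (real (snd s) - real m)) \<longlonglongrightarrow> 0" by simp
    qed (use int in auto)
    then show ?thesis using \<open>0 < \<epsilon>\<close> by (auto dest: order_tendstoD(2))
  qed
  then have "\<forall>\<^sub>F m in sequentially. \<forall>j. measure_pmf.expectation (Q j) (\<lambda>s. max 0 (real (snd s) - real m)) < \<epsilon>"
    by (rule eventually_all_finite)
  then obtain m where m: "\<And>j. measure_pmf.expectation (Q j) (\<lambda>s. max 0 (real (snd s) - real m)) < \<epsilon>"
    by (auto simp: eventually_sequentially)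
  define L where "L = real m"
  have L0: "0 \<le> L" by (simp add: L_def)
  define G where "G j s = real (snd s) + (\<phi> (fst s) - (\<mu> * of_bool (j = i) + \<phi> j))" for j and s :: "'e \<times> nat"
  have intG: "integrable (Q j) (G j)" for j
    unfolding G_def using int int\<phi> by (intro Bochner_Integration.integrable_add Bochner_Integration.integrable_diff) auto
  have meanG: "measure_pmf.expectation (Q j) (G j) = 0" for j
    using poisson[of j] int[of j] int\<phi>[of j] by (simp add: G_def[abs_def])
  obtain n0 where n0: "\<And>n i\<^sub>0 w. n \<ge> n0 \<Longrightarrow> (\<And>h. \<bar>w h\<bar> \<le> 1) \<Longrightarrow>
    (\<integral>\<^sup>+h. ennreal \<bar>asum (\<lambda>h s. w h * G (cur i\<^sub>0 h) s) h\<bar> \<partial>mr_path Q i\<^sub>0 n) \<le> ennreal (\<epsilon> * real n)"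
    using asum_L1_lln[of Q G, OF intG meanG \<open>0 < \<epsilon>\<close>] unfolding eventually_sequentially by blast
  show "\<forall>\<^sub>F M in sequentially. dist (measure_pmf.expectation (mr_path Q i\<^sub>0 (Suc M))
      (\<lambda>h. \<bar>visits M i\<^sub>0 i h / real M - 1 / \<mu>\<bar>)) 0 < r"
    using eventually_ge_at_top[of n0] eventually_ge_at_top[of "nat \<lceil>(L + 2 * H) / \<epsilon>\<rceil> + 1"]
  proof eventually_elim
    case (elim M)
    then have M: "n0 \<le> Suc M" "(L + 2 * H) / \<epsilon> \<le> real M" "1 \<le> real M" by linarith+
    define a where "a = asum (\<lambda>h s. wt M h * G (cur i\<^sub>0 h) s)"
    define b :: "('e \<times> nat) list \<Rightarrow> real" where "b = asum (\<lambda>h s. max 0 (real (snd s) - L))"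
    have b0: "0 \<le> b h" for h :: "('e \<times> nat) list" unfolding b_def by (rule asum_nonneg) simp
    \<comment> \<open>The stopped sojourn sum \<open>X\<close> exceeds M by at most L + b, and the
      \<phi>-increments telescope to at most 2 H; the martingale \<open>a\<close> ties both to the
      visits.\<close>
    have key: "\<bar>\<mu> * visits M i\<^sub>0 i h - real M\<bar> \<le> \<bar>a h\<bar> + (L + 2 * H) + b h"
      if "h \<in> set_pmf (mr_path Q i\<^sub>0 (Suc M))" for h
    proof -
      define X :: "('e \<times> nat) list \<Rightarrow> real" where "X = asum (\<lambda>h s. wt M h * real (snd s))"
      have "Suc M \<le> tot h" by (rule tot_ge_length[OF _ that]) (erule pos)
      then have "M < tot h" by simp
      then have "real M < X h" "X h \<le> real M + L + b h"
        using asum_wt_sojourn_gt[OF _ L0] unfolding X_def b_def by blast+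
      moreover have "a h = X h - \<mu> * visits M i\<^sub>0 i h + asum (\<lambda>h s. wt M h * (\<phi> (fst s) - \<phi> (cur i\<^sub>0 h))) h"
      proof -
        have "a h = asum (\<lambda>h s. wt M h * real (snd s) + (- \<mu> * (wt M h * of_bool (cur i\<^sub>0 h = i)) + wt M h * (\<phi> (fst s) - \<phi> (cur i\<^sub>0 h)))) h"
          unfolding a_def G_def by (simp add: algebra_simps)
        then show ?thesis by (simp only: asum_add asum_cmult X_def visits_def)
      qed
      moreover have "\<bar>asum (\<lambda>h s. wt M h * (\<phi> (fst s) - \<phi> (cur i\<^sub>0 h))) h\<bar> \<le> 2 * H"
        by (rule asum_wt_telescope[OF H])
      ultimately show ?thesis by linarith
    qed
    have vint: "integrable (mr_path Q i\<^sub>0 (Suc M)) (visits M i\<^sub>0 i)"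
      by (rule integrable_visits)
    have "(\<integral>\<^sup>+h. ennreal \<bar>\<mu> * visits M i\<^sub>0 i h - real M\<bar> \<partial>mr_path Q i\<^sub>0 (Suc M)) \<le>
       (\<integral>\<^sup>+h. ennreal \<bar>a h\<bar> + (ennreal (L + 2 * H) + ennreal (b h)) \<partial>mr_path Q i\<^sub>0 (Suc M))"
      using key L0 H0 b0
      by (intro nn_integral_mono_AE)
         (auto simp: AE_measure_pmf_iff ennreal_plus[symmetric] add.assoc intro!: ennreal_leI simp del: ennreal_plus mr_path.simps)
    also have "\<dots> = (\<integral>\<^sup>+h. ennreal \<bar>a h\<bar> \<partial>mr_path Q i\<^sub>0 (Suc M)) + (ennreal (L + 2 * H) + (\<integral>\<^sup>+h. ennreal (b h) \<partial>mr_path Q i\<^sub>0 (Suc M)))"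
      by (subst nn_integral_add, simp, simp, subst nn_integral_add) (auto simp del: mr_path.simps)
    also have "\<dots> \<le> ennreal (\<epsilon> * real (Suc M)) + (ennreal (L + 2 * H) + ennreal (real (Suc M) * \<epsilon>))"
    proof (intro add_mono order_refl)
      show "(\<integral>\<^sup>+h. ennreal \<bar>a h\<bar> \<partial>mr_path Q i\<^sub>0 (Suc M)) \<le> ennreal (\<epsilon> * real (Suc M))"
        unfolding a_def by (rule n0[OF M(1)]) (rule wt_bounds)
      show "(\<integral>\<^sup>+h. ennreal (b h) \<partial>mr_path Q i\<^sub>0 (Suc M)) \<le> ennreal (real (Suc M) * \<epsilon>)"
        unfolding b_def
      proof (rule nn_integral_asum_le)
        fix h
        have "integrable (Q j) (\<lambda>s. max 0 (real (snd s) - L))" for j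
          by (rule Bochner_Integration.integrable_bound[OF int[of j]]) (use L0 in auto)
        then have "(\<integral>\<^sup>+s. ennreal (max 0 (real (snd s) - L)) \<partial>Q (cur i\<^sub>0 h)) =
          ennreal (measure_pmf.expectation (Q (cur i\<^sub>0 h)) (\<lambda>s. max 0 (real (snd s) - L)))"
          by (intro nn_integral_eq_integral) auto
        also have "\<dots> \<le> ennreal \<epsilon>"
          using m[of "cur i\<^sub>0 h"] by (intro ennreal_leI) (simp add: L_def)
        finally show "(\<integral>\<^sup>+s. ennreal (max 0 (real (snd s) - L)) \<partial>Q (cur i\<^sub>0 h)) \<le> ennreal \<epsilon>" .
      qed (use \<open>0 < \<epsilon>\<close> in auto)
    qed
    also have "\<dots> = ennreal (2 * \<epsilon> * real (Suc M) + (L + 2 * H))"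
      using \<open>0 < \<epsilon>\<close> L0 H0 by (simp add: ennreal_plus[symmetric] algebra_simps del: ennreal_plus)
    finally have "(\<integral>\<^sup>+h. ennreal \<bar>\<mu> * visits M i\<^sub>0 i h - real M\<bar> \<partial>mr_path Q i\<^sub>0 (Suc M)) \<le> ennreal (2 * \<epsilon> * real (Suc M) + (L + 2 * H))" .
    then have le: "measure_pmf.expectation (mr_path Q i\<^sub>0 (Suc M)) (\<lambda>h. \<bar>\<mu> * visits M i\<^sub>0 i h - real M\<bar>) \<le> 2 * \<epsilon> * real (Suc M) + (L + 2 * H)"
      using vint \<open>0 < \<epsilon>\<close> L0 H0
      by (subst (asm) nn_integral_eq_integral) (auto simp del: mr_path.simps ennreal_plus)
    have "\<bar>visits M i\<^sub>0 i h / real M - 1 / \<mu>\<bar> = (1 / (\<mu> * real M)) * \<bar>\<mu> * visits M i\<^sub>0 i h - real M\<bar>" for h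
    proof -
      have "visits M i\<^sub>0 i h / real M - 1 / \<mu> = (1 / (\<mu> * real M)) * (\<mu> * visits M i\<^sub>0 i h - real M)"
        using M(3) \<mu> by (simp add: field_simps)
      then show ?thesis using M(3) \<mu> by (simp add: abs_mult)
    qed
    then have "measure_pmf.expectation (mr_path Q i\<^sub>0 (Suc M)) (\<lambda>h. \<bar>visits M i\<^sub>0 i h / real M - 1 / \<mu>\<bar>) =
       (1 / (\<mu> * real M)) * measure_pmf.expectation (mr_path Q i\<^sub>0 (Suc M)) (\<lambda>h. \<bar>\<mu> * visits M i\<^sub>0 i h - real M\<bar>)"
      by (simp del: mr_path.simps)
    also have "\<dots> \<le> (1 / (\<mu> * real M)) * (2 * \<epsilon> * real (Suc M) + (L + 2 * H))"
      using le M(3) \<mu> by (intro mult_left_mono) auto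
    also have "\<dots> \<le> (1 / (\<mu> * real M)) * (5 * \<epsilon> * real M)"
    proof (intro mult_left_mono)
      have "L + 2 * H \<le> \<epsilon> * real M" using M(2) \<open>0 < \<epsilon>\<close> by (simp add: field_simps)
      moreover have "2 * \<epsilon> * real (Suc M) \<le> 4 * \<epsilon> * real M" using M(3) \<open>0 < \<epsilon>\<close> by simp
      ultimately show "2 * \<epsilon> * real (Suc M) + (L + 2 * H) \<le> 5 * \<epsilon> * real M" by linarith
    qed (use M(3) \<mu> in auto)
    also have "\<dots> < r" using M(3) \<mu> \<open>0 < r\<close> by (simp add: \<epsilon>_def field_simps)
    finally show ?case by (simp add: dist_norm del: mr_path.simps)
  qed
qed

section \<open>Characteristic functions of sums of bounded martingale differences\<close>

lemma exp_minus_quadratic_bound: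
  fixes x :: real
  assumes "0 \<le> x"
  shows "\<bar>exp (- x) - (1 - x)\<bar> \<le> x\<^sup>2"
proof -
  have "1 - x \<le> exp (- x)" using exp_ge_add_one_self[of "-x"] by simp
  moreover have "exp (- x) \<le> 1 - x + x\<^sup>2"
  proof -
    have "exp (- x) \<le> 1 / (1 + x)"
      using exp_ge_add_one_self[of x] assms by (simp add: exp_minus inverse_eq_divide frac_le)
    also have "\<dots> \<le> 1 - x + x\<^sup>2"
    proof -
      have "(1 - x + x\<^sup>2) * (1 + x) = 1 + x ^ 3" by (simp add: algebra_simps power2_eq_square power3_eq_cube)
      moreover have "0 \<le> x ^ 3" using assms by simp
      ultimately show ?thesis using assms by (simp add: pos_divide_le_eq)
    qed
    finally show ?thesis .
  qed
  ultimately show ?thesis by simp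
qed

lemma abs_exp_diff_le:
  fixes a b :: real
  assumes "a \<le> K" "b \<le> K"
  shows "\<bar>exp a - exp b\<bar> \<le> exp K * \<bar>a - b\<bar>"
proof -
  have *: "exp b - exp a \<le> exp K * (b - a)" if "a \<le> b" "b \<le> K" for a b :: real
  proof -
    have "exp b - exp a = exp b * (1 - exp (a - b))" by (simp add: exp_diff algebra_simps)
    also have "\<dots> \<le> exp b * (b - a)"
    proof (rule mult_left_mono)
      show "1 - exp (a - b) \<le> b - a" using exp_ge_add_one_self[of "a - b"] by linarith
    qed simp
    also have "\<dots> \<le> exp K * (b - a)" using that by (intro mult_right_mono) auto
    finally show ?thesis .
  qed
  show ?thesis using *[of a b] *[of b a] assms by (cases "a \<le> b") auto
qed

text \<open>The characteristic function of one step and exp (- \<psi>) both agree with 1 - \<psi> up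
  to order b^3: the Taylor remainder is at most b^3 / 6, and \<psi>^2 \<le> b^4 / 4 \<le> b^3 / 4
  because b \<le> 1. Multiplication by exp \<psi> \<le> exp 1 gives the constant.\<close>

lemma conditional_char_bound:
  fixes p :: "'s pmf" and g :: "'s \<Rightarrow> real"
  assumes g: "\<And>s. \<bar>g s\<bar> \<le> b" and mean: "measure_pmf.expectation p g = 0" and b: "0 \<le> b" "b \<le> 1"
  defines "\<psi> \<equiv> measure_pmf.expectation p (\<lambda>s. (g s)\<^sup>2) / 2"
  shows "norm (measure_pmf.expectation p (\<lambda>s. exp (\<i> * g s + \<psi>)) - 1) \<le> exp 1 * b ^ 3"
proof -
  have int: "integrable p g"
    by (rule measure_pmf.integrable_const_bound[of _ b]) (use g in auto)
  have sq: "(g s)\<^sup>2 \<le> b\<^sup>2" for s using g[of s] b(1) by (simp add: abs_le_square_iff[symmetric])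
  then have int2: "integrable p (\<lambda>s. (g s)\<^sup>2)"
    by (intro measure_pmf.integrable_const_bound[of _ "b\<^sup>2"]) auto
  have inte: "integrable p (\<lambda>s. iexp (g s))"
    by (rule measure_pmf.integrable_const_bound[of _ 1]) auto
  have \<psi>: "0 \<le> \<psi>" "\<psi> \<le> b\<^sup>2 / 2"
    using measure_pmf.integral_le_const[OF int2, of "b\<^sup>2"] sq by (auto simp: \<psi>_def)
  have "b\<^sup>2 \<le> 1" using b by (simp add: power_le_one)
  then have \<psi>1: "\<psi> \<le> 1" using \<psi> by linarith
  have taylor: "norm (iexp x - (1 + \<i> * x - x\<^sup>2 / 2)) \<le> \<bar>x\<bar> ^ 3 / 6" for x :: real
    using iexp_approx1[of x 2]
    by (simp add: atMost_nat_numeral fact_numeral power2_eq_square algebra_simps eval_nat_numeral)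
  have c: "integrable p (\<lambda>s. complex_of_real (g s))" "integrable p (\<lambda>s. (complex_of_real (g s))\<^sup>2)"
    using integrable_of_real[OF int, where 'a=complex] integrable_of_real[OF int2, where 'a=complex] by simp_all
  have intt: "integrable p (\<lambda>s. 1 + \<i> * g s - (g s)\<^sup>2 / 2)"
    using c by simp
  have "measure_pmf.expectation p (\<lambda>s. 1 + \<i> * g s - (g s)\<^sup>2 / 2) = 1 + \<i> * measure_pmf.expectation p (\<lambda>s. complex_of_real (g s)) - measure_pmf.expectation p (\<lambda>s. complex_of_real ((g s)\<^sup>2)) / 2"
    using c by simp
  also have "\<dots> = 1 - \<psi>"
    using mean by (simp only: integral_complex_of_real) (simp add: \<psi>_def)
  finally have "norm (measure_pmf.expectation p (\<lambda>s. iexp (g s)) - (1 - \<psi>)) =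
      norm (measure_pmf.expectation p (\<lambda>s. iexp (g s) - (1 + \<i> * g s - (g s)\<^sup>2 / 2)))"
    by (simp only: Bochner_Integration.integral_diff[OF inte intt])
  also have "\<dots> \<le> measure_pmf.expectation p (\<lambda>s. norm (iexp (g s) - (1 + \<i> * g s - (g s)\<^sup>2 / 2)))"
    by (rule integral_norm_bound)
  also have "\<dots> \<le> b ^ 3 / 6"
  proof (rule measure_pmf.integral_le_const)
    show "integrable p (\<lambda>s. norm (iexp (g s) - (1 + \<i> * g s - (g s)\<^sup>2 / 2)))"
      by (rule integrable_norm[OF Bochner_Integration.integrable_diff[OF inte intt]])
    have "norm (iexp (g s) - (1 + \<i> * g s - (g s)\<^sup>2 / 2)) \<le> b ^ 3 / 6" for s
      using taylor[of "g s"] power_mono[OF g[of s], of 3] by simp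
    then show "AE s in p. norm (iexp (g s) - (1 + \<i> * g s - (g s)\<^sup>2 / 2)) \<le> b ^ 3 / 6" by simp
  qed
  finally have 1: "norm (measure_pmf.expectation p (\<lambda>s. iexp (g s)) - (1 - \<psi>)) \<le> b ^ 3 / 6" .
  have "norm (complex_of_real (exp (- \<psi>)) - (1 - \<psi>)) = \<bar>exp (- \<psi>) - (1 - \<psi>)\<bar>"
    by (metis norm_of_real of_real_1 of_real_diff)
  also have "\<dots> \<le> \<psi>\<^sup>2" by (rule exp_minus_quadratic_bound[OF \<psi>(1)])
  also have "\<dots> \<le> (b\<^sup>2 / 2)\<^sup>2" using \<psi> by (intro power_mono) auto
  also have "\<dots> = b ^ 3 * b / 4" by (simp add: power2_eq_square power3_eq_cube)
  also have "\<dots> \<le> b ^ 3 / 4" using b by (simp add: mult_left_le)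
  finally have 2: "norm (complex_of_real (exp (- \<psi>)) - (1 - \<psi>)) \<le> b ^ 3 / 4" .
  have 3: "norm (measure_pmf.expectation p (\<lambda>s. iexp (g s)) - complex_of_real (exp (- \<psi>))) \<le> b ^ 3"
  proof -
    have "norm (measure_pmf.expectation p (\<lambda>s. iexp (g s)) - complex_of_real (exp (- \<psi>))) \<le>
        norm (measure_pmf.expectation p (\<lambda>s. iexp (g s)) - (1 - \<psi>)) + norm (complex_of_real (exp (- \<psi>)) - (1 - \<psi>))"
      using norm_triangle_ineq4[of "measure_pmf.expectation p (\<lambda>s. iexp (g s)) - (1 - \<psi>)" "complex_of_real (exp (- \<psi>)) - (1 - \<psi>)"]
      by simp
    then show ?thesis using 1 2 zero_le_power[OF b(1), of 3] by linarith
  qed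
  have "measure_pmf.expectation p (\<lambda>s. exp (\<i> * g s + \<psi>)) - 1 =
     exp \<psi> * (measure_pmf.expectation p (\<lambda>s. iexp (g s)) - complex_of_real (exp (- \<psi>)))"
  proof -
    have "measure_pmf.expectation p (\<lambda>s. exp (\<i> * g s + \<psi>)) = measure_pmf.expectation p (\<lambda>s. exp \<psi> * iexp (g s))"
      by (simp add: exp_add exp_of_real mult.commute)
    also have "\<dots> = exp \<psi> * measure_pmf.expectation p (\<lambda>s. iexp (g s))" by simp
    moreover have "complex_of_real (exp \<psi>) * complex_of_real (exp (- \<psi>)) = 1"
      by (simp flip: of_real_mult exp_add)
    ultimately show ?thesis by (simp add: right_diff_distrib)
  qed
  then have "norm (measure_pmf.expectation p (\<lambda>s. exp (\<i> * g s + \<psi>)) - 1) =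
     exp \<psi> * norm (measure_pmf.expectation p (\<lambda>s. iexp (g s)) - complex_of_real (exp (- \<psi>)))"
    by (simp add: norm_mult)
  also have "\<dots> \<le> exp 1 * b ^ 3"
    using 3 \<psi>1 b by (intro mult_mono) auto
  finally show ?thesis .
qed

text \<open>Multiplying the exponential of the sum by the exponential of half the accumulated conditional
  variances gives a process that is a martingale up to an error of smaller order than \<open>1 / M\<close> per
  step.\<close>

lemma exponential_near_martingale:
  fixes Q :: "'e \<Rightarrow> ('e \<times> nat) pmf" and G :: "'e \<Rightarrow> 'e \<times> nat \<Rightarrow> real"
  assumes G: "\<And>j s. \<bar>G j s\<bar> \<le> b" and b: "0 \<le> b" "b \<le> 1"
    and mean: "\<And>j. measure_pmf.expectation (Q j) (G j) = 0"
  defines "\<psi> \<equiv> \<lambda>j. measure_pmf.expectation (Q j) (\<lambda>s. (G j s)\<^sup>2) / 2"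
  shows "norm (measure_pmf.expectation (mr_path Q i\<^sub>0 n)
      (\<lambda>h. exp (\<i> * asum (\<lambda>h s. wt M h * G (cur i\<^sub>0 h) s) h + asum (\<lambda>h s. wt M h * \<psi> (cur i\<^sub>0 h)) h)) - 1)
    \<le> real n * (exp (real n * b\<^sup>2 / 2) * (exp 1 * b ^ 3))"
proof (induction n)
  case 0
  show ?case by simp
next
  case (Suc n)
  define X where "X = asum (\<lambda>h s. wt M h * G (cur i\<^sub>0 h) s)"
  define A where "A = asum (\<lambda>h s. wt M h * \<psi> (cur i\<^sub>0 h))"
  define R where "R h = exp (\<i> * X h + A h)" for h
  have sq: "(G j s)\<^sup>2 \<le> b\<^sup>2" for j s using G[of j s] b(1) by (simp add: abs_le_square_iff[symmetric])
  have \<psi>: "0 \<le> \<psi> j" "\<psi> j \<le> b\<^sup>2 / 2" for j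
  proof -
    have "integrable (Q j) (\<lambda>s. (G j s)\<^sup>2)"
      by (rule measure_pmf.integrable_const_bound[of _ "b\<^sup>2"]) (use sq in auto)
    then show "0 \<le> \<psi> j" "\<psi> j \<le> b\<^sup>2 / 2"
      using measure_pmf.integral_le_const[of "Q j" "\<lambda>s. (G j s)\<^sup>2" "b\<^sup>2"] sq by (auto simp: \<psi>_def)
  qed
  have A_le: "A h \<le> real (length h) * (b\<^sup>2 / 2)" for h
  proof -
    have "A h \<le> asum (\<lambda>h s. b\<^sup>2 / 2) h"
      unfolding A_def using \<psi> by (intro asum_mono) (auto simp: wt_def)
    then show ?thesis by (simp only: asum_const)
  qed
  \<comment> \<open>The modulus of \<open>R\<close> is exp of the accumulated half variances, which
    have a deterministic bound linear in the path length.\<close>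
  have normR: "norm (R h) \<le> exp (real m * b\<^sup>2 / 2)" if "length h = m" for h m
    using A_le[of h] that by (simp add: R_def)
  have intR: "integrable (mr_path Q i\<^sub>0 m) R" for m
    by (rule integrable_path[of m _ "exp (real m * b\<^sup>2 / 2)"]) (rule normR)
  \<comment> \<open>The conditional mean of the factor that one jump adds to \<open>R\<close>. It is
    close to 1 while the chain runs and exactly 1 once it is stopped.\<close>
  define \<Phi> where "\<Phi> h = measure_pmf.expectation (Q (cur i\<^sub>0 h)) (\<lambda>s. exp (\<i> * (wt M h * G (cur i\<^sub>0 h) s) + wt M h * \<psi> (cur i\<^sub>0 h)))" for h
  have \<Phi>: "norm (\<Phi> h - 1) \<le> exp 1 * b ^ 3" for h
  proof (cases "tot h \<le> M")
    case True
    then show ?thesis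
      using conditional_char_bound[OF G[of "cur i\<^sub>0 h"] mean[of "cur i\<^sub>0 h"] b]
      by (simp add: \<Phi>_def wt_def \<psi>_def)
  next
    case False
    then show ?thesis using b by (simp add: \<Phi>_def wt_def)
  qed
  have step: "measure_pmf.expectation (mr_path Q i\<^sub>0 (Suc n)) R = measure_pmf.expectation (mr_path Q i\<^sub>0 n) (\<lambda>h. R h * \<Phi> h)"
  proof -
    have "measure_pmf.expectation (Q (cur i\<^sub>0 h)) (\<lambda>s. R (s # h)) = R h * \<Phi> h" for h
    proof -
      have "R (s # h) = R h * exp (\<i> * (wt M h * G (cur i\<^sub>0 h) s) + wt M h * \<psi> (cur i\<^sub>0 h))" for s
        by (simp add: R_def X_def A_def exp_add[symmetric] algebra_simps)
      then show ?thesis by (simp add: \<Phi>_def)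
    qed
    then show ?thesis
      using expectation_path_Suc_complex[of n R "exp (real (Suc n) * b\<^sup>2 / 2)" Q i\<^sub>0] normR[of _ "Suc n"] by simp
  qed
  have int\<Phi>: "integrable (mr_path Q i\<^sub>0 n) (\<lambda>h. R h * (\<Phi> h - 1))"
    by (rule integrable_path[of n _ "exp (real n * b\<^sup>2 / 2) * (exp 1 * b ^ 3)"])
       (use normR \<Phi> in \<open>auto simp: norm_mult intro!: mult_mono\<close>)
  have "norm (measure_pmf.expectation (mr_path Q i\<^sub>0 (Suc n)) R - measure_pmf.expectation (mr_path Q i\<^sub>0 n) R) =
     norm (measure_pmf.expectation (mr_path Q i\<^sub>0 n) (\<lambda>h. R h * (\<Phi> h - 1)))"
  proof -
    have "integrable (mr_path Q i\<^sub>0 n) (\<lambda>h. R h * \<Phi> h)"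
      using Bochner_Integration.integrable_add[OF int\<Phi> intR[of n]] by (simp add: algebra_simps)
    then show ?thesis unfolding step using intR[of n] by (simp add: right_diff_distrib)
  qed
  also have "\<dots> \<le> measure_pmf.expectation (mr_path Q i\<^sub>0 n) (\<lambda>h. norm (R h * (\<Phi> h - 1)))"
    by (rule integral_norm_bound)
  also have "\<dots> \<le> measure_pmf.expectation (mr_path Q i\<^sub>0 n) (\<lambda>h. exp (real n * b\<^sup>2 / 2) * (exp 1 * b ^ 3))"
  proof (rule expectation_path_mono)
    show "norm (R h * (\<Phi> h - 1)) \<le> exp (real n * b\<^sup>2 / 2) * (exp 1 * b ^ 3)" if "length h = n" for h
      unfolding norm_mult using normR[OF that] \<Phi>[of h] by (intro mult_mono) auto
  qed (use int\<Phi> in \<open>auto intro: integrable_norm simp del: norm_mult\<close>)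
  also have "\<dots> = exp (real n * b\<^sup>2 / 2) * (exp 1 * b ^ 3)" by simp
  finally have d: "norm (measure_pmf.expectation (mr_path Q i\<^sub>0 (Suc n)) R - measure_pmf.expectation (mr_path Q i\<^sub>0 n) R) \<le>
     exp (real n * b\<^sup>2 / 2) * (exp 1 * b ^ 3)" .
  have IH: "norm (measure_pmf.expectation (mr_path Q i\<^sub>0 n) R - 1) \<le> real n * (exp (real n * b\<^sup>2 / 2) * (exp 1 * b ^ 3))"
    using Suc.IH unfolding R_def X_def A_def .
  have "norm (measure_pmf.expectation (mr_path Q i\<^sub>0 (Suc n)) R - 1) \<le> real (Suc n) * (exp (real n * b\<^sup>2 / 2) * (exp 1 * b ^ 3))"
    using norm_triangle_le[OF add_mono[OF d IH]] by (simp add: algebra_simps)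
  also have "\<dots> \<le> real (Suc n) * (exp (real (Suc n) * b\<^sup>2 / 2) * (exp 1 * b ^ 3))"
    using b by (intro mult_left_mono mult_right_mono) (auto intro!: divide_right_mono mult_right_mono)
  finally show ?case unfolding R_def X_def A_def .
qed

text \<open>With finitely many states, accumulated conditional variances are linear combinations of
  visit counts; this is where the law of large numbers enters.\<close>

lemma asum_state_decomposition:
  fixes c :: "'e::finite \<Rightarrow> real"
  shows "asum (\<lambda>h s. wt M h * c (cur i\<^sub>0 h)) h = (\<Sum>i\<in>UNIV. c i * visits M i\<^sub>0 i h)"
proof -
  have "wt M h * c (cur i\<^sub>0 h) = (\<Sum>i\<in>UNIV. c i * (wt M h * of_bool (cur i\<^sub>0 h = i)))" for h
    by (simp add: of_bool_def if_distrib sum.delta cong: if_cong)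
  then show ?thesis unfolding visits_def by (simp add: asum_sum asum_cmult)
qed

text \<open>The accumulated half variance \<open>A\<close> converges in mean to the constant
  \<open>c\<close>, so exp A may be replaced by exp c in the near-martingale identity; dividing by
  exp c then yields the limit.\<close>

lemma markov_renewal_clt:
  fixes Q :: "'e::finite \<Rightarrow> ('e \<times> nat) pmf" and G :: "'e \<Rightarrow> 'e \<times> nat \<Rightarrow> real"
  assumes G: "\<And>j s. \<bar>G j s\<bar> \<le> B"
    and mean: "\<And>j. measure_pmf.expectation (Q j) (G j) = 0"
    and lln: "\<And>i. (\<lambda>M. measure_pmf.expectation (mr_path Q i\<^sub>0 (Suc M)) (\<lambda>h. \<bar>visits M i\<^sub>0 i h / real M - \<rho> i\<bar>)) \<longlonglongrightarrow> 0"
  shows "(\<lambda>M. measure_pmf.expectation (mr_path Q i\<^sub>0 (Suc M))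
      (\<lambda>h. iexp (asum (\<lambda>h s. wt M h * G (cur i\<^sub>0 h) s) h / sqrt (real M))))
    \<longlonglongrightarrow> exp (- (\<Sum>i\<in>UNIV. \<rho> i * measure_pmf.expectation (Q i) (\<lambda>s. (G i s)\<^sup>2)) / 2)"
proof -
  have B0: "0 \<le> B" using G[of undefined undefined] by linarith
  define v where "v i = measure_pmf.expectation (Q i) (\<lambda>s. (G i s)\<^sup>2)" for i
  define c where "c = (\<Sum>i\<in>UNIV. v i / 2 * \<rho> i)"
  \<comment> \<open>Dominates both exponents: A \<le> B^2 because \<open>Suc M\<close> \<le> 2 M.
    This makes the exponential Lipschitz with constant exp K.\<close>
  define K where "K = max (B\<^sup>2) c"
  have v: "0 \<le> v i" "v i \<le> B\<^sup>2" for i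
  proof -
    have sq: "(G i s)\<^sup>2 \<le> B\<^sup>2" for s using G[of i s] B0 by (simp add: abs_le_square_iff[symmetric])
    then have "integrable (Q i) (\<lambda>s. (G i s)\<^sup>2)"
      by (intro measure_pmf.integrable_const_bound[of _ "B\<^sup>2"]) auto
    then show "0 \<le> v i" "v i \<le> B\<^sup>2"
      using measure_pmf.integral_le_const[of "Q i" "\<lambda>s. (G i s)\<^sup>2" "B\<^sup>2"] sq by (auto simp: v_def)
  qed
  define X where "X M h = asum (\<lambda>h s. wt M h * G (cur i\<^sub>0 h) s) h / sqrt (real M)" for M h
  define A where "A M h = (\<Sum>i\<in>UNIV. v i / 2 * (visits M i\<^sub>0 i h / real M))" for M h
  \<comment> \<open>The first summand is the near-martingale error with b = B / sqrt M, of order M *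
    M^(-3/2); the second is the cost of replacing \<open>A\<close> by \<open>c\<close>.\<close>
  define err where "err M = real (Suc M) * (exp (real (Suc M) * (B / sqrt (real M))\<^sup>2 / 2) * (exp 1 * (B / sqrt (real M)) ^ 3))
    + exp K * (\<Sum>i\<in>UNIV. v i / 2 * measure_pmf.expectation (mr_path Q i\<^sub>0 (Suc M)) (\<lambda>h. \<bar>visits M i\<^sub>0 i h / real M - \<rho> i\<bar>))" for M
  have bound: "norm (measure_pmf.expectation (mr_path Q i\<^sub>0 (Suc M)) (\<lambda>h. iexp (X M h)) * exp c - 1) \<le> err M"
    if M: "1 \<le> real M" "B\<^sup>2 \<le> real M" for M
  proof -
    define p where "p = mr_path Q i\<^sub>0 (Suc M)"
    define b where "b = B / sqrt (real M)"
    have b: "0 \<le> b" "b \<le> 1"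
      using M B0 real_le_rsqrt[OF M(2)] by (auto simp: b_def)
    have Xeq: "X M = asum (\<lambda>h s. wt M h * (G (cur i\<^sub>0 h) s / sqrt (real M)))"
    proof
      fix h
      have "asum (\<lambda>h s. wt M h * (G (cur i\<^sub>0 h) s / sqrt (real M))) h = asum (\<lambda>h s. (1 / sqrt (real M)) * (wt M h * G (cur i\<^sub>0 h) s)) h"
        by (simp add: mult.commute)
      also have "\<dots> = X M h" by (simp only: asum_cmult) (simp add: X_def)
      finally show "X M h = asum (\<lambda>h s. wt M h * (G (cur i\<^sub>0 h) s / sqrt (real M))) h" by simp
    qed
    have Aeq: "A M h = asum (\<lambda>h s. wt M h * (measure_pmf.expectation (Q (cur i\<^sub>0 h)) (\<lambda>s. (G (cur i\<^sub>0 h) s / sqrt (real M))\<^sup>2) / 2)) h" for h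
      using asum_state_decomposition[of M "\<lambda>j. measure_pmf.expectation (Q j) (\<lambda>s. (G j s / sqrt (real M))\<^sup>2) / 2" i\<^sub>0 h]
      by (simp add: A_def v_def power_divide mult_ac)
    have near: "norm (measure_pmf.expectation p (\<lambda>h. exp (\<i> * X M h + A M h)) - 1) \<le>
       real (Suc M) * (exp (real (Suc M) * b\<^sup>2 / 2) * (exp 1 * b ^ 3))"
      unfolding Xeq Aeq p_def
    proof (rule exponential_near_martingale[OF _ b])
      show "\<bar>G j s / sqrt (real M)\<bar> \<le> b" for j s using G[of j s] by (simp add: b_def divide_right_mono)
      show "measure_pmf.expectation (Q j) (\<lambda>s. G j s / sqrt (real M)) = 0" for j using mean[of j] by simp
    qed
    have A_le: "A M h \<le> K" if "length h = Suc M" for h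
    proof -
      have "A M h = asum (\<lambda>h s. wt M h * (v (cur i\<^sub>0 h) / (2 * real M))) h"
        using asum_state_decomposition[of M "\<lambda>j. v j / (2 * real M)" i\<^sub>0 h] by (simp add: A_def)
      also have "\<dots> \<le> asum (\<lambda>h s. B\<^sup>2 / (2 * real M)) h"
        using v by (intro asum_mono) (auto simp: wt_def intro: divide_right_mono)
      also have "\<dots> = real (Suc M) * (B\<^sup>2 / (2 * real M))" using that by (simp only: asum_const)
      also have "\<dots> \<le> (2 * real M) * (B\<^sup>2 / (2 * real M))" using M by (intro mult_right_mono) auto
      also have "\<dots> \<le> K" using M by (simp add: K_def)
      finally show ?thesis .
    qed
    have intV: "integrable p (\<lambda>h. \<bar>visits M i\<^sub>0 i h / real M - \<rho> i\<bar>)" for i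
    proof -
      have "integrable p (visits M i\<^sub>0 i)"
        unfolding p_def by (rule integrable_visits)
      then show ?thesis by auto
    qed
    have intR: "integrable p (\<lambda>h. exp (\<i> * X M h + A M h))"
      unfolding p_def by (rule integrable_path[of "Suc M" _ "exp K"]) (use A_le in simp)
    have intI: "integrable p (\<lambda>h. iexp (X M h))"
      unfolding p_def by (rule integrable_path[of "Suc M" _ 1]) simp
    have diff: "norm (iexp (X M h) * exp c - exp (\<i> * X M h + A M h)) \<le>
       exp K * (\<Sum>i\<in>UNIV. v i / 2 * \<bar>visits M i\<^sub>0 i h / real M - \<rho> i\<bar>)" if "length h = Suc M" for h
    proof -
      have "iexp (X M h) * exp c - exp (\<i> * X M h + A M h) = iexp (X M h) * complex_of_real (exp c - exp (A M h))"
        by (simp add: exp_add exp_of_real right_diff_distrib)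
      then have "norm (iexp (X M h) * exp c - exp (\<i> * X M h + A M h)) = \<bar>exp (A M h) - exp c\<bar>"
        by (simp only: norm_mult norm_of_real norm_exp_i_times abs_minus_commute) simp
      also have "\<dots> \<le> exp K * \<bar>A M h - c\<bar>"
        by (rule abs_exp_diff_le[OF A_le[OF that]]) (simp add: K_def)
      also have "A M h - c = (\<Sum>i\<in>UNIV. v i / 2 * (visits M i\<^sub>0 i h / real M - \<rho> i))"
        by (simp add: A_def c_def right_diff_distrib sum_subtractf)
      also have "\<bar>\<dots>\<bar> \<le> (\<Sum>i\<in>UNIV. \<bar>v i / 2 * (visits M i\<^sub>0 i h / real M - \<rho> i)\<bar>)" by (rule sum_abs)
      also have "\<dots> = (\<Sum>i\<in>UNIV. v i / 2 * \<bar>visits M i\<^sub>0 i h / real M - \<rho> i\<bar>)"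
        using v(1) by (simp add: abs_mult)
      finally show ?thesis by (simp add: mult_left_mono)
    qed
    have "norm (measure_pmf.expectation p (\<lambda>h. iexp (X M h)) * exp c - measure_pmf.expectation p (\<lambda>h. exp (\<i> * X M h + A M h)))
       = norm (measure_pmf.expectation p (\<lambda>h. iexp (X M h) * exp c - exp (\<i> * X M h + A M h)))"
      using intR intI by simp
    also have "\<dots> \<le> measure_pmf.expectation p (\<lambda>h. norm (iexp (X M h) * exp c - exp (\<i> * X M h + A M h)))"
      by (rule integral_norm_bound)
    also have "\<dots> \<le> measure_pmf.expectation p (\<lambda>h. exp K * (\<Sum>i\<in>UNIV. v i / 2 * \<bar>visits M i\<^sub>0 i h / real M - \<rho> i\<bar>))"
      unfolding p_def
    proof (rule expectation_path_mono)
      show "integrable (mr_path Q i\<^sub>0 (Suc M)) (\<lambda>h. norm (iexp (X M h) * exp c - exp (\<i> * X M h + A M h)))"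
        using intR intI unfolding p_def by (intro integrable_norm Bochner_Integration.integrable_diff integrable_mult_left)
      show "integrable (mr_path Q i\<^sub>0 (Suc M)) (\<lambda>h. exp K * (\<Sum>i\<in>UNIV. v i / 2 * \<bar>visits M i\<^sub>0 i h / real M - \<rho> i\<bar>))"
        using intV unfolding p_def by (intro integrable_mult_right Bochner_Integration.integrable_sum)
    qed (rule diff)
    also have "\<dots> = exp K * (\<Sum>i\<in>UNIV. v i / 2 * measure_pmf.expectation p (\<lambda>h. \<bar>visits M i\<^sub>0 i h / real M - \<rho> i\<bar>))"
      using intV by (simp add: Bochner_Integration.integral_sum del: mr_path.simps)
    finally have "norm (measure_pmf.expectation p (\<lambda>h. iexp (X M h)) * exp c - measure_pmf.expectation p (\<lambda>h. exp (\<i> * X M h + A M h)))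
      \<le> exp K * (\<Sum>i\<in>UNIV. v i / 2 * measure_pmf.expectation p (\<lambda>h. \<bar>visits M i\<^sub>0 i h / real M - \<rho> i\<bar>))" .
    from norm_triangle_le[OF add_mono[OF near this]] show ?thesis
      by (simp add: err_def p_def b_def del: mr_path.simps)
  qed
  have "err \<longlonglongrightarrow> 0 + exp K * (\<Sum>i\<in>UNIV. v i / 2 * 0)"
    unfolding err_def
  proof (intro tendsto_add tendsto_mult tendsto_const tendsto_sum lln)
    show "(\<lambda>M. real (Suc M) * (exp (real (Suc M) * (B / sqrt (real M))\<^sup>2 / 2) * (exp 1 * (B / sqrt (real M)) ^ 3))) \<longlonglongrightarrow> 0"
    proof -
      have 1: "(\<lambda>M. real (Suc M) * (exp 1 * (B / sqrt (real M)) ^ 3)) \<longlonglongrightarrow> 0"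
        unfolding power_divide by real_asymp
      have 2: "(\<lambda>M. exp (real (Suc M) * (B / sqrt (real M))\<^sup>2 / 2)) \<longlonglongrightarrow> exp (B\<^sup>2 / 2)"
        unfolding power_divide by (intro tendsto_intros; (real_asymp | simp))
      show ?thesis using tendsto_mult[OF 1 2] by (simp add: mult_ac)
    qed
  qed
  then have err0: "err \<longlonglongrightarrow> 0" by simp
  have "(\<lambda>M. measure_pmf.expectation (mr_path Q i\<^sub>0 (Suc M)) (\<lambda>h. iexp (X M h)) * exp c - 1) \<longlonglongrightarrow> 0"
  proof (rule Lim_null_comparison[OF _ err0])
    show "\<forall>\<^sub>F M in sequentially. norm (measure_pmf.expectation (mr_path Q i\<^sub>0 (Suc M)) (\<lambda>h. iexp (X M h)) * exp c - 1) \<le> err M"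
      using eventually_ge_at_top[of "nat \<lceil>B\<^sup>2\<rceil> + 1"]
    proof eventually_elim
      case (elim M)
      then have "1 \<le> real M" "B\<^sup>2 \<le> real M" by linarith+
      then show ?case by (rule bound)
    qed
  qed
  from tendsto_add[OF this tendsto_const[of 1]]
  have lim: "(\<lambda>M. measure_pmf.expectation (mr_path Q i\<^sub>0 (Suc M)) (\<lambda>h. iexp (X M h)) * exp c) \<longlonglongrightarrow> 1"
    by (simp del: mr_path.simps)
  have inv: "complex_of_real (exp c) * complex_of_real (exp (- c)) = 1"
    by (simp flip: of_real_mult exp_add)
  have "(\<lambda>M. measure_pmf.expectation (mr_path Q i\<^sub>0 (Suc M)) (\<lambda>h. iexp (X M h))) \<longlonglongrightarrow> exp (- c)"
    using tendsto_mult[OF lim tendsto_const[of "complex_of_real (exp (- c))"]] inv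
    by (simp add: mult.assoc del: mr_path.simps)
  moreover have "- c = - (\<Sum>i\<in>UNIV. \<rho> i * v i) / 2"
    by (simp add: c_def sum_divide_distrib mult.commute)
  ultimately show ?thesis by (simp add: X_def v_def del: mr_path.simps)
qed

section \<open>Random normalisation\<close>

text \<open>For the estimator only the jumps completed by time \<open>M\<close> count; \<open>wt\<close> also counts the jump in
  progress.\<close>

definition cnt :: "nat \<Rightarrow> 'e \<Rightarrow> 'e \<Rightarrow> ('e \<times> nat) set \<Rightarrow> ('e \<times> nat) list \<Rightarrow> real" where
  "cnt M i\<^sub>0 i A = asum (\<lambda>h s. wt M (s # h) * of_bool (cur i\<^sub>0 h = i \<and> s \<in> A))"

section \<open>Completed jumps against jumps begun\<close>

lemma wt_mono: "wt M (s # h) \<le> wt M h"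
  by (auto simp: wt_def)

text \<open>Only the jump that crosses \<open>M\<close> has weight 1 before and weight 0 after it,
  so the sum records whether the crossing has happened.\<close>

lemma asum_wt_diff: "asum (\<lambda>h s. wt M h - wt M (s # h)) h = 1 - wt M h"
  by (induction h) (auto simp: wt_def)

lemma abs_asum_wt_diff_le:
  assumes "\<And>h s. \<bar>f h s\<bar> \<le> B"
  shows "\<bar>asum (\<lambda>h s. wt M (s # h) * f h s) h - asum (\<lambda>h s. wt M h * f h s) h\<bar> \<le> B"
proof -
  have B: "0 \<le> B" using assms[of "[]" undefined] by linarith
  have "asum (\<lambda>h s. wt M (s # h) * f h s) h - asum (\<lambda>h s. wt M h * f h s) h =
      asum (\<lambda>h s. wt M (s # h) * f h s + (-1) * (wt M h * f h s)) h"
    by (simp only: asum_add asum_cmult)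
  also have "\<bar>\<dots>\<bar> \<le> asum (\<lambda>h s. \<bar>wt M (s # h) * f h s + (-1) * (wt M h * f h s)\<bar>) h"
    by (rule abs_asum_le)
  also have "\<dots> \<le> asum (\<lambda>h s. B * (wt M h - wt M (s # h))) h"
  proof (rule asum_mono)
    fix h s
    have "wt M (s # h) * f h s + (-1) * (wt M h * f h s) = - ((wt M h - wt M (s # h)) * f h s)"
      by (simp add: algebra_simps)
    then have "\<bar>wt M (s # h) * f h s + (-1) * (wt M h * f h s)\<bar> = (wt M h - wt M (s # h)) * \<bar>f h s\<bar>"
      using wt_mono[of M s h] by (simp only: abs_minus_cancel abs_mult)
    also have "\<dots> \<le> B * (wt M h - wt M (s # h))"
      using assms[of h s] wt_mono[of M s h] by (simp add: mult.commute mult_right_mono)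
    finally show "\<bar>wt M (s # h) * f h s + (-1) * (wt M h * f h s)\<bar> \<le> B * (wt M h - wt M (s # h))" .
  qed
  also have "\<dots> = B * (1 - wt M h)" by (simp only: asum_cmult asum_wt_diff)
  also have "\<dots> \<le> B" using B wt_bounds(1)[of M h] by (simp add: mult_left_le)
  finally show ?thesis .
qed

lemma visits_minus_cnt: "0 \<le> visits M i\<^sub>0 i h - cnt M i\<^sub>0 i UNIV h" "visits M i\<^sub>0 i h - cnt M i\<^sub>0 i UNIV h \<le> 1"
proof -
  have "cnt M i\<^sub>0 i UNIV h \<le> visits M i\<^sub>0 i h"
    unfolding cnt_def visits_def using wt_mono by (intro asum_mono) (auto simp: mult_right_mono)
  then show "0 \<le> visits M i\<^sub>0 i h - cnt M i\<^sub>0 i UNIV h" by simp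
  show "visits M i\<^sub>0 i h - cnt M i\<^sub>0 i UNIV h \<le> 1"
    using abs_asum_wt_diff_le[of "\<lambda>h s. of_bool (cur i\<^sub>0 h = i)" 1 M h] by (simp add: visits_def cnt_def)
qed

text \<open>Deterministic comparison on the event that the visit frequency is close to 1 / \<mu>: W
  and N belong to completed jumps, W' and V also count the one in progress. The last two terms of
  the bound are tailored to what is known in mean: a bounded second moment of W' / sqrt M, to be
  made harmless by small \<eta>, and a vanishing first moment of the deviation of V / M.\<close>

lemma normalized_sum_diff_le:
  fixes W W' N V M \<mu> \<eta> B :: real
  assumes \<mu>: "0 < \<mu>" and M: "3 * \<mu> \<le> M" "1 \<le> M" and "0 < \<eta>" and B: "0 \<le> B"
    and VN: "0 \<le> V - N" "V - N \<le> 1" and W: "\<bar>W - W'\<bar> \<le> B" "\<bar>W'\<bar> \<le> 2 * M * B"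
    and D: "\<bar>V / M - 1 / \<mu>\<bar> \<le> 1 / (3 * \<mu>)"
  shows "0 < N" "\<bar>sqrt M * (W / N) - \<mu> * W' / sqrt M\<bar> \<le>
    (3 * \<mu> * B + 6 * \<mu>\<^sup>2 * B) / sqrt M + 3 * \<mu>\<^sup>2 * \<eta> * (W'\<^sup>2 / M) + 3 * \<mu> / \<eta> * \<bar>V / M - 1 / \<mu>\<bar>"
proof -
  define D where "D = \<bar>V / M - 1 / \<mu>\<bar>"
  define x where "x = W' / sqrt M"
  have "1 / \<mu> - 1 / (3 * \<mu>) \<le> V / M" using D by (simp add: abs_le_iff)
  moreover have "1 / \<mu> - 1 / (3 * \<mu>) = 2 / (3 * \<mu>)" using \<mu> by (simp add: field_simps)
  ultimately have "2 / (3 * \<mu>) \<le> V / M" by simp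
  then have V: "2 * M / (3 * \<mu>) \<le> V" using M by (simp add: field_simps)
  have "1 \<le> M / (3 * \<mu>)" using M \<mu> by simp
  then have N: "M / (3 * \<mu>) \<le> N" using V VN by simp
  have pos: "0 < M / (3 * \<mu>)" using M \<mu> by simp
  then show N0: "0 < N" using N by linarith
  have MN: "M / N \<le> 3 * \<mu>" using N N0 \<mu> by (simp add: field_simps)
  have 1: "\<bar>sqrt M * ((W - W') / N)\<bar> \<le> 3 * \<mu> * B / sqrt M"
  proof -
    have "\<bar>sqrt M * ((W - W') / N)\<bar> = (M / N) * (\<bar>W - W'\<bar> / sqrt M)"
    proof -
      have "M / sqrt M = sqrt M" using M by (simp add: real_div_sqrt)
      moreover have "(M / N) * (\<bar>W - W'\<bar> / sqrt M) = (M / sqrt M) * (\<bar>W - W'\<bar> / N)" by simp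
      ultimately show ?thesis using N0 M by (simp add: abs_mult)
    qed
    also have "\<dots> \<le> (3 * \<mu>) * (B / sqrt M)"
      using MN W N0 M \<mu> by (intro mult_mono divide_right_mono) auto
    finally show ?thesis by simp
  qed
  have 2: "\<bar>M / N - \<mu>\<bar> \<le> 3 * \<mu>\<^sup>2 * (D + 1 / M)"
  proof -
    have "M / N - \<mu> = (M / N) * (\<mu> * (1 / \<mu> - N / M))" using N0 M \<mu> by (simp add: field_simps)
    then have "\<bar>M / N - \<mu>\<bar> = (M / N) * (\<mu> * \<bar>1 / \<mu> - N / M\<bar>)"
      using N0 M \<mu> by (simp add: abs_mult)
    also have "\<dots> \<le> (3 * \<mu>) * (\<mu> * (D + 1 / M))"
    proof (rule mult_mono[OF MN])
      have "(V - N) / M \<le> 1 / M" "0 \<le> (V - N) / M" using VN M by (auto intro: divide_right_mono)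
      then have "\<bar>V / M - N / M\<bar> \<le> 1 / M" by (simp add: diff_divide_distrib)
      then have "\<bar>1 / \<mu> - N / M\<bar> \<le> D + 1 / M" unfolding D_def by linarith
      then show "\<mu> * \<bar>1 / \<mu> - N / M\<bar> \<le> \<mu> * (D + 1 / M)" using \<mu> by simp
    qed (use \<mu> in auto)
    finally show ?thesis by (simp add: power2_eq_square mult.assoc)
  qed
  have xM: "\<bar>x\<bar> / M \<le> 2 * B / sqrt M"
  proof -
    have "\<bar>x\<bar> / M = \<bar>W'\<bar> / (sqrt M * M)" using M by (simp add: x_def)
    also have "\<dots> \<le> 2 * M * B / (sqrt M * M)" using W M by (intro divide_right_mono) auto
    also have "\<dots> = 2 * B / sqrt M" using M by simp
    finally show ?thesis .
  qed
  \<comment> \<open>No joint moment of x and D is available, hence the weighted Young inequality; D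
    \<le> 1 / (3 \<mu>) turns the resulting D * D into a multiple of D.\<close>
  have xD: "\<bar>x\<bar> * D \<le> \<eta> * x\<^sup>2 + D / (\<mu> * \<eta>)"
  proof -
    have "0 \<le> (\<eta> * \<bar>x\<bar> - D / 2)\<^sup>2" by simp
    then have 1: "\<eta> * (\<bar>x\<bar> * D) \<le> \<eta>\<^sup>2 * x\<^sup>2 + D * D / 4"
      by (simp add: power2_diff power_mult_distrib power_divide power2_eq_square algebra_simps)
    have "D * D \<le> D * (1 / (3 * \<mu>))" using D unfolding D_def by (intro mult_left_mono) auto
    then have "D * D / 4 \<le> D * (1 / (3 * \<mu>)) / 4" by simp
    also have "\<dots> \<le> D / \<mu>" using \<mu> by (simp add: D_def field_simps)
    finally have "\<eta> * (\<bar>x\<bar> * D) \<le> \<eta>\<^sup>2 * x\<^sup>2 + D / \<mu>" using 1 by linarith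
    then show ?thesis using \<open>0 < \<eta>\<close> \<mu> by (simp add: field_simps power2_eq_square)
  qed
  have "sqrt M * (W / N) - \<mu> * W' / sqrt M = sqrt M * ((W - W') / N) + x * (M / N - \<mu>)"
  proof -
    have "x * (M / N) = (M / sqrt M) * (W' / N)" by (simp add: x_def)
    also have "M / sqrt M = sqrt M" using M by (simp add: real_div_sqrt)
    finally have "x * (M / N) = sqrt M * (W' / N)" .
    then show ?thesis by (simp add: x_def diff_divide_distrib algebra_simps)
  qed
  then have "\<bar>sqrt M * (W / N) - \<mu> * W' / sqrt M\<bar> \<le> \<bar>sqrt M * ((W - W') / N)\<bar> + \<bar>x\<bar> * \<bar>M / N - \<mu>\<bar>"
    using abs_triangle_ineq[of "sqrt M * ((W - W') / N)" "x * (M / N - \<mu>)"] by (simp only: abs_mult[of x])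
  also have "\<dots> \<le> 3 * \<mu> * B / sqrt M + \<bar>x\<bar> * (3 * \<mu>\<^sup>2 * (D + 1 / M))"
    by (intro add_mono 1 mult_left_mono 2) simp
  also have "\<dots> = 3 * \<mu> * B / sqrt M + 3 * \<mu>\<^sup>2 * (\<bar>x\<bar> * D) + 3 * \<mu>\<^sup>2 * (\<bar>x\<bar> / M)"
    by (simp add: algebra_simps)
  also have "\<dots> \<le> 3 * \<mu> * B / sqrt M + 3 * \<mu>\<^sup>2 * (\<eta> * x\<^sup>2 + D / (\<mu> * \<eta>)) + 3 * \<mu>\<^sup>2 * (2 * B / sqrt M)"
    by (intro add_mono order_refl mult_left_mono xD xM) auto
  also have "\<dots> = (3 * \<mu> * B + 6 * \<mu>\<^sup>2 * B) / sqrt M + 3 * \<mu>\<^sup>2 * \<eta> * x\<^sup>2 + 3 * \<mu> / \<eta> * D"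
  proof -
    have "3 * \<mu>\<^sup>2 * (D / (\<mu> * \<eta>)) = 3 * \<mu> / \<eta> * D" using \<mu> by (simp add: power2_eq_square)
    then have "3 * \<mu>\<^sup>2 * (\<eta> * x\<^sup>2 + D / (\<mu> * \<eta>)) = 3 * \<mu>\<^sup>2 * \<eta> * x\<^sup>2 + 3 * \<mu> / \<eta> * D"
      by (simp only: distrib_left mult.assoc)
    then show ?thesis by (simp add: add_divide_distrib)
  qed
  finally show "\<bar>sqrt M * (W / N) - \<mu> * W' / sqrt M\<bar> \<le>
    (3 * \<mu> * B + 6 * \<mu>\<^sup>2 * B) / sqrt M + 3 * \<mu>\<^sup>2 * \<eta> * (W'\<^sup>2 / M) + 3 * \<mu> / \<eta> * \<bar>V / M - 1 / \<mu>\<bar>"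
    using M by (simp add: x_def D_def power_divide)
qed

lemma norm_iexp_diff_le: "norm (iexp a - iexp b) \<le> \<bar>a - b\<bar>" "norm (iexp a - iexp b) \<le> 2"
proof -
  have "norm (iexp (a - b) - 1) \<le> \<bar>a - b\<bar>" using iexp_approx1[of "a - b" 0] by simp
  moreover have "iexp a - iexp b = iexp b * (iexp (a - b) - 1)"
    by (simp add: right_diff_distrib flip: exp_add)
  ultimately show "norm (iexp a - iexp b) \<le> \<bar>a - b\<bar>" by (simp add: norm_mult)
  show "norm (iexp a - iexp b) \<le> 2" using norm_triangle_ineq4[of "iexp a" "iexp b"] by simp
qed

text \<open>\<open>X\<close> is prescribed only where all counts are positive, which holds on the
  good event where every visit frequency is near its limit. There the exponentials of X and Y are
  compared by the deterministic estimate; elsewhere they differ by at most 2, which the mean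
  deviation of the visits pays for.\<close>

lemma renewal_normalization:
  fixes Q :: "'e::finite \<Rightarrow> ('e \<times> nat) pmf" and G :: "'e \<Rightarrow> 'e \<times> nat \<Rightarrow> real"
  assumes G: "\<And>j s. \<bar>G j s\<bar> \<le> B"
    and mean: "\<And>j. measure_pmf.expectation (Q j) (G j) = 0"
    and \<mu>: "\<And>i. 0 < \<mu> i"
    and lln: "\<And>i. (\<lambda>M. measure_pmf.expectation (mr_path Q i\<^sub>0 (Suc M)) (\<lambda>h. \<bar>visits M i\<^sub>0 i h / real M - 1 / \<mu> i\<bar>)) \<longlonglongrightarrow> 0"
    and X: "\<And>M h. (\<And>i. 0 < cnt M i\<^sub>0 i UNIV h) \<Longrightarrow> X M h =
      (\<Sum>i\<in>UNIV. sqrt (real M) * (asum (\<lambda>h s. wt M (s # h) * (of_bool (cur i\<^sub>0 h = i) * G i s)) h / cnt M i\<^sub>0 i UNIV h))"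
  shows "(\<lambda>M. measure_pmf.expectation (mr_path Q i\<^sub>0 (Suc M)) (\<lambda>h. iexp (X M h)))
    \<longlonglongrightarrow> exp (- (\<Sum>i\<in>UNIV. \<mu> i * measure_pmf.expectation (Q i) (\<lambda>s. (G i s)\<^sup>2)) / 2)"
proof -
  have B: "0 \<le> B" using G[of undefined undefined] by linarith
  define Y where "Y M h = asum (\<lambda>h s. wt M h * (\<mu> (cur i\<^sub>0 h) * G (cur i\<^sub>0 h) s)) h / sqrt (real M)" for M h
  define m where "m = Max (range \<mu>)"
  have m: "\<mu> i \<le> m" for i unfolding m_def by (rule Max_ge) auto
  have m0: "0 < m" using \<mu> m less_le_trans by blast
  have Y_lim: "(\<lambda>M. measure_pmf.expectation (mr_path Q i\<^sub>0 (Suc M)) (\<lambda>h. iexp (Y M h)))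
    \<longlonglongrightarrow> exp (- (\<Sum>i\<in>UNIV. \<mu> i * measure_pmf.expectation (Q i) (\<lambda>s. (G i s)\<^sup>2)) / 2)"
  proof -
    have "(\<lambda>M. measure_pmf.expectation (mr_path Q i\<^sub>0 (Suc M)) (\<lambda>h. iexp (Y M h)))
      \<longlonglongrightarrow> exp (- (\<Sum>i\<in>UNIV. 1 / \<mu> i * measure_pmf.expectation (Q i) (\<lambda>s. (\<mu> i * G i s)\<^sup>2)) / 2)"
      unfolding Y_def
    proof (rule markov_renewal_clt[OF _ _ lln, where B="m * B"])
      show "\<bar>\<mu> j * G j s\<bar> \<le> m * B" for j s
        using mult_mono[OF m[of j] G[of j s]] \<mu>[of j] m0 by (simp add: abs_mult)
      show "measure_pmf.expectation (Q j) (\<lambda>s. \<mu> j * G j s) = 0" for j using mean by simp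
    qed
    moreover have "1 / \<mu> i * measure_pmf.expectation (Q i) (\<lambda>s. (\<mu> i * G i s)\<^sup>2) =
        \<mu> i * measure_pmf.expectation (Q i) (\<lambda>s. (G i s)\<^sup>2)" for i
    proof -
      have "measure_pmf.expectation (Q i) (\<lambda>s. (\<mu> i * G i s)\<^sup>2) = (\<mu> i)\<^sup>2 * measure_pmf.expectation (Q i) (\<lambda>s. (G i s)\<^sup>2)"
        by (simp add: power_mult_distrib)
      then show ?thesis using \<mu>[of i] by (simp add: power2_eq_square)
    qed
    ultimately show ?thesis by (simp del: mr_path.simps)
  qed
  define W' where "W' M i = asum (\<lambda>h s. wt M h * (of_bool (cur i\<^sub>0 h = i) * G i s))" for M i
  have fB: "\<bar>of_bool (cur i\<^sub>0 h = i) * G i s\<bar> \<le> B" for h i s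
    using G[of i s] B by simp
  have wfB: "\<bar>wt M h * (of_bool (cur i\<^sub>0 h = i) * G i s)\<bar> \<le> B" for M h i s
    using G[of i s] B by (simp add: wt_def)
  have W'_sq: "measure_pmf.expectation (mr_path Q i\<^sub>0 (Suc M)) (\<lambda>h. (W' M i h)\<^sup>2) \<le> real (Suc M) * B\<^sup>2" for M i
    unfolding W'_def
  proof (rule expectation_asum_square_le)
    show "measure_pmf.expectation (Q (cur i\<^sub>0 h)) (\<lambda>s. wt M h * (of_bool (cur i\<^sub>0 h = i) * G i s)) = 0" for h
      using mean by (cases "cur i\<^sub>0 h = i") auto
  qed (rule wfB)
  have W'_bound: "\<bar>W' M i h\<bar> \<le> real (length h) * B" for M i h
    unfolding W'_def by (rule abs_asum_bound[OF wfB])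
  have int_W': "integrable (mr_path Q i\<^sub>0 n) (\<lambda>h. (W' M i h)\<^sup>2)" for n M i
  proof (rule integrable_path)
    show "norm ((W' M i h)\<^sup>2) \<le> (real n * B)\<^sup>2" if "length h = n" for h
      using W'_bound[of M i h] that power_mono[of "\<bar>W' M i h\<bar>" "real n * B" 2] by simp
  qed
  define D where "D M i h = \<bar>visits M i\<^sub>0 i h / real M - 1 / \<mu> i\<bar>" for M i h
  have int_D: "integrable (mr_path Q i\<^sub>0 n) (D M i)" for n M i
    unfolding D_def using integrable_visits[of Q i\<^sub>0 n M i] by auto
  have Y_eq: "Y M h = (\<Sum>i\<in>UNIV. \<mu> i * W' M i h / sqrt (real M))" for M h
  proof -
    have "wt M h * (\<mu> (cur i\<^sub>0 h) * G (cur i\<^sub>0 h) s) =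
        (\<Sum>i\<in>UNIV. \<mu> i * (wt M h * (of_bool (cur i\<^sub>0 h = i) * G i s)))" for h s
      by (simp add: of_bool_def if_distrib if_distribR sum.delta cong: if_cong)
    then show ?thesis
      unfolding Y_def W'_def by (simp add: asum_sum asum_cmult sum_divide_distrib)
  qed
  have close: "(\<lambda>M. measure_pmf.expectation (mr_path Q i\<^sub>0 (Suc M)) (\<lambda>h. iexp (X M h)) -
       measure_pmf.expectation (mr_path Q i\<^sub>0 (Suc M)) (\<lambda>h. iexp (Y M h))) \<longlonglongrightarrow> 0"
  proof (rule tendstoI)
    fix r :: real assume "0 < r"
    \<comment> \<open>Keeps the second moment terms below r / 2; the factor 2 in 2 B^2 comes from
      \<open>Suc M\<close> \<le> 2 M.\<close>
    define \<eta> where "\<eta> = r / (2 * (\<Sum>i\<in>UNIV. 3 * (\<mu> i)\<^sup>2 * (2 * B\<^sup>2)) + 2)"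
    have S0: "0 \<le> (\<Sum>i\<in>UNIV. 3 * (\<mu> i)\<^sup>2 * (2 * B\<^sup>2))" by (intro sum_nonneg) auto
    then have \<eta>: "0 < \<eta>" using \<open>0 < r\<close> by (simp add: \<eta>_def)
    have \<eta>S: "(\<Sum>i\<in>UNIV. 3 * (\<mu> i)\<^sup>2 * (2 * B\<^sup>2)) * \<eta> < r / 2"
    proof -
      have "(\<Sum>i\<in>UNIV. 3 * (\<mu> i)\<^sup>2 * (2 * B\<^sup>2)) * \<eta> < ((\<Sum>i\<in>UNIV. 3 * (\<mu> i)\<^sup>2 * (2 * B\<^sup>2)) + 1) * \<eta>"
        using \<eta> by simp
      also have "\<dots> = r / 2" using S0 by (simp add: \<eta>_def field_simps)
      finally show ?thesis .
    qed
    define e where "e M = (\<Sum>i\<in>UNIV. (3 * \<mu> i * B + 6 * (\<mu> i)\<^sup>2 * B) / sqrt (real M) +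
        (3 * \<mu> i / \<eta> + 6 * \<mu> i) * measure_pmf.expectation (mr_path Q i\<^sub>0 (Suc M)) (D M i))" for M
    have "e \<longlonglongrightarrow> (\<Sum>i\<in>UNIV. 0 + (3 * \<mu> i / \<eta> + 6 * \<mu> i) * 0)"
      unfolding e_def
    proof (intro tendsto_sum tendsto_add tendsto_mult tendsto_const)
      show "(\<lambda>M. (3 * \<mu> i * B + 6 * (\<mu> i)\<^sup>2 * B) / sqrt (real M)) \<longlonglongrightarrow> 0" for i by real_asymp
      show "(\<lambda>M. measure_pmf.expectation (mr_path Q i\<^sub>0 (Suc M)) (D M i)) \<longlonglongrightarrow> 0" for i
        unfolding D_def by (rule lln)
    qed
    then have "e \<longlonglongrightarrow> 0" by simp
    then have e_small: "\<forall>\<^sub>F M in sequentially. e M < r / 2"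
      using order_tendstoD(2)[of e 0 sequentially "r / 2"] \<open>0 < r\<close> by simp
    show "\<forall>\<^sub>F M in sequentially. dist (measure_pmf.expectation (mr_path Q i\<^sub>0 (Suc M)) (\<lambda>h. iexp (X M h)) -
       measure_pmf.expectation (mr_path Q i\<^sub>0 (Suc M)) (\<lambda>h. iexp (Y M h))) 0 < r"
      using e_small eventually_ge_at_top[of "nat \<lceil>3 * m\<rceil> + 1"]
    proof eventually_elim
      case (elim M)
      then have M: "3 * m \<le> real M" "1 \<le> real M" by linarith+
      define p where "p = mr_path Q i\<^sub>0 (Suc M)"
      \<comment> \<open>The additional 6 \<mu> D exceeds 2 whenever D > 1 / (3 \<mu>), so
        \<open>t\<close> bounds the difference of the exponentials off the good event as
        well.\<close>
      define t where "t i h = (3 * \<mu> i * B + 6 * (\<mu> i)\<^sup>2 * B) / sqrt (real M) + 3 * (\<mu> i)\<^sup>2 * \<eta> * ((W' M i h)\<^sup>2 / real M) +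
        (3 * \<mu> i / \<eta> + 6 * \<mu> i) * D M i h" for i h
      have \<mu>0: "0 \<le> \<mu> i" for i using \<mu>[of i] by simp
      have D0: "0 \<le> D M i h" for i h by (simp add: D_def)
      have t0: "0 \<le> t i h" for i h
        unfolding t_def using \<mu>0 B \<eta> D0 by (intro add_nonneg_nonneg mult_nonneg_nonneg divide_nonneg_nonneg) auto
      have t_ge: "6 * \<mu> i * D M i h \<le> t i h" for i h
      proof -
        have "t i h = 6 * \<mu> i * D M i h + ((3 * \<mu> i * B + 6 * (\<mu> i)\<^sup>2 * B) / sqrt (real M) + 3 * (\<mu> i)\<^sup>2 * \<eta> * ((W' M i h)\<^sup>2 / real M) + 3 * \<mu> i / \<eta> * D M i h)"
          by (simp add: t_def algebra_simps)
        moreover have "0 \<le> (3 * \<mu> i * B + 6 * (\<mu> i)\<^sup>2 * B) / sqrt (real M) + 3 * (\<mu> i)\<^sup>2 * \<eta> * ((W' M i h)\<^sup>2 / real M) + 3 * \<mu> i / \<eta> * D M i h"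
          using \<mu>0 B \<eta> D0 by (intro add_nonneg_nonneg mult_nonneg_nonneg divide_nonneg_nonneg) auto
        ultimately show ?thesis by linarith
      qed
      have pw: "norm (iexp (X M h) - iexp (Y M h)) \<le> (\<Sum>i\<in>UNIV. t i h)" if len: "length h = Suc M" for h
      proof (cases "\<forall>i. D M i h \<le> 1 / (3 * \<mu> i)")
        case True
        define W where "W i = asum (\<lambda>h s. wt M (s # h) * (of_bool (cur i\<^sub>0 h = i) * G i s)) h" for i
        have cmp: "0 < cnt M i\<^sub>0 i UNIV h \<and>
          \<bar>sqrt (real M) * (W i / cnt M i\<^sub>0 i UNIV h) - \<mu> i * W' M i h / sqrt (real M)\<bar> \<le> t i h" for i
        proof -
          have WW: "\<bar>W i - W' M i h\<bar> \<le> B"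
            unfolding W_def W'_def by (rule abs_asum_wt_diff_le[OF fB])
          have "real (length h) * B \<le> 2 * real M * B" using len M B by (intro mult_right_mono) auto
          then have W2: "\<bar>W' M i h\<bar> \<le> 2 * real M * B" using W'_bound[of M i h] by linarith
          have 3: "3 * \<mu> i \<le> real M" using M m[of i] by linarith
          note * = normalized_sum_diff_le[OF \<mu> 3 M(2) \<eta> B visits_minus_cnt WW W2 True[rule_format, of i, unfolded D_def]]
          have "0 \<le> 6 * \<mu> i * D M i h" using \<mu>0 D0 by simp
          with * show ?thesis unfolding t_def D_def by (auto simp: distrib_right)
        qed
        have "X M h - Y M h = (\<Sum>i\<in>UNIV. sqrt (real M) * (W i / cnt M i\<^sub>0 i UNIV h) - \<mu> i * W' M i h / sqrt (real M))"
          using X[of M h] cmp unfolding Y_eq W_def by (simp add: sum_subtractf)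
        also have "\<bar>\<dots>\<bar> \<le> (\<Sum>i\<in>UNIV. \<bar>sqrt (real M) * (W i / cnt M i\<^sub>0 i UNIV h) - \<mu> i * W' M i h / sqrt (real M)\<bar>)"
          by (rule sum_abs)
        also have "\<dots> \<le> (\<Sum>i\<in>UNIV. t i h)" using cmp by (intro sum_mono) auto
        finally show ?thesis using norm_iexp_diff_le(1)[of "X M h" "Y M h"] by linarith
      next
        case False
        then obtain i where i: "1 / (3 * \<mu> i) < D M i h" by (auto simp: not_le)
        have "2 \<le> 6 * \<mu> i * D M i h" using i \<mu>[of i] by (simp add: field_simps)
        also have "\<dots> \<le> t i h" by (rule t_ge)
        also have "\<dots> \<le> (\<Sum>i\<in>UNIV. t i h)" using t0 by (intro member_le_sum) auto
        finally show ?thesis using norm_iexp_diff_le(2)[of "X M h" "Y M h"] by linarith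
      qed
      have int_iexp: "integrable p (\<lambda>h. iexp (Z h))" for Z
        by (rule measure_pmf.integrable_const_bound[of _ 1]) auto
      have int_t: "integrable p (t i)" for i
        unfolding t_def p_def using int_W' int_D
        by (intro Bochner_Integration.integrable_add integrable_mult_right integrable_divide) (auto simp del: mr_path.simps)
      have "norm (measure_pmf.expectation p (\<lambda>h. iexp (X M h)) - measure_pmf.expectation p (\<lambda>h. iexp (Y M h))) =
          norm (measure_pmf.expectation p (\<lambda>h. iexp (X M h) - iexp (Y M h)))"
        by (simp only: Bochner_Integration.integral_diff[OF int_iexp int_iexp])
      also have "\<dots> \<le> measure_pmf.expectation p (\<lambda>h. norm (iexp (X M h) - iexp (Y M h)))"
        by (rule integral_norm_bound)
      also have "\<dots> \<le> measure_pmf.expectation p (\<lambda>h. \<Sum>i\<in>UNIV. t i h)"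
        unfolding p_def
      proof (rule expectation_path_mono)
        show "integrable (mr_path Q i\<^sub>0 (Suc M)) (\<lambda>h. norm (iexp (X M h) - iexp (Y M h)))"
          by (rule integrable_norm[OF Bochner_Integration.integrable_diff[OF int_iexp int_iexp, unfolded p_def]])
        show "integrable (mr_path Q i\<^sub>0 (Suc M)) (\<lambda>h. \<Sum>i\<in>UNIV. t i h)"
          by (rule Bochner_Integration.integrable_sum[OF int_t[unfolded p_def]])
      qed (rule pw)
      also have "\<dots> = (\<Sum>i\<in>UNIV. measure_pmf.expectation p (t i))"
        by (rule Bochner_Integration.integral_sum[OF int_t])
      also have "\<dots> = (\<Sum>i\<in>UNIV. (3 * \<mu> i * B + 6 * (\<mu> i)\<^sup>2 * B) / sqrt (real M) +
          3 * (\<mu> i)\<^sup>2 * \<eta> * (measure_pmf.expectation p (\<lambda>h. (W' M i h)\<^sup>2) / real M) +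
          (3 * \<mu> i / \<eta> + 6 * \<mu> i) * measure_pmf.expectation p (D M i))"
        unfolding t_def[abs_def] p_def using int_W' int_D by (simp del: mr_path.simps)
      also have "\<dots> \<le> (\<Sum>i\<in>UNIV. (3 * \<mu> i * B + 6 * (\<mu> i)\<^sup>2 * B) / sqrt (real M) +
          3 * (\<mu> i)\<^sup>2 * \<eta> * (2 * B\<^sup>2) +
          (3 * \<mu> i / \<eta> + 6 * \<mu> i) * measure_pmf.expectation p (D M i))"
      proof (intro sum_mono add_mono order_refl mult_left_mono)
        fix i
        have "measure_pmf.expectation p (\<lambda>h. (W' M i h)\<^sup>2) \<le> real (Suc M) * B\<^sup>2"
          unfolding p_def by (rule W'_sq)
        also have "\<dots> \<le> (2 * real M) * B\<^sup>2" using M by (intro mult_right_mono) auto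
        finally show "measure_pmf.expectation p (\<lambda>h. (W' M i h)\<^sup>2) / real M \<le> 2 * B\<^sup>2"
          using M by (simp add: divide_le_eq mult_ac)
      qed (use \<eta> in auto)
      also have "\<dots> = e M + (\<Sum>i\<in>UNIV. 3 * (\<mu> i)\<^sup>2 * (2 * B\<^sup>2)) * \<eta>"
        unfolding e_def p_def sum_distrib_right sum.distrib[symmetric] by (intro sum.cong) (auto simp: mult_ac simp del: mr_path.simps)
      also have "\<dots> < r" using elim(1) \<eta>S by linarith
      finally show ?case by (simp add: p_def dist_norm del: mr_path.simps)
    qed
  qed
  show ?thesis using tendsto_add[OF close Y_lim] by (simp del: mr_path.simps)
qed

section \<open>The law of the path\<close>

definition step_pmf :: "('e::finite \<Rightarrow> 'e \<Rightarrow> nat \<Rightarrow> real) \<Rightarrow> 'e \<Rightarrow> ('e \<times> nat) pmf" where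
  "step_pmf q i = embed_pmf (\<lambda>(j, k). q i j k)"

lemma pmf_step_pmf:
  assumes "semi_markov_kernel q"
  shows "pmf (step_pmf q i) (j, k) = q i j k"
proof -
  have q: "\<And>i j k. 0 \<le> q i j k" "\<And>i j. summable (q i j)" "(\<Sum>j\<in>UNIV. \<Sum>k. q i j k) = 1"
    using assms by (auto simp: semi_markov_kernel_def)
  have "(\<integral>\<^sup>+s. ennreal (case s of (j, k) \<Rightarrow> q i j k) \<partial>count_space UNIV) =
      (\<integral>\<^sup>+j. \<integral>\<^sup>+k. ennreal (q i j k) \<partial>count_space UNIV \<partial>count_space UNIV)"
    by (subst nn_integral_fst_count_space[symmetric]) simp
  also have "\<dots> = (\<Sum>j\<in>UNIV. \<Sum>k. ennreal (q i j k))"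
    by (simp add: nn_integral_count_space_finite nn_integral_count_space_nat)
  also have "\<dots> = (\<Sum>j\<in>UNIV. ennreal (\<Sum>k. q i j k))"
    using q by (intro sum.cong refl suminf_ennreal2) auto
  also have "\<dots> = 1"
    using q by (simp add: sum_ennreal suminf_nonneg)
  finally have "pmf (step_pmf q i) (j, k) = (case (j, k) of (j, k) \<Rightarrow> q i j k)"
    unfolding step_pmf_def using q(1) by (intro pmf_embed_pmf) auto
  then show ?thesis by simp
qed

lemma step_pmf_pos:
  assumes "semi_markov_kernel q" "s \<in> set_pmf (step_pmf q i)"
  shows "1 \<le> snd s"
proof -
  have "pmf (step_pmf q i) s \<noteq> 0" using assms(2) by (simp add: set_pmf_iff)
  then have "q i (fst s) (snd s) \<noteq> 0" by (cases s) (simp add: pmf_step_pmf[OF assms(1)])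
  then show ?thesis using assms(1) by (cases "snd s") (auto simp: semi_markov_kernel_def)
qed

section \<open>From the process to its finite paths\<close>

primrec hist :: "(nat \<Rightarrow> 'w \<Rightarrow> 'e) \<Rightarrow> (nat \<Rightarrow> 'w \<Rightarrow> nat) \<Rightarrow> nat \<Rightarrow> 'w \<Rightarrow> ('e \<times> nat) list" where
  "hist J S 0 w = []"
| "hist J S (Suc n) w = (J (Suc n) w, sojourn S (Suc n) w) # hist J S n w"

lemma length_hist[simp]: "length (hist J S n w) = n"
  by (induction n) auto

lemma hist_nth: "1 \<le> m \<Longrightarrow> m \<le> n \<Longrightarrow> hist J S n w ! (n - m) = (J m w, sojourn S m w)"
proof (induction n)
  case (Suc n)
  then show ?case by (cases "m = Suc n") (auto simp: Suc_diff_le)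
qed simp

text \<open>Translates between lists and the coordinatewise events in the Markov property; the index
  n - m arises because the latest jump comes first.\<close>

lemma hist_eq_iff:
  "hist J S n w = h \<longleftrightarrow> length h = n \<and> (\<forall>m. 1 \<le> m \<and> m \<le> n \<longrightarrow> (J m w, sojourn S m w) = h ! (n - m))"
proof safe
  assume *: "\<forall>m. 1 \<le> m \<and> m \<le> length h \<longrightarrow> (J m w, sojourn S m w) = h ! (length h - m)" "n = length h"
  show "hist J S (length h) w = h"
  proof (rule nth_equalityI)
    fix l assume "l < length (hist J S (length h) w)"
    then have "1 \<le> length h - l" "length h - l \<le> length h" "l = length h - (length h - l)" by auto
    then show "hist J S (length h) w ! l = h ! l"
      using * hist_nth[of "length h - l" "length h" J S w] by metis
  qed simp
qed (auto simp: hist_nth)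

lemma pmf_mr_path_Cons: "pmf (mr_path Q i\<^sub>0 (Suc n)) (s # h) = pmf (mr_path Q i\<^sub>0 n) h * pmf (Q (cur i\<^sub>0 h)) s"
proof -
  have "pmf (map_pmf (\<lambda>s. s # x) (Q (cur i\<^sub>0 x))) (s # h) = indicator {h} x * pmf (Q (cur i\<^sub>0 h)) s" for x
  proof (cases "x = h")
    case True
    then show ?thesis using pmf_map_inj'[of "\<lambda>s. s # h" "Q (cur i\<^sub>0 h)" s] by (simp add: inj_def)
  next
    case False
    then show ?thesis by (subst pmf_map_outside) auto
  qed
  then show ?thesis by (simp add: pmf_bind measure_pmf_single)
qed

lemma pmf_mr_path_Nil: "pmf (mr_path Q i\<^sub>0 (Suc n)) [] = 0"
  using set_path[of "[]" Q i\<^sub>0 "Suc n"] by (auto simp: pmf_eq_0_set_pmf simp del: mr_path.simps)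

locale markov_renewal =
  fixes q :: "'e::finite \<Rightarrow> 'e \<Rightarrow> nat \<Rightarrow> real"
    and P :: "'e \<Rightarrow> 'w measure"
    and J :: "nat \<Rightarrow> 'w \<Rightarrow> 'e"
    and S :: "nat \<Rightarrow> 'w \<Rightarrow> nat"
  assumes kernel: "semi_markov_kernel q"
    and chain: "markov_renewal_chain q P J S"
begin

abbreviation "Q \<equiv> step_pmf q"

lemma prob_space_P: "prob_space (P i)"
  and J_measurable: "J n \<in> measurable (P i) (count_space UNIV)"
  and S_measurable: "S n \<in> measurable (P i) (count_space UNIV)"
  and AE_start: "AE w in P i. J 0 w = i \<and> S 0 w = 0"
  and markov: "markov_chain (P i) (\<lambda>(i, x) (j, k). q i j k) (\<lambda>n w. (J n w, sojourn S n w))"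
  using chain by (simp_all add: markov_renewal_chain_def)

lemma sojourn_measurable[measurable]: "sojourn S n \<in> measurable (P i) (count_space UNIV)"
proof -
  note [measurable] = S_measurable[of n i] S_measurable[of "n - 1" i]
  show ?thesis unfolding sojourn_def[abs_def] by measurable
qed

lemma hist_measurable[measurable]: "hist J S n \<in> measurable (P i) (count_space UNIV)"
proof (induction n)
  case (Suc n)
  note [measurable] = Suc J_measurable[of "Suc n" i]
  show ?case unfolding hist.simps by measurable
qed simp

text \<open>The Markov property speaks only about conditioning events of positive probability; for
  the others both sides vanish.\<close>

lemma hist_step:
  "measure (P i) {w \<in> space (P i). hist J S (Suc n) w = s # h} =
   measure (P i) {w \<in> space (P i). hist J S n w = h} * pmf (Q (cur i h)) s"
proof -
  interpret prob_space "P i" by (rule prob_space_P)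
  note [measurable] = J_measurable[of _ i] S_measurable[of _ i]
  define A where "A = {w \<in> space (P i). hist J S n w = h}"
  have A[measurable]: "A \<in> events" unfolding A_def by measurable
  have E: "{w \<in> space (P i). hist J S (Suc n) w = s # h} = {w \<in> A. (J (Suc n) w, sojourn S (Suc n) w) = s}"
    by (auto simp: A_def)
  show ?thesis
  proof (cases "prob A = 0")
    case True
    have "prob {w \<in> A. (J (Suc n) w, sojourn S (Suc n) w) = s} \<le> prob A"
      by (rule finite_measure_mono) auto
    then show ?thesis unfolding E using True by (simp add: A_def measure_le_0_iff)
  next
    case False
    then have "A \<noteq> {}" by auto
    then have len: "length h = n" by (auto simp: A_def)
    \<comment> \<open>The list omits time 0, so its value is filled in: the state is almost surely
      \<open>i\<close>, and \<open>sojourn S 0\<close> is 0 because 0 - 1 = 0 on the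
      naturals.\<close>
    define z where "z m = (if m = 0 then (i, 0) else h ! (n - m))" for m
    define Z where "Z m w = (J m w, sojourn S m w)" for m w
    have [measurable]: "Z m \<in> measurable (P i) (count_space UNIV)" for m
      unfolding Z_def[abs_def] by measurable
    have ae: "AE w in P i. hist J S n w = h \<longleftrightarrow> (\<forall>m\<le>n. Z m w = z m)"
      using AE_start
    proof eventually_elim
      case (elim w)
      then have "Z 0 w = z 0" by (simp add: Z_def z_def sojourn_def)
      then have "(\<forall>m\<le>n. Z m w = z m) \<longleftrightarrow> (\<forall>m. 1 \<le> m \<and> m \<le> n \<longrightarrow> Z m w = z m)"
        by (metis One_nat_def Suc_leI not_gr_zero)
      also have "\<dots> \<longleftrightarrow> hist J S n w = h"
        unfolding hist_eq_iff using len by (auto simp: Z_def z_def)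
      finally show ?case by simp
    qed
    define B where "B = {w \<in> space (P i). \<forall>m\<le>n. Z m w = z m}"
    have B[measurable]: "B \<in> events" unfolding B_def by measurable
    have AB: "prob A = prob B"
    proof (rule finite_measure_eq_AE)
      show "AE w in P i. w \<in> A \<longleftrightarrow> w \<in> B" using ae AE_space by eventually_elim (auto simp: A_def B_def)
    qed auto
    have "{w \<in> A. Z (Suc n) w = s} \<in> events" "{w \<in> B. Z (Suc n) w = s} \<in> events" by measurable
    then have AB': "prob {w \<in> A. Z (Suc n) w = s} = prob {w \<in> B. Z (Suc n) w = s}"
    proof (intro finite_measure_eq_AE)
      show "AE w in P i. w \<in> {w \<in> A. Z (Suc n) w = s} \<longleftrightarrow> w \<in> {w \<in> B. Z (Suc n) w = s}"
        using ae AE_space by eventually_elim (auto simp: A_def B_def)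
    qed auto
    have "0 < prob B" using False AB by (simp add: zero_less_measure_iff)
    then have "cond_prob (P i) (\<lambda>w. Z (Suc n) w = s) (\<lambda>w. \<forall>m\<le>n. Z m w = z m) =
       (\<lambda>(i, x) (j, k). q i j k) (z n) s"
      using markov[of i] unfolding markov_chain_def Z_def B_def by blast
    moreover have "fst (z n) = cur i h"
      using len by (cases h) (auto simp: z_def)
    ultimately have "cond_prob (P i) (\<lambda>w. Z (Suc n) w = s) (\<lambda>w. \<forall>m\<le>n. Z m w = z m) = pmf (Q (cur i h)) s"
      by (cases s; cases "z n") (simp add: pmf_step_pmf[OF kernel])
    moreover have "{w \<in> space (P i). Z (Suc n) w = s \<and> (\<forall>m\<le>n. Z m w = z m)} = {w \<in> B. Z (Suc n) w = s}"
      by (auto simp: B_def)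
    ultimately have "prob {w \<in> B. Z (Suc n) w = s} = prob B * pmf (Q (cur i h)) s"
      using \<open>0 < prob B\<close> by (simp add: cond_prob_def B_def[symmetric] field_simps)
    then show ?thesis unfolding E using AB AB' by (simp add: Z_def A_def)
  qed
qed

lemma measure_hist: "measure (P i) {w \<in> space (P i). hist J S n w = h} = pmf (mr_path Q i n) h"
proof (induction n arbitrary: h)
  case 0
  interpret prob_space "P i" by (rule prob_space_P)
  show ?case by (cases "h = []") (auto simp: prob_space)
next
  case (Suc n)
  show ?case
  proof (cases h)
    case Nil
    then show ?thesis by (simp add: pmf_mr_path_Nil del: mr_path.simps)
  next
    case (Cons s h')
    show ?thesis unfolding Cons hist_step pmf_mr_path_Cons Suc.IH ..
  qed
qed

text \<open>From here on, integrals of functions of the first n jumps are expectations under the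
  discrete path law.\<close>

lemma distr_hist: "distr (P i) (count_space UNIV) (hist J S n) = measure_pmf (mr_path Q i n)"
proof (rule measure_eqI_countable[of _ UNIV])
  interpret prob_space "P i" by (rule prob_space_P)
  fix h
  have "hist J S n -` {h} \<inter> space (P i) = {w \<in> space (P i). hist J S n w = h}" by auto
  then show "emeasure (distr (P i) (count_space UNIV) (hist J S n)) {h} = emeasure (measure_pmf (mr_path Q i n)) {h}"
    by (simp add: emeasure_distr emeasure_eq_measure measure_hist emeasure_pmf_single)
qed auto

lemma AE_hist: "(\<And>h. h \<in> set_pmf (mr_path Q i n) \<Longrightarrow> R h) \<Longrightarrow> AE w in P i. R (hist J S n w)"
  using AE_distr_iff[of "hist J S n" "P i" "count_space UNIV" R] unfolding distr_hist
  by (simp add: AE_measure_pmf_iff)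

lemma integral_hist:
  fixes f :: "('e \<times> nat) list \<Rightarrow> 'b::{banach, second_countable_topology}"
  shows "(\<integral>w. f (hist J S n w) \<partial>P i) = measure_pmf.expectation (mr_path Q i n) f"
  using integral_distr[of "hist J S n" "P i" "count_space UNIV" f] by (simp add: distr_hist)

lemma nn_integral_hist: "(\<integral>\<^sup>+w. f (hist J S n w) \<partial>P i) = (\<integral>\<^sup>+h. f h \<partial>mr_path Q i n)"
  using nn_integral_distr[of "hist J S n" "P i" "count_space UNIV" f] by (simp add: distr_hist)

text \<open>The almost sure event on which the conventions are harmless: S increases strictly from
  0, so differences are not truncated and the maximum defining \<open>num_jumps\<close> is taken
  over a finite nonempty set.\<close>

definition regular :: "'e \<Rightarrow> 'w \<Rightarrow> bool" where
  "regular i w \<longleftrightarrow> J 0 w = i \<and> S 0 w = 0 \<and> (\<forall>n. 1 \<le> sojourn S (Suc n) w)"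

lemma AE_regular: "AE w in P i. regular i w"
proof -
  have "AE w in P i. 1 \<le> sojourn S (Suc n) w" for n
  proof -
    have "AE w in P i. 1 \<le> snd (hd (hist J S (Suc n) w))"
      by (rule AE_hist) (auto dest: step_pmf_pos[OF kernel])
    then show ?thesis by simp
  qed
  then have "AE w in P i. \<forall>n. 1 \<le> sojourn S (Suc n) w" by (simp add: AE_all_countable)
  then show ?thesis using AE_start unfolding regular_def by eventually_elim auto
qed

context
  fixes i w assumes reg: "regular i w"
begin

lemma S_Suc: "S (Suc n) w = S n w + sojourn S (Suc n) w" "S n w < S (Suc n) w"
  using reg[unfolded regular_def] by (auto simp: sojourn_def dest!: spec[of _ n])

lemma S_mono: "m \<le> n \<Longrightarrow> S m w \<le> S n w"
  by (rule lift_Suc_mono_le[of "\<lambda>n. S n w"]) (simp_all add: S_Suc(2) less_imp_le)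

lemma S_ge: "n \<le> S n w"
proof (induction n)
  case (Suc n)
  then show ?case using S_Suc(2)[of n] by simp
qed simp

lemma tot_hist: "tot (hist J S n w) = S n w"
  using reg S_Suc(1) by (induction n) (auto simp: regular_def)

lemma cur_hist: "cur i (hist J S n w) = J n w"
  using reg by (cases n) (auto simp: regular_def)

lemma wt_hist: "wt M (hist J S n w) = of_bool (S n w \<le> M)"
  by (simp add: wt_def tot_hist)

text \<open>The index set of the maximum is an initial segment, by monotonicity of S. This converts
  weights evaluated along the path into comparisons with \<open>num_jumps\<close>.\<close>

lemma S_le_iff: "S n w \<le> M \<longleftrightarrow> n \<le> num_jumps S M w"
proof -
  have fin: "finite {n. S n w \<le> M}"
    by (rule finite_subset[of _ "{..M}"]) (auto intro: order_trans[OF S_ge])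
  have ne: "{n. S n w \<le> M} \<noteq> {}" using reg by (auto simp: regular_def intro: exI[of _ 0])
  have "num_jumps S M w \<in> {n. S n w \<le> M}" unfolding num_jumps_def by (rule Max_in[OF fin ne])
  then show ?thesis
    using S_mono[of n "num_jumps S M w"] Max_ge[OF fin, of n] unfolding num_jumps_def
    by (auto intro: le_trans)
qed

lemma num_jumps_le: "num_jumps S M w \<le> M"
  using S_le_iff[of "num_jumps S M w" M] S_ge[of "num_jumps S M w"] by simp

lemma asum_hist: "asum f (hist J S n w) = (\<Sum>m<n. f (hist J S m w) (J (Suc m) w, sojourn S (Suc m) w))"
  by (induction n) auto

text \<open>\<open>cnt\<close> evaluates its weight after the jump, which selects precisely the
  jumps completed by time M; as there are at most M of them, the path of \<open>Suc M\<close> jumps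
  contains them all.\<close>

lemma cnt_hist:
  "cnt M i j A (hist J S (Suc M) w) =
    (\<Sum>n=1..num_jumps S M w. of_bool (J (n - 1) w = j \<and> (J n w, sojourn S n w) \<in> A))"
proof -
  have wt: "wt M ((J (Suc m) w, sojourn S (Suc m) w) # hist J S m w) = of_bool (Suc m \<le> num_jumps S M w)" for m
    using wt_hist[of M "Suc m"] S_le_iff[of "Suc m" M] by simp
  have "cnt M i j A (hist J S (Suc M) w) =
      (\<Sum>m<Suc M. of_bool (Suc m \<le> num_jumps S M w) * of_bool (J m w = j \<and> (J (Suc m) w, sojourn S (Suc m) w) \<in> A))"
    unfolding cnt_def asum_hist wt cur_hist ..
  also have "\<dots> = (\<Sum>m<num_jumps S M w. of_bool (J m w = j \<and> (J (Suc m) w, sojourn S (Suc m) w) \<in> A))"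
    using num_jumps_le[of M] by (intro sum.mono_neutral_cong_right) auto
  also have "\<dots> = (\<Sum>n=1..num_jumps S M w. of_bool (J (n - 1) w = j \<and> (J n w, sojourn S n w) \<in> A))"
    by (rule sum.reindex_bij_witness[of _ "\<lambda>n. n - 1" Suc]) auto
  finally show ?thesis .
qed

lemma q_hat_hist:
  "q_hat J S M w j l k = cnt M i j {(l, k)} (hist J S (Suc M) w) / cnt M i j UNIV (hist J S (Suc M) w)"
  unfolding cnt_hist q_hat_def num_visits_def by simp

end

end

section \<open>Mean return times and the asymptotic law\<close>

text \<open>Transition operator of the embedded chain killed on entering \<open>i\<close>. Values in
  \<open>ennreal\<close> allow expectations to be formed before they are known to be finite.\<close>

definition taboo :: "('e \<Rightarrow> ('e \<times> nat) pmf) \<Rightarrow> 'e \<Rightarrow> ('e \<Rightarrow> ennreal) \<Rightarrow> 'e \<Rightarrow> ennreal" where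
  "taboo Q i f j = (\<integral>\<^sup>+s. of_bool (fst s \<noteq> i) * f (fst s) \<partial>Q j)"

definition mean_sojourn :: "('e \<Rightarrow> ('e \<times> nat) pmf) \<Rightarrow> 'e \<Rightarrow> ennreal" where
  "mean_sojourn Q j = (\<integral>\<^sup>+s. ennreal (real (snd s)) \<partial>Q j)"

text \<open>\<open>mean_hit Q i j\<close> is the mean of \<open>S\<close> at the first visit to \<open>i\<close> when the chain starts in \<open>j\<close>; for
  \<open>j = i\<close> it is \<open>\<mu>\<^sub>i\<^sub>i\<close>.\<close>

definition mean_hit :: "('e \<Rightarrow> ('e \<times> nat) pmf) \<Rightarrow> 'e \<Rightarrow> 'e \<Rightarrow> ennreal" where
  "mean_hit Q i j = (\<Sum>n. (taboo Q i ^^ n) (mean_sojourn Q) j)"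

text \<open>The list contains only states entered, not the initial one, so starting in
  \<open>i\<close> itself is allowed and describes an excursion from \<open>i\<close>.\<close>

lemma nn_integral_taboo_path:
  "(\<integral>\<^sup>+h. of_bool (i \<notin> fst ` set h) * f (cur i\<^sub>0 h) \<partial>mr_path Q i\<^sub>0 n) = (taboo Q i ^^ n) f i\<^sub>0"
proof (induction n arbitrary: f)
  case (Suc n)
  have "(\<integral>\<^sup>+h. of_bool (i \<notin> fst ` set h) * f (cur i\<^sub>0 h) \<partial>mr_path Q i\<^sub>0 (Suc n)) =
    (\<integral>\<^sup>+h. (\<integral>\<^sup>+s. of_bool (i \<notin> fst ` set h) * (of_bool (fst s \<noteq> i) * f (fst s)) \<partial>Q (cur i\<^sub>0 h)) \<partial>mr_path Q i\<^sub>0 n)"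
    by (simp, intro nn_integral_cong) auto
  also have "\<dots> = (\<integral>\<^sup>+h. of_bool (i \<notin> fst ` set h) * taboo Q i f (cur i\<^sub>0 h) \<partial>mr_path Q i\<^sub>0 n)"
    by (subst nn_integral_cmult) (simp_all add: taboo_def)
  also have "\<dots> = (taboo Q i ^^ Suc n) f i\<^sub>0"
    unfolding Suc.IH by (simp add: funpow_Suc_right del: funpow.simps)
  finally show ?case .
qed simp

text \<open>First-step analysis: the term n = 0 is split off, and the rest is the operator applied
  to the whole series.\<close>

lemma mean_hit_unfold: "mean_hit Q i j = mean_sojourn Q j + taboo Q i (mean_hit Q i) j"
proof -
  have "mean_hit Q i j = (\<Sum>n. (taboo Q i ^^ (n + 1)) (mean_sojourn Q) j) + (\<Sum>n<1. (taboo Q i ^^ n) (mean_sojourn Q) j)"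
    unfolding mean_hit_def by (rule suminf_offset) (rule summableI)
  also have "(\<Sum>n. (taboo Q i ^^ (n + 1)) (mean_sojourn Q) j) = taboo Q i (mean_hit Q i) j"
  proof -
    have iter: "(taboo Q i ^^ (n + 1)) (mean_sojourn Q) j =
        (\<integral>\<^sup>+s. of_bool (fst s \<noteq> i) * (taboo Q i ^^ n) (mean_sojourn Q) (fst s) \<partial>Q j)" for n
      by (simp add: taboo_def)
    have "(\<Sum>n. (taboo Q i ^^ (n + 1)) (mean_sojourn Q) j) =
        (\<integral>\<^sup>+s. (\<Sum>n. of_bool (fst s \<noteq> i) * (taboo Q i ^^ n) (mean_sojourn Q) (fst s)) \<partial>Q j)"
      unfolding iter by (rule nn_integral_suminf[symmetric]) simp
    then show ?thesis by (simp add: taboo_def mean_hit_def)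
  qed
  finally show ?thesis by (simp add: add.commute)
qed

text \<open>First-step analysis rearranged: \<phi> is the mean hitting time set to 0 at
  \<open>i\<close>, so the value lost there, the mean return time, becomes the source term. Mean
  sojourn times are finite as summands of finite mean hitting times.\<close>

lemma poisson_equation:
  assumes fin: "\<And>j. mean_hit Q i j < \<infinity>"
  defines "\<phi> \<equiv> \<lambda>j. enn2real (mean_hit Q i j) * of_bool (j \<noteq> i)"
  shows "integrable (Q j) (\<lambda>s. real (snd s))"
    and "measure_pmf.expectation (Q j) (\<lambda>s. real (snd s) + \<phi> (fst s)) =
      enn2real (mean_hit Q i i) * of_bool (j = i) + \<phi> j"
proof -
  have ms: "mean_sojourn Q j < \<infinity>"
    using fin[of j] unfolding mean_hit_unfold[of Q i j] by (auto simp: less_top)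
  then show "integrable (Q j) (\<lambda>s. real (snd s))"
    by (intro integrableI_nonneg) (auto simp: mean_sojourn_def)
  have \<phi>: "0 \<le> \<phi> j" "ennreal (\<phi> j) = of_bool (j \<noteq> i) * mean_hit Q i j" for j
    using fin[of j] by (auto simp: \<phi>_def less_top)
  have "measure_pmf.expectation (Q j) (\<lambda>s. real (snd s) + \<phi> (fst s)) =
      enn2real (\<integral>\<^sup>+s. ennreal (real (snd s) + \<phi> (fst s)) \<partial>Q j)"
    using \<phi> by (intro integral_eq_nn_integral) auto
  also have "(\<integral>\<^sup>+s. ennreal (real (snd s) + \<phi> (fst s)) \<partial>Q j) =
      (\<integral>\<^sup>+s. ennreal (real (snd s)) + of_bool (fst s \<noteq> i) * mean_hit Q i (fst s) \<partial>Q j)"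
    using \<phi> by (simp add: ennreal_plus)
  also have "\<dots> = mean_hit Q i j"
    by (subst nn_integral_add) (simp_all add: mean_hit_unfold[of Q i j] mean_sojourn_def taboo_def)
  finally show "measure_pmf.expectation (Q j) (\<lambda>s. real (snd s) + \<phi> (fst s)) =
      enn2real (mean_hit Q i i) * of_bool (j = i) + \<phi> j"
    by (auto simp: \<phi>_def)
qed

text \<open>A finite expectation over the next state forces a finite value at every atom, so
  finiteness spreads along possible transitions.\<close>

lemma mean_hit_finite_step:
  assumes "mean_hit Q i i < \<infinity>" "mean_hit Q i j < \<infinity>" "s \<in> set_pmf (Q j)"
  shows "mean_hit Q i (fst s) < \<infinity>"
proof (cases "fst s = i")
  case False
  have "taboo Q i (mean_hit Q i) j \<noteq> \<infinity>"
    using assms(2) unfolding mean_hit_unfold[of Q i j] by auto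
  then have "AE s in Q j. of_bool (fst s \<noteq> i) * mean_hit Q i (fst s) \<noteq> \<infinity>"
    unfolding taboo_def by (intro nn_integral_PInf_AE) auto
  then show ?thesis using assms(3) False by (auto simp: AE_measure_pmf_iff less_top)
qed (use assms in simp)

lemma mean_hit_finite_path:
  assumes "mean_hit Q i i < \<infinity>"
  shows "h \<in> set_pmf (mr_path Q i n) \<Longrightarrow> mean_hit Q i (cur i h) < \<infinity>"
proof (induction n arbitrary: h)
  case (Suc n)
  then obtain x s where "x \<in> set_pmf (mr_path Q i n)" "s \<in> set_pmf (Q (cur i x))" "h = s # x" by auto
  then show ?case using mean_hit_finite_step[OF assms Suc.IH] by simp
qed (use assms in simp)

context markov_renewal
begin

text \<open>Convergence in distribution demands measurability on the whole space, so outcomes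
  outside the regular event must be treated too.\<close>

lemma num_jumps_measurable: "num_jumps S M \<in> measurable (P i) (count_space UNIV)"
proof -
  note [measurable] = S_measurable[of _ i]
  have fin: "finite {n. S n w \<le> M} \<longleftrightarrow> (\<exists>N. \<forall>n. N \<le> n \<longrightarrow> \<not> S n w \<le> M)" for w
    unfolding finite_nat_set_iff_bounded mem_Collect_eq Ball_def by (intro iff_exI) (use not_le in blast)
  \<comment> \<open>Countable quantifiers describe the maximum; \<open>Max {}\<close> and
    \<open>the None\<close> are its fixed values on empty and on infinite sets.\<close>
  have "num_jumps S M w = v \<longleftrightarrow>
     (if \<exists>N. \<forall>n. N \<le> n \<longrightarrow> \<not> S n w \<le> M
      then if \<exists>n. S n w \<le> M then S v w \<le> M \<and> (\<forall>n. v < n \<longrightarrow> \<not> S n w \<le> M) else v = Max {}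
      else v = the None)" for w v
  proof (cases "finite {n. S n w \<le> M}")
    case True
    show ?thesis
    proof (cases "\<exists>n. S n w \<le> M")
      case ne: True
      then have "num_jumps S M w = v \<longleftrightarrow> S v w \<le> M \<and> (\<forall>n. S n w \<le> M \<longrightarrow> n \<le> v)"
        unfolding num_jumps_def using Max_eq_iff[OF True] by auto
      then show ?thesis using True ne fin[of w] by (auto simp: not_le[symmetric])
    next
      case False
      then show ?thesis using True fin[of w] by (auto simp: num_jumps_def)
    qed
  next
    case False
    then show ?thesis using fin[of w] Max.infinite[OF False] by (auto simp: num_jumps_def)
  qed
  then have "{w \<in> space (P i). num_jumps S M w = v} \<in> sets (P i)" for v
    by simp
  then show ?thesis
    by (intro measurable_count_space_eq2_countable[THEN iffD2]) (auto simp: vimage_def Int_def conj_commute)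
qed

lemma q_hat_measurable: "(\<lambda>w. q_hat J S M w j l k) \<in> borel_measurable (P i)"
proof -
  note [measurable] = J_measurable[of _ i]
  have sum: "(\<lambda>w. \<Sum>n=1..num_jumps S M w. f n w) \<in> borel_measurable (P i)"
    if [measurable]: "\<And>n. f n \<in> borel_measurable (P i)" for f :: "nat \<Rightarrow> 'w \<Rightarrow> real"
    by (rule measurable_compose_countable[OF _ num_jumps_measurable]) measurable
  have eq: "q_hat J S M w j l k =
     1 / (\<Sum>n=1..num_jumps S M w. of_bool (J (n - 1) w = j)) *
     (\<Sum>n=1..num_jumps S M w. of_bool (J (n - 1) w = j \<and> J n w = l \<and> sojourn S n w = k))" for w
    by (simp add: q_hat_def num_visits_def)
  have 1: "(\<lambda>w. \<Sum>n=1..num_jumps S M w. of_bool (J (n - 1) w = j) :: real) \<in> borel_measurable (P i)"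
    by (rule sum) measurable
  have 2: "(\<lambda>w. \<Sum>n=1..num_jumps S M w. of_bool (J (n - 1) w = j \<and> J n w = l \<and> sojourn S n w = k) :: real) \<in> borel_measurable (P i)"
    by (rule sum) measurable
  show ?thesis
    unfolding eq by (intro borel_measurable_times borel_measurable_divide borel_measurable_const 1 2)
qed

lemma not_visited_hist: "i \<notin> fst ` set (hist J S n w) \<longleftrightarrow> (\<forall>m. 1 \<le> m \<and> m \<le> n \<longrightarrow> J m w \<noteq> i)"
  by (induction n) (auto simp: le_Suc_eq)

text \<open>The sojourn n + 1 counts as long as \<open>i\<close> has not been entered by time n. If
  it never is, each sojourn contributes at least 1 and the series diverges, in agreement with the
  value \<infinity>.\<close>

lemma S_at_hit_eq_suminf:
  assumes reg: "regular i w"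
  shows "ennreal_of_enat (S_at_hit J S i w) =
    (\<Sum>n. of_bool (i \<notin> fst ` set (hist J S n w)) * ennreal (real (sojourn S (Suc n) w)))"
proof (cases "\<exists>n\<ge>1. J n w = i")
  case True
  define N where "N = (LEAST n. 1 \<le> n \<and> J n w = i)"
  have N: "1 \<le> N" "J N w = i" using LeastI_ex[OF True[simplified]] by (auto simp: N_def)
  have N_le: "N \<le> n" if "1 \<le> n" "J n w = i" for n unfolding N_def using that by (intro Least_le) auto
  have "hit_time J i w = enat N"
    unfolding hit_time_def
    by (intro antisym Inf_lower Inf_greatest) (use N N_le in auto)
  then have lhs: "ennreal_of_enat (S_at_hit J S i w) = ennreal (real (S N w))"
    by (simp add: S_at_hit_def ennreal_of_nat_eq_real_of_nat)
  have vis: "i \<notin> fst ` set (hist J S n w) \<longleftrightarrow> n < N" for n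
    unfolding not_visited_hist using N N_le by (metis le_less_linear less_le_trans not_le)
  have "(\<Sum>n. of_bool (i \<notin> fst ` set (hist J S n w)) * ennreal (real (sojourn S (Suc n) w))) =
      (\<Sum>n<N. ennreal (real (sojourn S (Suc n) w)))"
    unfolding vis by (subst suminf_finite[of "{..<N}"]) auto
  also have "\<dots> = ennreal (real (S N w))"
  proof -
    have "real (S n w) = (\<Sum>m<n. real (sojourn S (Suc m) w))" for n
      using reg S_Suc(1)[OF reg] by (induction n) (auto simp: regular_def)
    then show ?thesis by simp
  qed
  finally show ?thesis using lhs by simp
next
  case False
  then have "{enat n | n. 1 \<le> n \<and> J n w = i} = {}" by auto
  then have "hit_time J i w = \<infinity>" unfolding hit_time_def by (simp add: Inf_enat_def)
  then have lhs: "ennreal_of_enat (S_at_hit J S i w) = \<infinity>" by (simp add: S_at_hit_def)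
  have vis: "i \<notin> fst ` set (hist J S n w)" for n
    using False by (auto simp: not_visited_hist)
  have "of_nat N \<le> (\<Sum>n. ennreal (real (sojourn S (Suc n) w)))" for N
  proof -
    have "(of_nat N :: ennreal) = (\<Sum>n<N. 1)" by simp
    also have "\<dots> \<le> (\<Sum>n<N. ennreal (real (sojourn S (Suc n) w)))"
      using reg by (intro sum_mono) (auto simp: regular_def one_ennreal_def[symmetric] ennreal_1[symmetric] simp del: ennreal_1 intro!: ennreal_leI)
    also have "\<dots> \<le> (\<Sum>n. ennreal (real (sojourn S (Suc n) w)))" by (rule sum_le_suminf) auto
    finally show ?thesis .
  qed
  then have "(SUP N. of_nat N :: ennreal) \<le> (\<Sum>n. ennreal (real (sojourn S (Suc n) w)))"
    by (intro SUP_least)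
  then have "(\<Sum>n. ennreal (real (sojourn S (Suc n) w))) = \<infinity>"
    unfolding ennreal_SUP_of_nat_eq_top infinity_ennreal_def by (rule top_le)
  then show ?thesis using lhs vis by simp
qed

text \<open>Termwise integration of the nonnegative series, followed by averaging the latest sojourn
  time, found at the head of the list, given its tail.\<close>

lemma mean_return_eq_mean_hit: "mean_return P J S i = mean_hit Q i i"
proof -
  define g where "g h = of_bool (i \<notin> fst ` set (tl h)) * ennreal (real (snd (hd h)))" for h :: "('e \<times> nat) list"
  have gm: "(\<lambda>w. g (hist J S n w)) \<in> borel_measurable (P i)" for n
    by (rule measurable_compose[OF hist_measurable]) simp
  have "mean_return P J S i = (\<integral>\<^sup>+w. (\<Sum>n. g (hist J S (Suc n) w)) \<partial>P i)"
    unfolding mean_return_def using AE_regular[of i]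
    by (intro nn_integral_cong_AE) (auto simp: g_def S_at_hit_eq_suminf elim!: eventually_mono)
  also have "\<dots> = (\<Sum>n. \<integral>\<^sup>+w. g (hist J S (Suc n) w) \<partial>P i)"
    by (rule nn_integral_suminf) (rule gm)
  also have "\<dots> = (\<Sum>n. (taboo Q i ^^ n) (mean_sojourn Q) i)"
  proof -
    have "(\<integral>\<^sup>+w. g (hist J S (Suc n) w) \<partial>P i) = (taboo Q i ^^ n) (mean_sojourn Q) i" for n
    proof -
      have "(\<integral>\<^sup>+w. g (hist J S (Suc n) w) \<partial>P i) =
         (\<integral>\<^sup>+h. (\<integral>\<^sup>+s. of_bool (i \<notin> fst ` set h) * ennreal (real (snd s)) \<partial>Q (cur i h)) \<partial>mr_path Q i n)"
        unfolding nn_integral_hist by (simp add: g_def)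
      also have "\<dots> = (\<integral>\<^sup>+h. of_bool (i \<notin> fst ` set h) * mean_sojourn Q (cur i h) \<partial>mr_path Q i n)"
        by (subst nn_integral_cmult) (simp_all add: mean_sojourn_def)
      finally show ?thesis by (simp add: nn_integral_taboo_path)
    qed
    then show ?thesis by (simp del: hist.simps)
  qed
  finally show ?thesis by (simp add: mean_hit_def)
qed

lemma mean_return_ge_1: "1 \<le> mean_return P J S i"
proof -
  have "1 = (\<integral>\<^sup>+s. 1 \<partial>Q i)" by simp
  also have "\<dots> \<le> mean_sojourn Q i"
    unfolding mean_sojourn_def
    by (rule nn_integral_mono_AE)
       (auto simp: AE_measure_pmf_iff dest!: step_pmf_pos[OF kernel] simp flip: ennreal_1 simp del: ennreal_1 intro!: ennreal_leI)
  also have "\<dots> \<le> mean_hit Q i i" unfolding mean_hit_unfold[of Q i i] by simp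
  finally show ?thesis by (simp add: mean_return_eq_mean_hit)
qed

text \<open>A state of infinite mean hitting time would almost surely never be entered from
  \<open>i\<close>, where the mean is finite; irreducibility excludes this.\<close>

lemma mean_hit_finite:
  assumes "irreducible_chain P J" "mean_return P J S i < \<infinity>"
  shows "mean_hit Q i j < \<infinity>"
proof (rule ccontr)
  assume j: "\<not> mean_hit Q i j < \<infinity>"
  have i: "mean_hit Q i i < \<infinity>" using assms(2) by (simp add: mean_return_eq_mean_hit)
  have "AE w in P i. mean_hit Q i (cur i (hist J S n w)) < \<infinity>" for n
    by (rule AE_hist) (rule mean_hit_finite_path[OF i])
  then have "AE w in P i. \<forall>n. mean_hit Q i (cur i (hist J S n w)) < \<infinity>" by (simp add: AE_all_countable)
  then have "AE w in P i. \<not> hit_time J j w < \<infinity>"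
    using AE_regular[of i]
  proof eventually_elim
    case (elim w)
    then have "J n w \<noteq> j" for n using j cur_hist[OF elim(2)] by metis
    then have "{enat n | n. 1 \<le> n \<and> J n w = j} = {}" by auto
    then show ?case unfolding hit_time_def by (simp add: Inf_enat_def)
  qed
  then have ae: "AE w in P i. w \<notin> {w \<in> space (P i). hit_time J j w < \<infinity>}" by eventually_elim auto
  have "measure (P i) {w \<in> space (P i). hit_time J j w < \<infinity>} = 0"
  \<comment> \<open>Spares a measurability proof: a set outside the sigma-algebra has measure 0 by
    convention.\<close>
  proof (cases "{w \<in> space (P i). hit_time J j w < \<infinity>} \<in> sets (P i)")
    case True
    then have "{w \<in> space (P i). hit_time J j w < \<infinity>} \<in> null_sets (P i)"
      using ae by (subst AE_iff_null_sets)
    then show ?thesis by (simp add: measure_eq_0_null_sets)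
  qed (rule measure_notin_sets)
  then show False
    using assms(1)[unfolded irreducible_chain_def, rule_format, of i j] by simp
qed

section \<open>Linear forms of the estimation error\<close>

definition err_form :: "('e \<times> 'e \<times> nat) set \<Rightarrow> ('e \<times> 'e \<times> nat \<Rightarrow> real) \<Rightarrow> 'e \<Rightarrow> nat \<Rightarrow> ('e \<times> nat) list \<Rightarrow> real" where
  "err_form F c i\<^sub>0 M h = (\<Sum>e\<in>F. c e * (sqrt (real M) *
     (cnt M i\<^sub>0 (fst e) {snd e} h / cnt M i\<^sub>0 (fst e) UNIV h - pmf (Q (fst e)) (snd e))))"

text \<open>The contribution of a jump out of \<open>i\<close> to the numerators of the linear form:
  indicators centred at their conditional probabilities.\<close>

definition score :: "('e \<times> 'e \<times> nat) set \<Rightarrow> ('e \<times> 'e \<times> nat \<Rightarrow> real) \<Rightarrow> 'e \<Rightarrow> 'e \<times> nat \<Rightarrow> real" where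
  "score F c i s = (\<Sum>e\<in>F. c e * (of_bool (fst e = i) * (of_bool (s = snd e) - pmf (Q i) (snd e))))"

lemma err_form_hist:
  assumes "regular i\<^sub>0 w"
  shows "(\<Sum>e\<in>F. c e * (case e of (i, j, k) \<Rightarrow> sqrt (real M) * (q_hat J S M w i j k - q i j k))) =
    err_form F c i\<^sub>0 M (hist J S (Suc M) w)"
  unfolding err_form_def
  by (intro sum.cong refl)
     (auto simp: q_hat_hist[OF assms] pmf_step_pmf[OF kernel] simp del: hist.simps)

text \<open>Subtracting pmf times the number of visits in the numerator amounts to subtracting pmf
  from the ratio. This requires a positive count: division by zero would give 0 on the right but
  leave the subtracted pmf on the left.\<close>

lemma err_form_eq_score_sums:
  assumes pos: "\<And>i. 0 < cnt M i\<^sub>0 i UNIV h"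
  shows "err_form F c i\<^sub>0 M h = (\<Sum>i\<in>UNIV. sqrt (real M) *
    (asum (\<lambda>h s. wt M (s # h) * (of_bool (cur i\<^sub>0 h = i) * score F c i s)) h / cnt M i\<^sub>0 i UNIV h))"
proof -
  have sums: "asum (\<lambda>h s. wt M (s # h) * (of_bool (cur i\<^sub>0 h = i) * score F c i s)) h =
      (\<Sum>e\<in>F. (c e * of_bool (fst e = i)) * (cnt M i\<^sub>0 i {snd e} h + (- pmf (Q i) (snd e)) * cnt M i\<^sub>0 i UNIV h))" for i
  proof -
    have "wt M (s # h) * (of_bool (cur i\<^sub>0 h = i) * score F c i s) =
        (\<Sum>e\<in>F. (c e * of_bool (fst e = i)) * (wt M (s # h) * of_bool (cur i\<^sub>0 h = i \<and> s \<in> {snd e}) +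
          (- pmf (Q i) (snd e)) * (wt M (s # h) * of_bool (cur i\<^sub>0 h = i \<and> s \<in> UNIV))))" for h s
      unfolding score_def sum_distrib_left by (intro sum.cong) (auto simp: algebra_simps)
    then show ?thesis unfolding cnt_def by (simp only: asum_sum asum_cmult asum_add)
  qed
  have "sqrt (real M) * (asum (\<lambda>h s. wt M (s # h) * (of_bool (cur i\<^sub>0 h = i) * score F c i s)) h / cnt M i\<^sub>0 i UNIV h) =
      (\<Sum>e\<in>F. of_bool (fst e = i) * (c e * (sqrt (real M) *
        (cnt M i\<^sub>0 i {snd e} h / cnt M i\<^sub>0 i UNIV h - pmf (Q i) (snd e)))))" for i
  proof -
    have "(C + (- p) * cnt M i\<^sub>0 i UNIV h) / cnt M i\<^sub>0 i UNIV h = C / cnt M i\<^sub>0 i UNIV h - p" for C p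
      using pos[of i] by (simp add: field_simps)
    then show ?thesis
      unfolding sums sum_divide_distrib sum_distrib_left
      by (intro sum.cong refl) (simp add: mult_ac flip: times_divide_eq_right)
  qed
  then have "(\<Sum>i\<in>UNIV. sqrt (real M) *
    (asum (\<lambda>h s. wt M (s # h) * (of_bool (cur i\<^sub>0 h = i) * score F c i s)) h / cnt M i\<^sub>0 i UNIV h)) =
    (\<Sum>i\<in>UNIV. \<Sum>e\<in>F. of_bool (fst e = i) * (c e * (sqrt (real M) *
      (cnt M i\<^sub>0 i {snd e} h / cnt M i\<^sub>0 i UNIV h - pmf (Q i) (snd e)))))"
    by simp
  also have "\<dots> = err_form F c i\<^sub>0 M h"
    unfolding err_form_def by (subst sum.swap) (simp add: of_bool_def if_distrib if_distribR sum.delta cong: if_cong)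
  finally show ?thesis by simp
qed

lemma score_bound: "\<bar>score F c i s\<bar> \<le> (\<Sum>e\<in>F. \<bar>c e\<bar>)"
proof -
  have "\<bar>c e * (of_bool (fst e = i) * (of_bool (s = snd e) - pmf (Q i) (snd e)))\<bar> \<le> \<bar>c e\<bar>" for e
  proof -
    have "\<bar>of_bool (fst e = i) * (of_bool (s = snd e) - pmf (Q i) (snd e))\<bar> \<le> 1"
      using pmf_le_1[of "Q i" "snd e"] pmf_nonneg[of "Q i" "snd e"] by (auto simp: of_bool_def)
    then show ?thesis by (simp add: abs_mult mult_left_le)
  qed
  then show ?thesis
    unfolding score_def by (intro order_trans[OF sum_abs sum_mono])
qed

lemma expectation_of_bool_eq: "measure_pmf.expectation p (\<lambda>s. of_bool (s = x)) = pmf p x"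
proof -
  have "(\<lambda>s. of_bool (s = x)) = (indicator {x} :: _ \<Rightarrow> real)" by (auto simp: fun_eq_iff)
  then show ?thesis by (simp add: measure_pmf_single)
qed

lemma integrable_of_bool_eq: "integrable (measure_pmf p) (\<lambda>s. of_bool (R s) :: real)"
  by (rule measure_pmf.integrable_const_bound[of _ 1]) auto

lemma score_mean: "measure_pmf.expectation (Q i) (score F c i) = 0"
  unfolding score_def[abs_def]
  by (subst Bochner_Integration.integral_sum)
     (auto simp: integrable_of_bool_eq expectation_of_bool_eq)

lemma score_variance:
  "measure_pmf.expectation (Q i) (\<lambda>s. (score F c i s)\<^sup>2) =
   (\<Sum>e\<in>F. \<Sum>e'\<in>F. c e * c e' * (of_bool (fst e = i \<and> fst e' = i) *
      (pmf (Q i) (snd e) * (of_bool (snd e = snd e') - pmf (Q i) (snd e')))))"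
proof -
  have cov: "measure_pmf.expectation (Q i) (\<lambda>s. (of_bool (s = x) - pmf (Q i) x) * (of_bool (s = y) - pmf (Q i) y)) =
      pmf (Q i) x * (of_bool (x = y) - pmf (Q i) y)" for x y
  proof -
    have "(of_bool (s = x) - pmf (Q i) x) * (of_bool (s = y) - pmf (Q i) y) =
        of_bool (x = y) * of_bool (s = x) - pmf (Q i) y * of_bool (s = x) - pmf (Q i) x * of_bool (s = y) + pmf (Q i) x * pmf (Q i) y" for s
      by (auto simp: algebra_simps)
    then have "measure_pmf.expectation (Q i) (\<lambda>s. (of_bool (s = x) - pmf (Q i) x) * (of_bool (s = y) - pmf (Q i) y)) =
        of_bool (x = y) * pmf (Q i) x - pmf (Q i) y * pmf (Q i) x - pmf (Q i) x * pmf (Q i) y + pmf (Q i) x * pmf (Q i) y"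
      by (simp add: integrable_of_bool_eq expectation_of_bool_eq)
    then show ?thesis by (simp add: algebra_simps)
  qed
  have int: "integrable (Q i) (\<lambda>s. (of_bool (s = x) - pmf (Q i) x) * (of_bool (s = y) - pmf (Q i) y))" for x y
  proof (rule measure_pmf.integrable_const_bound[of _ 1])
    have le: "\<bar>of_bool (s = x) - pmf (Q i) x\<bar> \<le> 1" for s x
      using pmf_le_1[of "Q i" x] pmf_nonneg[of "Q i" x] by (auto simp: of_bool_def)
    show "AE s in Q i. norm ((of_bool (s = x) - pmf (Q i) x) * (of_bool (s = y) - pmf (Q i) y)) \<le> 1"
      using mult_mono[OF le[of _ x] le[of _ y]] by (simp add: abs_mult)
  qed simp
  have "(score F c i s)\<^sup>2 = (\<Sum>e\<in>F. \<Sum>e'\<in>F. (c e * c e' * of_bool (fst e = i \<and> fst e' = i)) *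
      ((of_bool (s = snd e) - pmf (Q i) (snd e)) * (of_bool (s = snd e') - pmf (Q i) (snd e'))))" for s
    unfolding score_def power2_eq_square sum_product by (intro sum.cong refl) (auto simp: mult_ac)
  then show ?thesis
    using int by (simp add: Bochner_Integration.integral_sum cov mult.assoc)
qed

lemma asymp_var_eq:
  "asymp_var q \<mu> = (\<lambda>(i, s) (i', s'). \<mu> i * of_bool (i = i') * pmf (Q i) s * (of_bool (s = s') - pmf (Q i') s'))"
  by (auto simp: asymp_var_def fun_eq_iff pmf_step_pmf[OF kernel])

text \<open>Only pairs with a common source state survive, and the sum over \<open>i\<close>
  collapses to that state.\<close>

lemma score_variance_sum:
  "(\<Sum>i\<in>UNIV. \<mu> i * measure_pmf.expectation (Q i) (\<lambda>s. (score F c i s)\<^sup>2)) =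
    (\<Sum>e\<in>F. \<Sum>e'\<in>F. c e * c e' * asymp_var q \<mu> e e')"
proof -
  have "(\<Sum>i\<in>UNIV. \<mu> i * measure_pmf.expectation (Q i) (\<lambda>s. (score F c i s)\<^sup>2)) =
     (\<Sum>i\<in>UNIV. \<Sum>e\<in>F. \<Sum>e'\<in>F. \<mu> i * (c e * c e' * (of_bool (fst e = i \<and> fst e' = i) *
      (pmf (Q i) (snd e) * (of_bool (snd e = snd e') - pmf (Q i) (snd e'))))))"
    by (simp only: score_variance sum_distrib_left)
  also have "\<dots> = (\<Sum>e\<in>F. \<Sum>e'\<in>F. \<Sum>i\<in>UNIV. \<mu> i * (c e * c e' * (of_bool (fst e = i \<and> fst e' = i) *
      (pmf (Q i) (snd e) * (of_bool (snd e = snd e') - pmf (Q i) (snd e'))))))"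
    by (subst sum.swap, intro sum.cong refl, subst sum.swap, rule refl)
  also have "\<dots> = (\<Sum>e\<in>F. \<Sum>e'\<in>F. c e * c e' * asymp_var q \<mu> e e')"
  proof (intro sum.cong refl)
    fix e e'
    have "(\<Sum>i\<in>UNIV. \<mu> i * (c e * c e' * (of_bool (fst e = i \<and> fst e' = i) *
      (pmf (Q i) (snd e) * (of_bool (snd e = snd e') - pmf (Q i) (snd e')))))) =
      (\<Sum>i\<in>{fst e}. \<mu> i * (c e * c e' * (of_bool (fst e = i \<and> fst e' = i) *
      (pmf (Q i) (snd e) * (of_bool (snd e = snd e') - pmf (Q i) (snd e'))))))"
      by (rule sum.mono_neutral_right) auto
    also have "\<dots> = c e * c e' * asymp_var q \<mu> e e'"
      by (auto simp: asymp_var_eq split: prod.splits)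
    finally show "(\<Sum>i\<in>UNIV. \<mu> i * (c e * c e' * (of_bool (fst e = i \<and> fst e' = i) *
      (pmf (Q i) (snd e) * (of_bool (snd e = snd e') - pmf (Q i) (snd e')))))) = c e * c e' * asymp_var q \<mu> e e'" .
  qed
  finally show ?thesis .
qed

lemma estimator_char_tendsto:
  assumes A1: "irreducible_chain P J" and A3: "positive_recurrent_chain P J S"
  shows "(\<lambda>M. \<integral>w. iexp (\<Sum>e\<in>F. c e * (case e of (i, j, k) \<Rightarrow> sqrt (real M) * (q_hat J S M w i j k - q i j k))) \<partial>P i\<^sub>0)
    \<longlonglongrightarrow> exp (- (\<Sum>e\<in>F. \<Sum>e'\<in>F. c e * c e' * asymp_var q (\<lambda>i. enn2real (mean_return P J S i)) e e') / 2)"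
proof -
  define \<mu> where "\<mu> i = enn2real (mean_return P J S i)" for i
  have ret: "mean_return P J S i < \<infinity>" for i using A3 by (simp add: positive_recurrent_chain_def)
  have \<mu>: "0 < \<mu> i" for i
    using ret[of i] mean_return_ge_1[of i] by (auto simp: \<mu>_def enn2real_positive_iff intro: less_le_trans[OF zero_less_one])
  have fin: "mean_hit Q i j < \<infinity>" for i j by (rule mean_hit_finite[OF A1 ret])
  have poisson: "measure_pmf.expectation (Q j) (\<lambda>s. real (snd s) + enn2real (mean_hit Q i (fst s)) * of_bool (fst s \<noteq> i)) =
      \<mu> i * of_bool (j = i) + enn2real (mean_hit Q i j) * of_bool (j \<noteq> i)" for i j
    using poisson_equation(2)[of Q i j, OF fin] by (simp add: \<mu>_def mean_return_eq_mean_hit)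
  have lln: "(\<lambda>M. measure_pmf.expectation (mr_path Q i\<^sub>0 (Suc M)) (\<lambda>h. \<bar>visits M i\<^sub>0 i h / real M - 1 / \<mu> i\<bar>)) \<longlonglongrightarrow> 0" for i
    by (rule visits_lln[OF _ poisson_equation(1)[OF fin] poisson \<mu>]) (erule step_pmf_pos[OF kernel])
  have "(\<lambda>M. measure_pmf.expectation (mr_path Q i\<^sub>0 (Suc M)) (\<lambda>h. iexp (err_form F c i\<^sub>0 M h)))
    \<longlonglongrightarrow> exp (- (\<Sum>i\<in>UNIV. \<mu> i * measure_pmf.expectation (Q i) (\<lambda>s. (score F c i s)\<^sup>2)) / 2)"
    by (rule renewal_normalization[OF score_bound score_mean \<mu> lln err_form_eq_score_sums])
  moreover have "(\<integral>w. iexp (\<Sum>e\<in>F. c e * (case e of (i, j, k) \<Rightarrow> sqrt (real M) * (q_hat J S M w i j k - q i j k))) \<partial>P i\<^sub>0) =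
      measure_pmf.expectation (mr_path Q i\<^sub>0 (Suc M)) (\<lambda>h. iexp (err_form F c i\<^sub>0 M h))" for M
  proof -
    have m: "(\<lambda>w. (case e of (i, j, k) \<Rightarrow> sqrt (real M) * (q_hat J S M w i j k - q i j k))) \<in> borel_measurable (P i\<^sub>0)" for e
      by (cases e) (auto intro!: borel_measurable_times borel_measurable_diff q_hat_measurable)
    have "(\<integral>w. iexp (\<Sum>e\<in>F. c e * (case e of (i, j, k) \<Rightarrow> sqrt (real M) * (q_hat J S M w i j k - q i j k))) \<partial>P i\<^sub>0) =
       (\<integral>w. iexp (err_form F c i\<^sub>0 M (hist J S (Suc M) w)) \<partial>P i\<^sub>0)"
    proof (rule integral_cong_AE)
      note [measurable] = m
      show "(\<lambda>w. iexp (\<Sum>e\<in>F. c e * (case e of (i, j, k) \<Rightarrow> sqrt (real M) * (q_hat J S M w i j k - q i j k)))) \<in> borel_measurable (P i\<^sub>0)"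
        by measurable
      show "(\<lambda>w. iexp (err_form F c i\<^sub>0 M (hist J S (Suc M) w))) \<in> borel_measurable (P i\<^sub>0)"
        by (rule measurable_compose[OF hist_measurable]) simp
      show "AE w in P i\<^sub>0. iexp (\<Sum>e\<in>F. c e * (case e of (i, j, k) \<Rightarrow> sqrt (real M) * (q_hat J S M w i j k - q i j k))) =
          iexp (err_form F c i\<^sub>0 M (hist J S (Suc M) w))"
        using AE_regular[of i\<^sub>0] by eventually_elim (simp only: err_form_hist)
    qed
    also have "\<dots> = measure_pmf.expectation (mr_path Q i\<^sub>0 (Suc M)) (\<lambda>h. iexp (err_form F c i\<^sub>0 M h))"
      by (rule integral_hist)
    finally show ?thesis .
  qed
  ultimately show ?thesis
    unfolding score_variance_sum by (simp add: \<mu>_def[abs_def] del: mr_path.simps)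
qed

end

theorem theorem1p3:
  fixes q :: "'e::finite \<Rightarrow> 'e \<Rightarrow> nat \<Rightarrow> real"
    and P :: "'e \<Rightarrow> 'w measure"
    and J :: "nat \<Rightarrow> 'w \<Rightarrow> 'e"
    and S :: "nat \<Rightarrow> 'w \<Rightarrow> nat"
  assumes kernel: "semi_markov_kernel q"
    and chain: "markov_renewal_chain q P J S"
    and A1: "irreducible_chain P J"
    and A2: "aperiodic_chain P J S"
    and A3: "positive_recurrent_chain P J S"
  shows "\<exists>\<mu> :: ('e \<times> 'e \<times> nat \<Rightarrow> real) measure.
           centered_gaussian_law (asymp_var q (\<lambda>i. enn2real (mean_return P J S i))) \<mu> \<and>
           (\<forall>i\<^sub>0. converges_in_distribution (P i\<^sub>0)
              (\<lambda>M w (i, j, k). sqrt (real M) * (q_hat J S M w i j k - q i j k)) \<mu>)"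
proof -
  interpret markov_renewal q P J S by unfold_locales (fact kernel, fact chain)
  let ?V = "asymp_var q (\<lambda>i. enn2real (mean_return P J S i))"
  \<comment> \<open>The limit law is chosen before the initial state, so that one law serves every
    \<open>i\<^sub>0\<close>.\<close>
  obtain \<mu> where \<mu>: "centered_gaussian_law ?V \<mu>"
    unfolding asymp_var_eq
    using multinomial_gaussian_law_exists[of "\<lambda>i. enn2real (mean_return P J S i)" "step_pmf q"] by auto
  have "converges_in_distribution (P i\<^sub>0)
      (\<lambda>M w (i, j, k). sqrt (real M) * (q_hat J S M w i j k - q i j k)) \<mu>" for i\<^sub>0
  proof (rule Cramer_Wold)
    show "prob_space (P i\<^sub>0)" by (rule prob_space_P)
    show "prob_space \<mu>" "sets \<mu> = sets borel"
      using \<mu> by (auto simp: centered_gaussian_law_def centered_gaussian_system_def)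
    show "(\<lambda>w (i, j, k). sqrt (real M) * (q_hat J S M w i j k - q i j k)) \<in> borel_measurable (P i\<^sub>0)" for M
    proof (rule measurable_coordinatewise_then_product)
      fix e :: "'e \<times> 'e \<times> nat"
      show "(\<lambda>w. (case e of (i, j, k) \<Rightarrow> sqrt (real M) * (q_hat J S M w i j k - q i j k))) \<in> borel_measurable (P i\<^sub>0)"
        by (cases e) (auto intro!: borel_measurable_times borel_measurable_diff q_hat_measurable)
    qed
    fix F :: "('e \<times> 'e \<times> nat) set" and c assume F: "finite F"
    have "(\<integral>y. iexp (\<Sum>e\<in>F. c e * y e) \<partial>\<mu>) = exp (- (\<Sum>e\<in>F. \<Sum>e'\<in>F. c e * c e' * ?V e e') / 2)"
      using centered_gaussian_system_char[OF _ F, of \<mu> "\<lambda>e y. y e" ?V c] \<mu> by (simp add: centered_gaussian_law_def)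
    then show "(\<lambda>M. \<integral>w. iexp (\<Sum>e\<in>F. c e * (case e of (i, j, k) \<Rightarrow> sqrt (real M) * (q_hat J S M w i j k - q i j k))) \<partial>P i\<^sub>0)
        \<longlonglongrightarrow> (\<integral>y. iexp (\<Sum>e\<in>F. c e * y e) \<partial>\<mu>)"
      using estimator_char_tendsto[OF A1 A3, where F=F and c=c and i\<^sub>0=i\<^sub>0] by simp
  qed
  then show ?thesis using \<mu> by blast
qed

end
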